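(* There is a polynomial-time algorithm that decides whether a given tropical matrix has factor rank $3$.
   Context: The tropical semiring is $\mathbb{R}$ with $a\oplus b=\min\{a,b\}$ and $a\otimes b=a+b$; $(B\otimes C)_{ij}=\min_{\tau}\{B_{i\tau}+C_{\tau j}\}$. The factor rank of $A\in\mathbb{R}^{m\times n}$ is the smallest $k$ such that $A=B\otimes C$ for some $B\in\mathbb{R}^{m\times k}$, $C\in\mathbb{R}^{k\times n}$. Running time is measured in arithmetic operations, polynomial in $m$ and $n$. *)

theory Defs
  imports Complex_Main "Jordan_Normal_Form.Matrix"
begin

section \<open>Tropical matrices and factor rank\<close>

definition trop_mult :: "real mat \<Rightarrow> real mat \<Rightarrow> real mat" where
  "trop_mult B C = mat (dim_row B) (dim_col C)
     (\<lambda>(i, j). Min ((\<lambda>t. B $$ (i, t) + C $$ (t, j)) ` {..<dim_col B}))"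

text \<open>The inner dimension is required to be positive: over the reals (without an infinite
  element) a tropical product of inner dimension 0 would be an empty minimum, on which
  \<^const>\<open>Min\<close> is unspecified. A matrix with \<open>m, n \<ge> 1\<close> always has a factorization
  (with inner dimension \<open>n\<close>), so the \<open>LEAST\<close> is attained.\<close>

definition factor_rank :: "real mat \<Rightarrow> nat" where
  "factor_rank A = (LEAST k. k \<ge> 1 \<and>
     (\<exists>B \<in> carrier_mat (dim_row A) k. \<exists>C \<in> carrier_mat k (dim_col A). A = trop_mult B C))"

section \<open>Algorithms: programs for a unit-cost real RAM\<close>

text \<open>A program works on two unbounded memories, one of natural numbers (used for counters and
  addresses) and one of reals, both with indirect addressing. Real numbers can be combined by the
  field operations and compared. There is no rounding, no other passage from reals to
  naturals, no integer division, and the only real constants are 0 and 1, so that neither bit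
  operations on long integers at unit cost nor information hidden in a real constant is
  available. Subtraction of naturals is truncated, and \<open>x / 0 = 0\<close>.\<close>

datatype iexp = Num nat | ICell iexp | IAdd iexp iexp | ISub iexp iexp | IMul iexp iexp

datatype rexp = RZero | ROne | RCell iexp
  | RAdd rexp rexp | RSub rexp rexp | RMul rexp rexp | RDiv rexp rexp

datatype bexp = ILess iexp iexp | IEq iexp iexp | RLess rexp rexp | REq rexp rexp
  | BNot bexp | BAnd bexp bexp

text \<open>The first argument of an assignment is the address of the cell to be overwritten.\<close>

datatype com = Skip | IAssign iexp iexp | RAssign iexp rexp
  | Seq com com | Cond bexp com com | While bexp com

record state =
  imem :: "nat \<Rightarrow> nat"
  rmem :: "nat \<Rightarrow> real"

primrec ival :: "iexp \<Rightarrow> state \<Rightarrow> nat" where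
  "ival (Num k) s = k"
| "ival (ICell a) s = imem s (ival a s)"
| "ival (IAdd a b) s = ival a s + ival b s"
| "ival (ISub a b) s = ival a s - ival b s"
| "ival (IMul a b) s = ival a s * ival b s"

primrec rval :: "rexp \<Rightarrow> state \<Rightarrow> real" where
  "rval RZero s = 0"
| "rval ROne s = 1"
| "rval (RCell a) s = rmem s (ival a s)"
| "rval (RAdd a b) s = rval a s + rval b s"
| "rval (RSub a b) s = rval a s - rval b s"
| "rval (RMul a b) s = rval a s * rval b s"
| "rval (RDiv a b) s = rval a s / rval b s"

primrec bval :: "bexp \<Rightarrow> state \<Rightarrow> bool" where
  "bval (ILess a b) s \<longleftrightarrow> ival a s < ival b s"
| "bval (IEq a b) s \<longleftrightarrow> ival a s = ival b s"
| "bval (RLess a b) s \<longleftrightarrow> rval a s < rval b s"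
| "bval (REq a b) s \<longleftrightarrow> rval a s = rval b s"
| "bval (BNot b) s \<longleftrightarrow> \<not> bval b s"
| "bval (BAnd b c) s \<longleftrightarrow> bval b s \<and> bval c s"

text \<open>Evaluating an expression costs one unit per constant, memory access, arithmetic operation,
  comparison and connective occurring in it.\<close>

primrec icost :: "iexp \<Rightarrow> nat" where
  "icost (Num k) = 1"
| "icost (ICell a) = icost a + 1"
| "icost (IAdd a b) = icost a + icost b + 1"
| "icost (ISub a b) = icost a + icost b + 1"
| "icost (IMul a b) = icost a + icost b + 1"

primrec rcost :: "rexp \<Rightarrow> nat" where
  "rcost RZero = 1"
| "rcost ROne = 1"
| "rcost (RCell a) = icost a + 1"
| "rcost (RAdd a b) = rcost a + rcost b + 1"
| "rcost (RSub a b) = rcost a + rcost b + 1"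
| "rcost (RMul a b) = rcost a + rcost b + 1"
| "rcost (RDiv a b) = rcost a + rcost b + 1"

primrec bcost :: "bexp \<Rightarrow> nat" where
  "bcost (ILess a b) = icost a + icost b + 1"
| "bcost (IEq a b) = icost a + icost b + 1"
| "bcost (RLess a b) = rcost a + rcost b + 1"
| "bcost (REq a b) = rcost a + rcost b + 1"
| "bcost (BNot b) = bcost b + 1"
| "bcost (BAnd b c) = bcost b + bcost c + 1"

text \<open>\<open>exec c s t s'\<close>: started in \<open>s\<close>, the program \<open>c\<close> halts in \<open>s'\<close> after \<open>t\<close> units of time.\<close>

inductive exec :: "com \<Rightarrow> state \<Rightarrow> nat \<Rightarrow> state \<Rightarrow> bool" where
  Skip: "exec Skip s 1 s"
| IAssign: "exec (IAssign a e) s (icost a + icost e + 1)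
    (s\<lparr>imem := (imem s)(ival a s := ival e s)\<rparr>)"
| RAssign: "exec (RAssign a e) s (icost a + rcost e + 1)
    (s\<lparr>rmem := (rmem s)(ival a s := rval e s)\<rparr>)"
| Seq: "exec c1 s t1 s1 \<Longrightarrow> exec c2 s1 t2 s2 \<Longrightarrow> exec (Seq c1 c2) s (t1 + t2) s2"
| CondTrue: "bval b s \<Longrightarrow> exec c1 s t s' \<Longrightarrow> exec (Cond b c1 c2) s (bcost b + t + 1) s'"
| CondFalse: "\<not> bval b s \<Longrightarrow> exec c2 s t s' \<Longrightarrow> exec (Cond b c1 c2) s (bcost b + t + 1) s'"
| WhileFalse: "\<not> bval b s \<Longrightarrow> exec (While b c) s (bcost b + 1) s"
| WhileTrue: "bval b s \<Longrightarrow> exec c s t1 s1 \<Longrightarrow> exec (While b c) s1 t2 s2 \<Longrightarrow>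
    exec (While b c) s (bcost b + t1 + t2 + 1) s2"

lemma exec_deterministic:
  "exec c s t s' \<Longrightarrow> exec c s u s'' \<Longrightarrow> u = t \<and> s'' = s'"
proof (induction arbitrary: u s'' rule: exec.induct)
  case (Seq c1 s t1 s1 c2 t2 s2)
  from Seq.prems show ?case by cases (use Seq.IH in blast)
next
  case (WhileTrue b s c t1 s1 t2 s2)
  from WhileTrue.prems show ?case
    by cases (use WhileTrue.IH WhileTrue.hyps in blast)+
next
  case (CondTrue b s c1 t s' c2)
  from CondTrue.prems show ?case by cases (use CondTrue.IH CondTrue.hyps in blast)+
next
  case (CondFalse b s c2 t s' c1)
  from CondFalse.prems show ?case by cases (use CondFalse.IH CondFalse.hyps in blast)+
qed (auto elim: exec.cases)

text \<open>Input convention: the dimensions are in the natural-number cells 0 and 1, the entries are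
  stored row by row in the first \<open>m * n\<close> real cells, and all other cells are 0. The answer is read
  off from natural-number cell 0.\<close>

definition input_state :: "real mat \<Rightarrow> state" where
  "input_state A =
    \<lparr>imem = (\<lambda>_. 0)(0 := dim_row A, 1 := dim_col A),
     rmem = (\<lambda>k. if k < dim_row A * dim_col A
                 then A $$ (k div dim_col A, k mod dim_col A) else 0)\<rparr>"

text \<open>One program has to handle all matrix sizes. As \<open>m + n \<ge> 2\<close>, a bound by some polynomial in
  \<open>m\<close> and \<open>n\<close> is the same as a bound of the form \<open>K * (m + n) ^ d\<close>.\<close>

definition decides_in_poly_time :: "com \<Rightarrow> (real mat \<Rightarrow> bool) \<Rightarrow> bool" where
  "decides_in_poly_time c P \<longleftrightarrow>
    (\<exists>K d :: nat. \<forall>m \<ge> 1. \<forall>n \<ge> 1. \<forall>A \<in> carrier_mat m n.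
       \<exists>t s. exec c (input_state A) t s \<and> t \<le> K * (m + n) ^ d \<and>
             imem s 0 = (if P A then 1 else 0))"

end

theory Submission
  imports Defs "HOL-Analysis.Function_Topology"
begin

text \<open>Rows and columns of \<open>A\<close> are the vertices of a bipartite graph, and a factorization is a function \<open>U\<close> with
  \<open>U t u + U t v \<ge> A\<^sub>u\<^sub>v\<close> for the three colours \<open>t\<close>, where some colour is tight in every cell. For a colour \<open>t\<close> let
  \<open>e t s\<close> be the column minimizing \<open>U t - U s\<close> and \<open>f t s\<close> the corresponding row. These six columns and six rows
  determine lower bounds \<open>L\<close> for \<open>U\<close>, up to one real offset per colour, and comparing differences shows that every
  vertex exceeds its lower bound in at most one colour. Once \<open>L\<close> is known, it therefore remains to solve
  a system of difference constraints and of clauses with two literals \<open>U t u \<le> h\<close>, hence an instance of 2-SAT,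
  and any solution yields a factorization, whatever \<open>L\<close> was.

  At least two of the three offsets are differences of two entries of one row. For the third, take a factorization
  with the smallest possible column part. In it every column is reached from the first row by steps of tight cells
  and of cells in which no other colour is tight, and following such a path shows that the offset is
  a combination of four entries of \<open>A\<close> and two entries of the closure of the forced equalities. So polynomially many guesses suffice.

  The program is written with counting loops only, all of them up to the same bound, and so it takes
  polynomial time.\<close>

section \<open>Difference constraints and 2-satisfiability\<close>

text \<open>A cell needs one tight colour out of three, which looks like 3-SAT. Two literals suffice
  because each end is raised in at most one colour. If \<open>L\<close> excludes no colour at the
  cell, some colour is raised at neither end and is tight; if \<open>L\<close> excludes two, the
  third gives a linear equality; if it excludes one, only ends raised in the two different remaining
  colours are open, and there an upper bound for a single end already means tightness. Once literals
  are chosen the colours decouple, and inside a colour upper bounds can contradict the closed system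
  only singly or as a row-column pair, so conflicts are binary as well. \<open>L\<close> is explicit
  because row \<open>f t s\<close> and column \<open>e t r\<close> meet in a cell tight in
  \<open>t\<close> whenever \<open>t\<close>, \<open>s\<close>, \<open>r\<close> are distinct. In a
  colour these two cells form two row-column pairs, and the offset is the missing link between the
  pairs. The obstacle is a colour without a direct link. Its offset is read off from a closure that
  itself depends on \<open>L\<close>; the circle breaks because the forced equalities of a colour
  are defined by the lower bounds of the other two.\<close>

text \<open>A link \<open>(w, x, \<alpha>)\<close> stands for the constraint \<open>U w + U x \<le> \<alpha>\<close>, through which lower bounds \<open>K u v\<close> for sums
  \<open>U u + U v\<close> are propagated as in the Floyd-Warshall algorithm.\<close>

definition relax_step :: "'a \<Rightarrow> 'a \<Rightarrow> real \<Rightarrow> ('a \<Rightarrow> 'a \<Rightarrow> real) \<Rightarrow> 'a \<Rightarrow> 'a \<Rightarrow> real" where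
  "relax_step w x \<alpha> K = (\<lambda>u v. max (K u v) (K u w - \<alpha> + K x v))"

definition link_closed :: "'a \<Rightarrow> 'a \<Rightarrow> real \<Rightarrow> ('a \<Rightarrow> 'a \<Rightarrow> real) \<Rightarrow> bool" where
  "link_closed w x \<alpha> K \<longleftrightarrow> (\<forall>u v. K u w - \<alpha> + K x v \<le> K u v)"

text \<open>The hypothesis says that the link contradicts no known bound, i.e. there is no positive
  cycle. Passing through the link twice then gains nothing over passing once.\<close>

lemma relax_step_closed:
  assumes "K x w \<le> \<alpha>"
  shows "link_closed w x \<alpha> (relax_step w x \<alpha> K)"
  using assms unfolding link_closed_def relax_step_def by (smt (verit))

text \<open>This is why a single pass over all links suffices, as in the Floyd-Warshall
  algorithm.\<close>

lemma relax_step_preserves_closed: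
  assumes "K x w \<le> \<alpha>" "link_closed w' x' \<alpha>' K"
  shows "link_closed w' x' \<alpha>' (relax_step w x \<alpha> K)"
  unfolding link_closed_def
proof (intro allI)
  fix u v
  have c: "\<And>u v. K u w' - \<alpha>' + K x' v \<le> K u v"
    using assms(2) by (auto simp: link_closed_def)
  show "relax_step w x \<alpha> K u w' - \<alpha>' + relax_step w x \<alpha> K x' v \<le> relax_step w x \<alpha> K u v"
    \<comment> \<open>The four instances correspond to which of the two summands on the left already
      passes through the new link.\<close>
    using c[of u v] c[of u w] c[of x v] c[of x w] assms(1)
    unfolding relax_step_def by (smt (verit))
qed

lemma relax_step_ge: "K u v \<le> relax_step w x \<alpha> K u v"
  by (simp add: relax_step_def)

text \<open>Literals carry no negation: a conflict relation replaces it, because a literal stands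
  for an upper bound and its falsity is never enforced as a constraint.\<close>

definition hits :: "('l \<Rightarrow> 'l \<Rightarrow> bool) \<Rightarrow> 'l set \<Rightarrow> bool" where
  "hits P S \<longleftrightarrow> (\<forall>l k. P l k \<longrightarrow> l \<in> S \<or> k \<in> S)"

definition avoids :: "('l \<Rightarrow> 'l \<Rightarrow> bool) \<Rightarrow> 'l set \<Rightarrow> bool" where
  "avoids Q S \<longleftrightarrow> (\<forall>l\<in>S. \<forall>k\<in>S. \<not> Q l k)"

text \<open>A literal is hopeless if its consequences under \<open>R\<close> contain a conflict. A maximal closed set free of conflicts
  hits every clause, since otherwise it could be enlarged by the consequences of a literal that is not hopeless.\<close>

lemma two_sat:
  fixes P Q :: "'l \<Rightarrow> 'l \<Rightarrow> bool"
  assumes fin: "finite V" and PV: "\<And>l k. P l k \<Longrightarrow> l \<in> V \<and> k \<in> V"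
    and symP: "\<And>l k. P l k \<Longrightarrow> P k l" and symQ: "\<And>l k. Q l k \<Longrightarrow> Q k l"
    and refl: "\<And>l. l \<in> V \<Longrightarrow> R l l" 
    and step: "\<And>l z k. Q l z \<Longrightarrow> P z k \<Longrightarrow> l \<in> V \<Longrightarrow> R l k"
    and trans: "\<And>l k j. R l k \<Longrightarrow> R k j \<Longrightarrow> l \<in> V \<Longrightarrow> k \<in> V \<Longrightarrow> j \<in> V \<Longrightarrow> R l j"
    and good: "\<And>l k. P l k \<Longrightarrow> (\<forall>i\<in>V. \<forall>j\<in>V. R l i \<and> R l j \<longrightarrow> \<not> Q i j) \<or>
                 (\<forall>i\<in>V. \<forall>j\<in>V. R k i \<and> R k j \<longrightarrow> \<not> Q i j)"
  shows "\<exists>S\<subseteq>V. hits P S \<and> avoids Q S"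
proof -
  \<comment> \<open>Closed under unit propagation: a chosen \<open>l\<close> that conflicts with
    \<open>z\<close> rules \<open>z\<close> out, so a clause of \<open>z\<close> and
    \<open>k\<close> demands \<open>k\<close>.\<close>
  define cl where "cl S \<longleftrightarrow> S \<subseteq> V \<and> avoids Q S \<and> (\<forall>l z k. l \<in> S \<longrightarrow> Q l z \<longrightarrow> P z k \<longrightarrow> k \<in> S)" for S
  have "finite {S. cl S}" by (rule finite_subset[of _ "Pow V"]) (auto simp: cl_def fin)
  moreover have "{} \<in> {S. cl S}" by (auto simp: cl_def avoids_def)
  ultimately obtain S where S: "cl S" and max: "\<And>T. cl T \<Longrightarrow> S \<subseteq> T \<Longrightarrow> T = S"
    using finite_has_maximal[of "{S. cl S}"] by blast
  have "l \<in> S \<or> k \<in> S" if "P l k" for l k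
  proof (rule ccontr)
    have key: False if lk: "P l k" "l \<notin> S" "k \<notin> S" 
      and g: "\<forall>i\<in>V. \<forall>j\<in>V. R l i \<and> R l j \<longrightarrow> \<not> Q i j" for l k
    proof -
      define E where "E = {(x, y). \<exists>z. Q x z \<and> P z y}"
      define T where "T = {y. (l, y) \<in> E\<^sup>*}"
      have lV: "l \<in> V" using lk PV by blast
      have TV: "y \<in> V \<and> R l y" if "(l, y) \<in> E\<^sup>*" for y
        using that
      proof induction
        case base then show ?case using lV refl by blast
      next
        case (step x y)
        then obtain z where z: "Q x z" "P z y" by (auto simp: E_def)
        show ?case using step.IH z assms(6)[of x z y] PV trans lV by blast
      qed
      \<comment> \<open>By symmetry every implication has its contrapositive: a conflict of
        \<open>S\<close> with \<open>y\<close> would put \<open>z\<close> into \<open>S\<close>,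
        which conflicts with \<open>x\<close>. Followed back to \<open>l\<close>, it would put the
        other literal of the clause into \<open>S\<close>.\<close>
      have backw: "(l, y) \<in> E\<^sup>* \<Longrightarrow> \<forall>x\<in>S. \<not> Q x y" for y
      proof (induction rule: rtrancl_induct)
        case base
        show ?case using S lk symP unfolding cl_def by blast
      next
        case (step x y)
        then obtain z where z: "Q x z" "P z y" by (auto simp: E_def)
        show ?case
        proof (intro ballI notI)
          fix s assume "s \<in> S" "Q s y"
          then have "z \<in> S" using S z symP unfolding cl_def by blast
          then show False using step.IH z symQ by blast
        qed
      qed
      have "cl (S \<union> T)"
        unfolding cl_def
      proof (intro conjI allI impI)
        show "S \<union> T \<subseteq> V" using S TV by (auto simp: cl_def T_def)
        show "avoids Q (S \<union> T)"
          using S backw g TV symQ unfolding avoids_def cl_def T_def by blast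
        fix x z y assume "x \<in> S \<union> T" "Q x z" "P z y"
        then show "y \<in> S \<union> T"
          using S unfolding cl_def T_def E_def
          by (auto intro: rtrancl_into_rtrancl)
      qed
      then have "S \<union> T = S" using max by blast
      moreover have "l \<in> T" by (simp add: T_def)
      ultimately show False using lk by blast
    qed
    assume "\<not> (l \<in> S \<or> k \<in> S)"
    then show False using good[OF that] key[OF that] key[OF symP[OF that]] by blast
  qed
  then show ?thesis using S by (auto simp: cl_def hits_def)
qed

text \<open>The columns are chosen as small and the rows then as large as possible.\<close>

lemma extend_bounds:
  fixes a K :: "'r \<Rightarrow> 'c \<Rightarrow> real" and Hr :: "'r \<Rightarrow> real set" and Hc :: "'c \<Rightarrow> real set"
  assumes fin: "finite I" "finite J" "\<And>i. i \<in> I \<Longrightarrow> finite (Hr i)"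
    and Ka: "\<And>i j. i \<in> I \<Longrightarrow> j \<in> J \<Longrightarrow> a i j \<le> K i j"
    and Kc: "\<And>i j i' j'. i \<in> I \<Longrightarrow> j \<in> J \<Longrightarrow> i' \<in> I \<Longrightarrow> j' \<in> J \<Longrightarrow> F i' j' \<Longrightarrow>
              K i j' - a i' j' + K i' j \<le> K i j"
    and lr: "\<And>i h. i \<in> I \<Longrightarrow> h \<in> Hr i \<Longrightarrow> lr i \<le> h"
    and lc: "\<And>j h. j \<in> J \<Longrightarrow> h \<in> Hc j \<Longrightarrow> lc j \<le> h"
    and nc: "\<And>i j h h'. i \<in> I \<Longrightarrow> j \<in> J \<Longrightarrow> h \<in> Hr i \<Longrightarrow> h' \<in> Hc j \<Longrightarrow> K i j \<le> h + h'"
    and Fr: "\<And>i j. i \<in> I \<Longrightarrow> j \<in> J \<Longrightarrow> F i j \<Longrightarrow> a i j - lc j \<in> Hr i"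
    and Fc: "\<And>i j. i \<in> I \<Longrightarrow> j \<in> J \<Longrightarrow> F i j \<Longrightarrow> a i j - lr i \<in> Hc j"
  shows "\<exists>Y C. (\<forall>i\<in>I. lr i \<le> Y i \<and> (\<forall>h\<in>Hr i. Y i \<le> h)) \<and> (\<forall>j\<in>J. lc j \<le> C j \<and> (\<forall>h\<in>Hc j. C j \<le> h)) \<and>
     (\<forall>i\<in>I. \<forall>j\<in>J. a i j \<le> Y i + C j \<and> (F i j \<longrightarrow> Y i + C j \<le> a i j))"
proof -
  define Cs where "Cs j = insert (lc j) (\<Union>i\<in>I. (\<lambda>h. K i j - h) ` Hr i)" for j
  define C where "C j = Max (Cs j)" for j
  have finC: "finite (Cs j)" for j using fin by (auto simp: Cs_def)
  \<comment> \<open>\<open>M i\<close> is the largest lower bound of row \<open>i\<close>. As a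
    candidate of \<open>Min\<close> it is the value of a row without caps; the remaining steps check
    that no other candidate undercuts a lower bound.\<close>
  define M where "M i = Max (insert (lr i) ((\<lambda>j. a i j - C j) ` J))" for i
  define Ys where "Ys i = insert (M i) (Hr i \<union> (\<lambda>j. a i j - C j) ` {j\<in>J. F i j})" for i
  define Y where "Y i = Min (Ys i)" for i
  have finY: "finite (Ys i)" if "i \<in> I" for i using fin that by (auto simp: Ys_def)
  have C_lc: "lc j \<le> C j" for j unfolding C_def by (rule Max_ge[OF finC]) (simp add: Cs_def)
  have C_K: "K i j - h \<le> C j" if "i \<in> I" "h \<in> Hr i" for i j h
    unfolding C_def by (rule Max_ge[OF finC]) (use that in \<open>auto simp: Cs_def\<close>)
  have C_cases: "C j = lc j \<or> (\<exists>i\<in>I. \<exists>h\<in>Hr i. C j = K i j - h)" for j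
    using Max_in[OF finC, of j] unfolding C_def by (auto simp: Cs_def)
  have Y_le: "Y i \<le> y" if "i \<in> I" "y \<in> Ys i" for i y
    unfolding Y_def using finY that by (intro Min_le) auto
  have Y_cases: "Y i = M i \<or> Y i \<in> Hr i \<or> (\<exists>j\<in>J. F i j \<and> Y i = a i j - C j)" if "i \<in> I" for i
    using Min_in[OF finY[OF that]] unfolding Y_def by (auto simp: Ys_def)
  have M1: "lr i \<le> M i" for i unfolding M_def by (rule Max_ge) (use fin in auto)
  have M2: "a i j - C j \<le> M i" if "j \<in> J" for i j unfolding M_def by (rule Max_ge) (use fin that in auto)
  have a1: "a i j \<le> Y i + C j" if ij: "i \<in> I" "j \<in> J" for i j
    using Y_cases[OF ij(1)]
  proof (elim disjE bexE conjE)
    assume "Y i = M i" then show ?thesis using M2[OF ij(2), of i] by linarith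
  next
    assume "Y i \<in> Hr i" then show ?thesis using C_K[OF ij(1), of "Y i" j] Ka[OF ij] by linarith
  next
    fix j' assume j': "j' \<in> J" "F i j'" "Y i = a i j' - C j'"
    \<comment> \<open>If \<open>C j'\<close> equals its lower bound, the value forced by the cell is
      itself a cap of the row by \<open>Fr\<close>. Otherwise \<open>C j'\<close> stems from a row
      cap, and \<open>Kc\<close> transports that demand across the forced cell to
      \<open>j\<close>.\<close>
    from C_cases[of j'] show ?thesis
    proof (elim disjE bexE)
      assume "C j' = lc j'"
      then show ?thesis using C_K[OF ij(1) Fr[OF ij(1) j'(1,2)], of j] Ka[OF ij] j' by linarith
    next
      fix i' h assume h: "i' \<in> I" "h \<in> Hr i'" "C j' = K i' j' - h"
      show ?thesis using C_K[OF h(1,2), of j] Kc[OF h(1) ij(2) ij(1) j'(1,2)] Ka[OF ij] h j' by linarith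
    qed
  qed
  have a2: "lr i \<le> Y i" if i: "i \<in> I" for i
    using Y_cases[OF i]
  proof (elim disjE bexE conjE)
    assume "Y i = M i" then show ?thesis using M1 by simp
  next
    assume "Y i \<in> Hr i" then show ?thesis using lr i by blast
  next
    fix j assume j: "j \<in> J" "F i j" "Y i = a i j - C j"
    from C_cases[of j] show ?thesis
    proof (elim disjE bexE)
      assume "C j = lc j"
      then show ?thesis using lr[OF i Fr[OF i j(1,2)]] j by linarith
    next
      fix i' h assume h: "i' \<in> I" "h \<in> Hr i'" "C j = K i' j - h"
      show ?thesis using nc[OF h(1) j(1) h(2) Fc[OF i j(1,2)]] h j by linarith
    qed
  qed
  have a3: "C j \<le> h" if j: "j \<in> J" "h \<in> Hc j" for j h
    using C_cases[of j]
  proof (elim disjE bexE)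
    assume "C j = lc j" then show ?thesis using lc j by metis
  next
    fix i h' assume h: "i \<in> I" "h' \<in> Hr i" "C j = K i j - h'"
    then show ?thesis using nc[OF h(1) j(1) h(2) j(2)] by linarith
  qed
  have a4: "Y i + C j \<le> a i j" if "i \<in> I" "j \<in> J" "F i j" for i j
    using Y_le[of i "a i j - C j"] that by (auto simp: Ys_def)
  show ?thesis
    by (rule exI[of _ Y], rule exI[of _ C]) (use a1 a2 a3 a4 C_lc Y_le in \<open>auto simp: Ys_def\<close>)
qed

section \<open>The relaxed problem\<close>

text \<open>The vertices below \<open>m\<close> are rows, and \<open>m + j\<close> is column \<open>j\<close>. The literal \<open>(t, u, v)\<close> says that \<open>U t u\<close> is at most
  \<open>cap L (t, u, v)\<close>: for \<open>u = v\<close>, that \<open>u\<close> is not raised above \<open>L\<close> in colour \<open>t\<close>; for \<open>u \<noteq> v\<close>, that the cell \<open>(u, v)\<close>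
  may be tight in colour \<open>t\<close> with \<open>v\<close> not raised.\<close>

type_synonym lit = "nat \<times> nat \<times> nat"

lemma other_colours:
  assumes "r < (3 :: nat)"
  obtains s t where "s < 3" "t < 3" "s \<noteq> t" "s \<noteq> r" "t \<noteq> r" "3 - s - t = r" "3 - t - s = r"
    "3 - s - r = t" "\<And>k. k < 3 \<Longrightarrow> k = r \<or> k = s \<or> k = t"
proof -
  consider "r = 0" | "r = 1" | "r = 2" using assms by linarith
  then show ?thesis
  proof cases
    case 1 then show ?thesis by (intro that[of 1 2]) auto
  next
    case 2 then show ?thesis by (intro that[of 0 2]) auto
  next
    case 3 then show ?thesis by (intro that[of 0 1]) auto
  qed
qed

locale bipartite_form =
  fixes m n :: nat and a :: "nat \<Rightarrow> nat \<Rightarrow> real"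
  assumes m_pos: "0 < m" and n_pos: "0 < n" and a_sym: "a u v = a v u"
begin

definition opp :: "nat \<Rightarrow> nat \<Rightarrow> bool" where
  "opp u v \<longleftrightarrow> u < m + n \<and> v < m + n \<and> (u < m) \<noteq> (v < m)"

lemma opp_sym: "opp u v \<longleftrightarrow> opp v u"
  by (auto simp: opp_def)

definition covers :: "(nat \<Rightarrow> nat \<Rightarrow> real) \<Rightarrow> bool" where
  "covers U \<longleftrightarrow> (\<forall>u v. opp u v \<longrightarrow>
     (\<forall>t<3. a u v \<le> U t u + U t v) \<and> (\<exists>t<3. U t u + U t v = a u v))"

definition excluded :: "(nat \<Rightarrow> nat \<Rightarrow> real) \<Rightarrow> nat \<Rightarrow> nat \<Rightarrow> nat \<Rightarrow> bool" where
  "excluded L t u v \<longleftrightarrow> a u v < L t u + L t v"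

definition forced :: "(nat \<Rightarrow> nat \<Rightarrow> real) \<Rightarrow> nat \<Rightarrow> nat \<Rightarrow> nat \<Rightarrow> bool" where
  "forced L t i j \<longleftrightarrow> i < m \<and> m \<le> j \<and> j < m + n \<and> (\<forall>s<3. s \<noteq> t \<longrightarrow> excluded L s i j)"

definition cap :: "(nat \<Rightarrow> nat \<Rightarrow> real) \<Rightarrow> lit \<Rightarrow> real" where
  "cap L = (\<lambda>(t, u, v). if u = v then L t u else a u v - L t v)"

definition lits :: "lit set" where
  "lits = {(t, u, v). t < 3 \<and> u < m + n \<and> v < m + n \<and> (u = v \<or> opp u v)}"

text \<open>For \<open>L\<close> below \<open>U\<close>, tightness of the cell in \<open>s\<close>
  implies \<open>(s, u, v)\<close> and tightness in \<open>t\<close> implies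
  \<open>(t, v, u)\<close>. The ends are crossed because the open case is that of ends raised in
  different colours, where the cap of one end and the lower bound of the other add up to the entry.
  The third colour is \<open>3 - s - t\<close>.\<close>

definition clause :: "(nat \<Rightarrow> nat \<Rightarrow> real) \<Rightarrow> lit \<Rightarrow> lit \<Rightarrow> bool" where
  "clause L = (\<lambda>(s, u, v) (t, w, x). s < 3 \<and> t < 3 \<and> s \<noteq> t \<and> u < m + n \<and> v < m + n \<and> w = v \<and> x = u \<and>
     (u = v \<or> opp u v \<and> excluded L (3 - s - t) u v))"

text \<open>The first two disjuncts compare a row cap and a column cap with the closed bound for
  their sum. The last one lets a literal clash with itself, which forbids it. Together they mirror
  the compatibility hypotheses of \<open>extend_bounds\<close>.\<close>

definition clash :: "(nat \<Rightarrow> nat \<Rightarrow> real) \<Rightarrow> (nat \<Rightarrow> nat \<Rightarrow> nat \<Rightarrow> real) \<Rightarrow> lit \<Rightarrow> lit \<Rightarrow> bool" where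
  "clash L K l k \<longleftrightarrow> l \<in> lits \<and> k \<in> lits \<and>
     (case (l, k) of ((s, u, v), (t, w, x)) \<Rightarrow> s = t \<and>
       (u < m \<and> \<not> w < m \<and> cap L l + cap L k < K t u w \<or>
        w < m \<and> \<not> u < m \<and> cap L l + cap L k < K t w u \<or>
        l = k \<and> cap L l < L s u))"

definition closed_under :: "(nat \<Rightarrow> nat \<Rightarrow> real) \<Rightarrow> (nat \<Rightarrow> nat \<Rightarrow> nat \<Rightarrow> real) \<Rightarrow> bool" where
  "closed_under L K \<longleftrightarrow> (\<forall>t<3. \<forall>i<m. \<forall>j. m \<le> j \<and> j < m + n \<longrightarrow> a i j \<le> K t i j \<and>
     (\<forall>i'<m. \<forall>j'. forced L t i' j' \<longrightarrow> K t i j' - a i' j' + K t i' j \<le> K t i j))"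

definition consistent :: "(nat \<Rightarrow> nat \<Rightarrow> real) \<Rightarrow> (nat \<Rightarrow> nat \<Rightarrow> nat \<Rightarrow> real) \<Rightarrow> (lit \<Rightarrow> lit \<Rightarrow> bool) \<Rightarrow> bool" where
  "consistent L K R \<longleftrightarrow> (\<forall>l\<in>lits. \<forall>k\<in>lits. clause L l k \<longrightarrow>
      (\<forall>i\<in>lits. \<forall>j\<in>lits. R l i \<and> R l j \<longrightarrow> \<not> clash L K i j) \<or>
      (\<forall>i\<in>lits. \<forall>j\<in>lits. R k i \<and> R k j \<longrightarrow> \<not> clash L K i j))"

lemma clause_sym: "clause L l k \<Longrightarrow> clause L k l"
  using a_sym by (auto simp: clause_def opp_sym excluded_def add.commute diff_commute split: prod.splits)

lemma clash_sym: "clash L K l k \<Longrightarrow> clash L K k l"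
  by (auto simp: clash_def add.commute split: prod.splits)

lemma clause_lits: "clause L l k \<Longrightarrow> l \<in> lits \<and> k \<in> lits"
  by (auto simp: clause_def lits_def opp_def split: prod.splits)

lemma finite_lits: "finite lits"
  by (rule finite_subset[of _ "{..<3} \<times> {..<m+n} \<times> {..<m+n}"]) (auto simp: lits_def)

lemma bounds_imp_covers:
  assumes LU: "\<And>t u. t < 3 \<Longrightarrow> u < m + n \<Longrightarrow> L t u \<le> U t u"
    and ge: "\<And>t i j. t < 3 \<Longrightarrow> i < m \<Longrightarrow> m \<le> j \<Longrightarrow> j < m + n \<Longrightarrow> a i j \<le> U t i + U t j"
    and F: "\<And>t i j. t < 3 \<Longrightarrow> forced L t i j \<Longrightarrow> U t i + U t j \<le> a i j"
    and P: "\<And>l k. clause L l k \<Longrightarrow> U (fst l) (fst (snd l)) \<le> cap L l \<or> U (fst k) (fst (snd k)) \<le> cap L k"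
  shows "covers U"
proof -
  have one: "U s u \<le> L s u \<or> U t u \<le> L t u" if "s < 3" "t < 3" "s \<noteq> t" "u < m + n" for s t u
    using P[of "(s, u, u)" "(t, u, u)"] that by (auto simp: clause_def cap_def)
  have two: "U s u \<le> a u v - L s v \<or> U t v \<le> a v u - L t u"
    if "s < 3" "t < 3" "s \<noteq> t" "opp u v" "excluded L (3 - s - t) u v" for s t u v
    using P[of "(s, u, v)" "(t, v, u)"] that by (auto simp: clause_def cap_def opp_def)
  have cov: "\<exists>t<3. U t i + U t j \<le> a i j" if i: "i < m" and j: "m \<le> j" "j < m + n" for i j
  proof (rule ccontr)
    assume "\<not> ?thesis"
    then have N: "\<And>t. t < 3 \<Longrightarrow> a i j < U t i + U t j" by force
    have o: "opp i j" "opp j i" using i j by (auto simp: opp_def)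
    have fin3: "t = 0 \<or> t = 1 \<or> t = 2" if "t < 3" for t :: nat using that by linarith
    show False
    proof (cases "\<exists>r<3. excluded L r i j")
      case False
      \<comment> \<open>Each end is raised in at most one of the three colours, so some colour is
        raised at neither; there \<open>L\<close> bounds both summands from above.\<close>
      have "u < m + n \<Longrightarrow> U 0 u \<le> L 0 u \<or> U 1 u \<le> L 1 u" "u < m + n \<Longrightarrow> U 0 u \<le> L 0 u \<or> U 2 u \<le> L 2 u"
        "u < m + n \<Longrightarrow> U 1 u \<le> L 1 u \<or> U 2 u \<le> L 2 u" for u
        using one[of 0 1 u] one[of 0 2 u] one[of 1 2 u] by auto
      from this[of i] this[of j] i j
      have "U 0 i \<le> L 0 i \<and> U 0 j \<le> L 0 j \<or> U 1 i \<le> L 1 i \<and> U 1 j \<le> L 1 j \<or> U 2 i \<le> L 2 i \<and> U 2 j \<le> L 2 j"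
        by auto
      then obtain t where "t < 3" "U t i \<le> L t i" "U t j \<le> L t j"
        using that[of 0] that[of 1] that[of 2] by auto
      moreover have "L t i + L t j \<le> a i j" using False \<open>t < 3\<close> by (metis excluded_def not_less)
      ultimately show False using N[of t] by linarith
    next
      case True
      then obtain r where r: "r < 3" "excluded L r i j" by blast
      obtain s t where st: "s < 3" "t < 3" "s \<noteq> t" "s \<noteq> r" "t \<noteq> r" "3 - s - t = r" "3 - t - s = r"
        "\<And>k. k < 3 \<Longrightarrow> k = r \<or> k = s \<or> k = t"
        using other_colours[OF r(1)] by metis
      \<comment> \<open>Were a second colour excluded as well, the cell would be forced in the
        remaining one and hence tight by \<open>F\<close>.\<close>
      have nf: "\<not> excluded L s i j" if "s < 3" "t < 3" "s \<noteq> r" "t \<noteq> r" "s \<noteq> t" "\<And>k. k < 3 \<Longrightarrow> k = r \<or> k = s \<or> k = t" for s t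
        using F[of t i j] N[of t] that r i j unfolding forced_def by force
      have "\<not> excluded L s i j" "\<not> excluded L t i j" using nf st by blast+
      moreover have "L s i \<le> U s i" "L t i \<le> U t i" "L s j \<le> U s j" "L t j \<le> U t j"
        using LU st i j by auto
      moreover have "U s i \<le> a i j - L s j \<or> U t j \<le> a i j - L t i"
        using two[of s t i j] st r o a_sym[of i j] by simp
      moreover have "U t i \<le> a i j - L t j \<or> U s j \<le> a i j - L s i"
        using two[of t s i j] st r o a_sym[of i j] by simp
      moreover have "U s i \<le> L s i \<or> U t i \<le> L t i" "U s j \<le> L s j \<or> U t j \<le> L t j"
        using one st i j by auto
      \<comment> \<open>A colour unraised at both ends is tight, as it is not excluded. Otherwise
        one end is unraised in \<open>s\<close> and the other in \<open>t\<close>, and one of the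
        two crossed clauses combines an unraised end with a cap of the other end.\<close>
      ultimately show False
        using N[OF st(1)] N[OF st(2)] unfolding excluded_def by (elim disjE) linarith+
    qed
  qed
  show ?thesis
    unfolding covers_def
  proof (intro allI impI)
    fix u v assume o: "opp u v"
    obtain i j where ij: "i < m" "m \<le> j" "j < m + n" "(i = u \<and> j = v) \<or> (i = v \<and> j = u)"
      using o by (auto simp: opp_def)
    then obtain t where "t < 3" "U t i + U t j \<le> a i j" using cov by blast
    with ij ge a_sym show "(\<forall>t<3. a u v \<le> U t u + U t v) \<and> (\<exists>t<3. U t u + U t v = a u v)"
      by (metis add.commute order_antisym)
  qed
qed

text \<open>Once a set of literals is fixed the colours no longer interact: in each colour the
  chosen literals become caps, and the absence of clashes is what \<open>extend_bounds\<close> asks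
  for.\<close>

theorem consistent_imp_covers:
  assumes K: "closed_under L K"
    and refl: "\<And>l. l \<in> lits \<Longrightarrow> R l l"
    and step: "\<And>l z k. clash L K l z \<Longrightarrow> clause L z k \<Longrightarrow> R l k"
    and trans: "\<And>l k j. R l k \<Longrightarrow> R k j \<Longrightarrow> l \<in> lits \<Longrightarrow> k \<in> lits \<Longrightarrow> j \<in> lits \<Longrightarrow> R l j"
    and con: "consistent L K R"
  shows "\<exists>U. covers U"
proof -
  have "\<exists>S\<subseteq>lits. hits (clause L) S \<and> avoids (clash L K) S"
  proof (rule two_sat[where R = R, OF finite_lits])
    show "(\<forall>i\<in>lits. \<forall>j\<in>lits. R l i \<and> R l j \<longrightarrow> \<not> clash L K i j) \<or>
      (\<forall>i\<in>lits. \<forall>j\<in>lits. R k i \<and> R k j \<longrightarrow> \<not> clash L K i j)" if "clause L l k" for l k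
      using con clause_lits[OF that] that unfolding consistent_def by blast
  qed (use step trans clause_lits clash_sym clause_sym in \<open>(blast intro: refl)+\<close>)
  then obtain S where S: "S \<subseteq> lits" "hits (clause L) S" "avoids (clash L K) S"
    by blast
  define H where "H t u = cap L ` {l \<in> S. fst l = t \<and> fst (snd l) = u}" for t u
  have HI: "cap L (t, u, v) \<in> H t u" if "(t, u, v) \<in> S" for t u v
    using that unfolding H_def by force
  have HE: "\<exists>v. (t, u, v) \<in> S \<and> h = cap L (t, u, v)" if "h \<in> H t u" for t u h
    using that unfolding H_def by force
  have finH: "finite (H t u)" for t u
    unfolding H_def using finite_subset[OF S(1) finite_lits] by simp
  \<comment> \<open>At a forced cell every other colour is excluded, so its literals clash with
    themselves and the clauses leave those of \<open>t\<close>. This supplies the caps that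
    \<open>extend_bounds\<close> wants for forced cells.\<close>
  have unit: "(t, i, j) \<in> S \<and> (t, j, i) \<in> S" if "t < 3" "forced L t i j" for t i j
  proof -
    obtain s where s: "s < 3" "s \<noteq> t" "3 - s - t < 3" "3 - s - t \<noteq> t" "3 - s - t \<noteq> s"
      using other_colours[OF \<open>t < 3\<close>] by metis
    have ij: "i < m" "m \<le> j" "j < m + n" "excluded L s i j" "excluded L (3 - s - t) i j"
      using that s by (auto simp: forced_def)
    have o: "opp i j" "opp j i" using ij by (auto simp: opp_def)
    have n': "excluded L s j i" "excluded L (3 - s - t) j i"
      using ij a_sym by (auto simp: excluded_def add.commute)
    have c1: "clause L (s, j, i) (t, i, j)" and c2: "clause L (s, i, j) (t, j, i)"
      using s that ij o n' by (auto simp: clause_def)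
    have "clash L K (s, j, i) (s, j, i)" "clash L K (s, i, j) (s, i, j)"
      using s ij o n' a_sym by (auto simp: clash_def lits_def cap_def excluded_def)
    then have "(s, j, i) \<notin> S" "(s, i, j) \<notin> S" using S(3) by (auto simp: avoids_def)
    then show ?thesis using c1 c2 S(2) unfolding hits_def by blast
  qed
  have lowH: "L t u \<le> h" if "h \<in> H t u" for t u h
  proof -
    obtain v where v: "(t, u, v) \<in> S" "h = cap L (t, u, v)" using HE[OF \<open>h \<in> H t u\<close>] by blast
    then have "\<not> clash L K (t, u, v) (t, u, v)" "(t, u, v) \<in> lits" using S by (auto simp: avoids_def)
    then show ?thesis using v by (auto simp: clash_def)
  qed
  have ncH: "K t i j \<le> h + h'" if "i < m" "m \<le> j" "h \<in> H t i" "h' \<in> H t j" for t i j h h'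
  proof -
    obtain v w where v: "(t, i, v) \<in> S" "h = cap L (t, i, v)" "(t, j, w) \<in> S" "h' = cap L (t, j, w)"
      using HE[OF \<open>h \<in> H t i\<close>] HE[OF \<open>h' \<in> H t j\<close>] by blast
    then have "\<not> clash L K (t, i, v) (t, j, w)" "(t, i, v) \<in> lits" "(t, j, w) \<in> lits"
      using S by (auto simp: avoids_def)
    then show ?thesis using v that by (auto simp: clash_def)
  qed
  have "\<exists>Y C. (\<forall>i\<in>{..<m}. L t i \<le> Y i \<and> (\<forall>h\<in>H t i. Y i \<le> h)) \<and>
      (\<forall>j\<in>{m..<m+n}. L t j \<le> C j \<and> (\<forall>h\<in>H t j. C j \<le> h)) \<and>
     (\<forall>i\<in>{..<m}. \<forall>j\<in>{m..<m+n}. a i j \<le> Y i + C j \<and> (forced L t i j \<longrightarrow> Y i + C j \<le> a i j))"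
    if t: "t < 3" for t
  proof (rule extend_bounds[where K = "K t"])
    fix i j assume ij: "i \<in> {..<m}" "j \<in> {m..<m + n}" "forced L t i j"
    then show "a i j - L t j \<in> H t i" "a i j - L t i \<in> H t j"
      using HI[of t i j] HI[of t j i] unit[OF t ij(3)] a_sym[of i j] by (auto simp: cap_def)
  qed (use K t finH lowH ncH in \<open>auto simp: closed_under_def\<close>)
  then obtain Y C where YC: "\<And>t. t < 3 \<Longrightarrow> (\<forall>i\<in>{..<m}. L t i \<le> Y t i \<and> (\<forall>h\<in>H t i. Y t i \<le> h)) \<and>
      (\<forall>j\<in>{m..<m+n}. L t j \<le> C t j \<and> (\<forall>h\<in>H t j. C t j \<le> h)) \<and>
     (\<forall>i\<in>{..<m}. \<forall>j\<in>{m..<m+n}. a i j \<le> Y t i + C t j \<and> (forced L t i j \<longrightarrow> Y t i + C t j \<le> a i j))"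
    by metis
  define U where "U t u = (if u < m then Y t u else C t u)" for t u
  have UH: "U t u \<le> h" if "t < 3" "u < m + n" "h \<in> H t u" for t u h
    using YC[OF that(1)] that by (cases "u < m") (auto simp: U_def)
  have "covers U"
  proof (rule bounds_imp_covers)
    show "L t u \<le> U t u" if "t < 3" "u < m + n" for t u
      using YC[OF that(1)] that by (cases "u < m") (auto simp: U_def)
    show "a i j \<le> U t i + U t j" if "t < 3" "i < m" "m \<le> j" "j < m + n" for t i j
      using YC[OF that(1)] that by (auto simp: U_def)
    show "U t i + U t j \<le> a i j" if "t < 3" "forced L t i j" for t i j
      using YC[OF that(1)] that by (auto simp: U_def forced_def)
    have S_le: "U (fst l) (fst (snd l)) \<le> cap L l" if "l \<in> S" for l
    proof -
      obtain t u v where l: "l = (t, u, v)" by (cases l)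
      then have "(t, u, v) \<in> lits" using S that by auto
      then show ?thesis using UH[of t u "cap L l"] HI[of t u v] that l by (auto simp: lits_def)
    qed
    show "U (fst l) (fst (snd l)) \<le> cap L l \<or> U (fst k) (fst (snd k)) \<le> cap L k" if "clause L l k" for l k
      using that S(2) S_le unfolding hits_def by blast
  qed
  then show ?thesis by blast
qed

end

section \<open>Extremal factorizations\<close>

lemma compact_box:
  fixes B :: "'k \<Rightarrow> real set"
  assumes "\<And>k. compact (B k)"
  shows "compact {C. \<forall>k. C k \<in> B k}"
proof -
  have "compactin (product_topology (\<lambda>_. euclidean) UNIV) (PiE UNIV B)"
    using assms by (subst compactin_PiE) (simp add: compactin_euclidean_iff)
  moreover have "PiE UNIV B = {C. \<forall>k. C k \<in> B k}" by (auto simp: PiE_def)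
  ultimately show ?thesis by (simp add: euclidean_product_topology compactin_euclidean_iff)
qed

text \<open>The index type may be infinite, so coordinates outside \<open>D\<close> are replaced by
  0. Inside \<open>D\<close> the lower bounds together with a sum not above that of
  \<open>C0\<close> bound every coordinate, and a compact box remains.\<close>

lemma minimal_sum_exists:
  fixes V :: "('k \<Rightarrow> real) set"
  assumes D: "finite D" and V: "closed V" "C0 \<in> V"
    and lo: "\<And>C k. C \<in> V \<Longrightarrow> k \<in> D \<Longrightarrow> lo k \<le> C k"
    and dep: "\<And>C. C \<in> V \<Longrightarrow> (\<lambda>k. if k \<in> D then C k else 0) \<in> V"
  shows "\<exists>C\<in>V. \<forall>C'\<in>V. sum C D \<le> sum C' D"
proof -
  define hi where "hi k = lo k + (sum C0 D - sum lo D)" for k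
  define X where "X = {C. \<forall>k. C k \<in> (if k \<in> D then {lo k..hi k} else {0})}"
  define cut where "cut C = (\<lambda>k. if k \<in> D then C k else 0 :: real)" for C
  have sum_cut: "sum (cut C) D = sum C D" for C by (simp add: cut_def)
  have inX: "cut C \<in> X" if "C \<in> V" "sum C D \<le> sum C0 D" for C
  proof -
    have "C k \<le> hi k" if k: "k \<in> D" for k
    proof -
      have "sum lo (D - {k}) \<le> sum C (D - {k})" by (rule sum_mono) (use lo \<open>C \<in> V\<close> in auto)
      then show ?thesis using sum.remove[OF D k, of C] sum.remove[OF D k, of lo] \<open>sum C D \<le> sum C0 D\<close>
        unfolding hi_def by linarith
    qed
    then show ?thesis using lo \<open>C \<in> V\<close> by (auto simp: X_def cut_def)
  qed
  have "compact X" unfolding X_def by (rule compact_box) auto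
  then have "compact (X \<inter> V)" using V by (simp add: compact_Int_closed)
  moreover have "cut C0 \<in> X \<inter> V" using inX[OF V(2)] dep[OF V(2)] by (auto simp: cut_def)
  moreover have "continuous_on (X \<inter> V) (\<lambda>C. sum C D)"
    by (intro continuous_on_sum continuous_on_subset[OF continuous_on_product_coordinates]) auto
  ultimately obtain C where C: "C \<in> X \<inter> V" "\<And>C'. C' \<in> X \<inter> V \<Longrightarrow> sum C D \<le> sum C' D"
    using continuous_attains_inf[of "X \<inter> V" "\<lambda>C. sum C D"] by blast
  have "sum C D \<le> sum C' D" if "C' \<in> V" for C'
  proof (cases "sum C' D \<le> sum C0 D")
    case True
    then show ?thesis using C(2)[of "cut C'"] inX[OF that] dep[OF that] sum_cut by (simp add: cut_def)
  next
    case False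
    then show ?thesis using C(2)[of "cut C0"] \<open>cut C0 \<in> X \<inter> V\<close> sum_cut[of C0] by simp
  qed
  then show ?thesis using C by blast
qed

context bipartite_form
begin

definition tight :: "(nat \<Rightarrow> nat \<Rightarrow> real) \<Rightarrow> nat \<Rightarrow> nat \<Rightarrow> nat \<Rightarrow> bool" where
  "tight U t u v \<longleftrightarrow> U t u + U t v = a u v"

definition only :: "(nat \<Rightarrow> nat \<Rightarrow> real) \<Rightarrow> nat \<Rightarrow> nat \<Rightarrow> nat \<Rightarrow> bool" where
  "only U t u v \<longleftrightarrow> (\<forall>s<3. s \<noteq> t \<longrightarrow> \<not> tight U s u v)"

text \<open>Lowering the column part of colour \<open>t\<close> outside of a set of columns is blocked by exactly the steps of a path:
  the cells of a row in the set that are tight, and those columns of the set whose cell depends on \<open>t\<close> alone.\<close>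

inductive path :: "(nat \<Rightarrow> nat \<Rightarrow> real) \<Rightarrow> nat \<Rightarrow> nat \<Rightarrow> nat \<Rightarrow> bool" for U t where
  here: "i < m \<Longrightarrow> opp i v \<Longrightarrow> tight U t i v \<Longrightarrow> path U t i v"
| step: "i < m \<Longrightarrow> opp i w \<Longrightarrow> tight U t i w \<Longrightarrow> j < m \<Longrightarrow> only U t j w \<Longrightarrow> path U t j v \<Longrightarrow> path U t i v"

lemma path_append:
  "path U t i w \<Longrightarrow> only U t j w \<Longrightarrow> j < m \<Longrightarrow> opp j v \<Longrightarrow> tight U t j v \<Longrightarrow> path U t i v"
  by (induction rule: path.induct) (auto intro: path.intros)

text \<open>Row 0 is the base point because its entries supply the lower bounds that make the
  minimum of the column parts exist.\<close>

definition extremal :: "(nat \<Rightarrow> nat \<Rightarrow> real) \<Rightarrow> bool" where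
  "extremal U \<longleftrightarrow> covers U \<and> (\<forall>t<3. \<forall>u<m+n. \<exists>v. opp u v \<and> tight U t u v) \<and>
     (\<forall>t<3. \<forall>v. m \<le> v \<and> v < m + n \<longrightarrow> path U t 0 v)"

lemma path_last_row:
  shows "path U t i v \<Longrightarrow> \<exists>j. opp v j \<and> tight U t v j"
proof (induction rule: path.induct)
  case (here i v)
  then have "opp v i" "tight U t v i" using a_sym[of i v] by (auto simp: opp_def tight_def add.commute)
  then show ?case by blast
qed

text \<open>Row parts are eliminated: for given column parts the least admissible row part is
  \<open>Y\<close>, and a cell is tight exactly if its column attains the maximum in the row.
  Normalized factorizations thus become a closed set of column parts, and a minimizer cannot be
  lowered on the columns that no path reaches.\<close>

lemma extremal_exists:
  assumes U0: "covers U0"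
  shows "\<exists>U. extremal U"
proof -
  define J where "J = {m..<m+n}"
  define D where "D = {..<3::nat} \<times> J"
  define ok where "ok C t i j \<longleftrightarrow> (\<forall>j'\<in>J. a i j' - C (t, j') \<le> a i j - C (t, j))" for C :: "nat \<times> nat \<Rightarrow> real" and t i j
  \<comment> \<open>The bound by row 0 fixes the shift between rows and columns in each colour;
    without it the sums would have no minimum.\<close>
  define V where "V = {C. (\<forall>t\<in>{..<3}. \<forall>j\<in>J. a 0 j \<le> C (t, j)) \<and> (\<forall>i\<in>{..<m}. \<forall>j\<in>J. \<exists>t\<in>{..<3}. ok C t i j)}"
  \<comment> \<open>The column parts of \<open>U0\<close> after the shift that makes the part of row
    0 equal to 0.\<close>
  define C0 where "C0 = (\<lambda>(t, j). U0 t j + U0 t 0)"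
  have finJ: "finite J" by (simp add: J_def)
  have J0: "m \<in> J" using n_pos by (simp add: J_def)
  have oppJ: "opp i j" "opp j i" if "i < m" "j \<in> J" for i j using that by (auto simp: opp_def J_def)
  have half: "closed {C :: nat \<times> nat \<Rightarrow> real. c - C k \<le> d - C l}" "closed {C :: nat \<times> nat \<Rightarrow> real. c \<le> C k}" for c d k l
    by (intro closed_Collect_le continuous_intros continuous_on_product_coordinates)+
  have "V = (\<Inter>t<3. \<Inter>j\<in>J. {C. a 0 j \<le> C (t, j)}) \<inter>
      (\<Inter>i<m. \<Inter>j\<in>J. \<Union>t<3. \<Inter>j'\<in>J. {C. a i j' - C (t, j') \<le> a i j - C (t, j)})"
    by (auto simp: V_def ok_def)
  then have "closed V" using finJ
    by (simp only:) (intro closed_Int closed_INT closed_UN half finite_lessThan ballI)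
  moreover have "C0 \<in> V"
    unfolding V_def
  proof (intro CollectI conjI ballI)
    fix t j assume "t \<in> {..<3 :: nat}" "j \<in> J"
    then show "a 0 j \<le> C0 (t, j)"
      using U0 oppJ[of 0 j] m_pos unfolding covers_def C0_def by (auto simp: add.commute)
  next
    fix i j assume ij: "i \<in> {..<m}" "j \<in> J"
    then have "opp i j" using oppJ by auto
    then obtain t where t: "t < 3" "U0 t i + U0 t j = a i j"
      using U0 unfolding covers_def by blast
    have "a i j' \<le> U0 t i + U0 t j'" if "j' \<in> J" for j'
      using U0 oppJ[of i j'] ij t that unfolding covers_def by auto
    then have "ok C0 t i j" using t unfolding ok_def C0_def by fastforce
    then show "\<exists>t\<in>{..<3}. ok C0 t i j" using t by auto
  qed
  moreover have "(\<lambda>k. if k \<in> D then C k else 0) \<in> V" if "C \<in> V" for C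
    using that unfolding V_def ok_def D_def by auto
  moreover have "finite D" using finJ by (simp add: D_def)
  ultimately obtain C where CV: "C \<in> V" and Cmin: "\<And>C'. C' \<in> V \<Longrightarrow> sum C D \<le> sum C' D"
    using minimal_sum_exists[of D V C0 "\<lambda>(t, j). a 0 j"] unfolding D_def V_def by force
  have C0le: "a 0 j \<le> C (t, j)" if "t < 3" "j \<in> J" for t j using CV that by (auto simp: V_def)
  have Cok: "\<exists>t<3. ok C t i j" if "i < m" "j \<in> J" for i j using CV that unfolding V_def by blast
  define Y where "Y t i = Max ((\<lambda>j. a i j - C (t, j)) ` J)" for t i
  have Yge: "a i j \<le> Y t i + C (t, j)" if "j \<in> J" for t i j
  proof -
    have "a i j - C (t, j) \<le> Y t i" unfolding Y_def using that finJ by (intro Max_ge) auto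
    then show ?thesis by linarith
  qed
  have Yat: "\<exists>j\<in>J. a i j = Y t i + C (t, j)" for t i
  proof -
    have "Y t i \<in> (\<lambda>j. a i j - C (t, j)) ` J" unfolding Y_def using J0 finJ by (intro Max_in) auto
    then obtain j where "j \<in> J" "Y t i = a i j - C (t, j)" by auto
    then show ?thesis by (intro bexI[of _ j]) auto
  qed
  have ok_iff: "ok C t i j \<longleftrightarrow> Y t i + C (t, j) = a i j" if "j \<in> J" for t i j
    using Yge[OF that, of i t] Yat[of i t] Yge[of _ i t] that unfolding ok_def by (smt (verit))
  define U where "U t u = (if u < m then Y t u else C (t, u))" for t u
  have tight_iff: "tight U t i j \<longleftrightarrow> ok C t i j" "tight U t j i \<longleftrightarrow> ok C t i j" if "i < m" "j \<in> J" for t i j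
    using that ok_iff[OF that(2), of t i] a_sym[of i j] by (auto simp: tight_def U_def J_def add.commute)
  have cov: "covers U"
    unfolding covers_def
  proof (intro allI impI)
    fix u v assume "opp u v"
    then obtain i j where ij: "i < m" "j \<in> J" "(i = u \<and> j = v) \<or> (i = v \<and> j = u)"
      by (auto simp: opp_def J_def)
    then have "a i j \<le> U t i + U t j" for t using Yge[of j i t] by (auto simp: U_def J_def)
    moreover obtain t where "t < 3" "tight U t i j" using Cok ij tight_iff by blast
    ultimately show "(\<forall>t<3. a u v \<le> U t u + U t v) \<and> (\<exists>t<3. U t u + U t v = a u v)"
      using ij(3) a_sym unfolding tight_def by (auto simp: add.commute)
  qed
  have reach: "path U t 0 v" if t: "t < 3" and v: "v \<in> J" for t v
  proof (rule ccontr)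
    assume nv: "\<not> path U t 0 v"
    define N where "N = {j\<in>J. \<not> path U t 0 j}"
    \<comment> \<open>The amounts by which unreached columns may drop before the bound by row 0
      fails or a reached column loses the maximum in a cell that depends on \<open>t\<close> alone.
      The element 1 makes the set nonempty.\<close>
    define slack where "slack = insert 1 ((\<lambda>j. C (t, j) - a 0 j) ` N \<union>
      (\<lambda>(i, j, j'). (a i j - C (t, j)) - (a i j' - C (t, j'))) `
        {(i, j, j') \<in> {..<m} \<times> J \<times> N. only U t i j \<and> j \<notin> N})"
    have finN: "finite N" using finJ by (simp add: N_def)
    have fs: "finite slack"
      unfolding slack_def using finJ finN
      by (intro finite.insertI finite_UnI finite_imageI) (auto intro: finite_subset[of _ "{..<m} \<times> J \<times> N"])
    have pos: "0 < x" if "x \<in> slack" for x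
      using that unfolding slack_def
    proof (elim insertE UnE imageE; clarsimp)
      fix j assume j: "j \<in> N"
      then have "\<not> tight U t 0 j" using path.here[of 0 j U t] m_pos oppJ[of 0 j] by (auto simp: N_def)
      then have "\<not> ok C t 0 j" using tight_iff[of 0 j] m_pos j by (auto simp: N_def)
      then obtain j' where "j' \<in> J" "a 0 j - C (t, j) < a 0 j' - C (t, j')" by (auto simp: ok_def not_le)
      then show "a 0 j < C (t, j)" using C0le[OF t, of j'] by linarith
    next
      fix i j j' assume h: "i < m" "j \<in> J" "j' \<in> N" "only U t i j" "j \<notin> N"
      then have "path U t 0 j" by (auto simp: N_def)
      then have "\<not> tight U t i j'"
        using path_append[of U t 0 j i j'] h oppJ[of i j'] by (auto simp: N_def)
      then have "\<not> ok C t i j'" using tight_iff h by (auto simp: N_def)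
      moreover have "ok C t i j" using Cok[OF h(1,2)] h(4) tight_iff[OF h(1,2)] by (auto simp: only_def)
      ultimately obtain j'' where "j'' \<in> J" "a i j' - C (t, j') < a i j'' - C (t, j'')"
        by (auto simp: ok_def not_le)
      then show "a i j' - C (t, j') < a i j - C (t, j)" using \<open>ok C t i j\<close> unfolding ok_def by force
    qed
    define e where "e = Min slack"
    have e0: "0 < e" using fs pos Min_in[of slack] by (auto simp: e_def slack_def)
    have ele: "e \<le> x" if "x \<in> slack" for x using fs that by (auto simp: e_def)
    define C' where "C' = (\<lambda>(s, j). C (s, j) - (if s = t \<and> j \<in> N then e else 0))"
    have "C' \<in> V"
      unfolding V_def
    proof (intro CollectI conjI ballI)
      fix s j assume "s \<in> {..<3::nat}" "j \<in> J"
      then show "a 0 j \<le> C' (s, j)" using C0le[of s j] ele[of "C (t, j) - a 0 j"]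
        by (auto simp: C'_def slack_def)
    next
      fix i j assume ij: "i \<in> {..<m}" "j \<in> J"
      show "\<exists>t\<in>{..<3}. ok C' t i j"
      proof (cases "\<exists>s<3. s \<noteq> t \<and> ok C s i j")
        case True
        then obtain s where "s < 3" "s \<noteq> t" "ok C s i j" by blast
        then have "ok C' s i j" by (auto simp: ok_def C'_def)
        then show ?thesis using \<open>s < 3\<close> by auto
      next
        case False
        then have on: "only U t i j" using tight_iff ij by (auto simp: only_def)
        have okt: "ok C t i j" using Cok[of i j] False ij by auto
        \<comment> \<open>Only lowering an unreached \<open>j'\<close> against a reached
          \<open>j\<close> could move the maximum, and there \<open>e\<close> is at most the
          slack.\<close>
        have "a i j' - C' (t, j') \<le> a i j - C' (t, j)" if "j' \<in> J" for j'
        proof (cases "j \<notin> N \<and> j' \<in> N")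
          case True
          then have "(a i j - C (t, j)) - (a i j' - C (t, j')) \<in> slack"
            using ij on unfolding slack_def by force
          then show ?thesis using ele True by (force simp: C'_def)
        next
          case False
          then show ?thesis using okt that e0 unfolding ok_def C'_def by auto
        qed
        then have "ok C' t i j" by (auto simp: ok_def)
        then show ?thesis using t by auto
      qed
    qed
    moreover have "sum C' D < sum C D"
    proof (rule sum_strict_mono_ex1[OF \<open>finite D\<close>])
      show "\<forall>x\<in>D. C' x \<le> C x" using e0 by (auto simp: C'_def)
      show "\<exists>x\<in>D. C' x < C x" using e0 t v nv by (intro bexI[of _ "(t, v)"]) (auto simp: C'_def N_def D_def)
    qed
    ultimately show False using Cmin by force
  qed
  have "\<exists>v. opp u v \<and> tight U t u v" if "t < 3" "u < m + n" for t u
  proof (cases "u < m")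
    case True
    then obtain j where j: "j \<in> J" "a u j = Y t u + C (t, j)" using Yat by blast
    then have "tight U t u j" using True by (auto simp: tight_def U_def J_def)
    then show ?thesis using oppJ(1)[OF True j(1)] by blast
  next
    case False
    then show ?thesis using path_last_row[OF reach[OF that(1), of u]] that by (auto simp: J_def)
  qed
  then have "extremal U" using cov reach unfolding extremal_def J_def by auto
  then show ?thesis by blast
qed

section \<open>Extreme rows and columns, raised vertices, and the offsets\<close>

definition compat :: "(nat \<Rightarrow> nat \<Rightarrow> real) \<Rightarrow> (nat \<Rightarrow> nat \<Rightarrow> real) \<Rightarrow> bool" where
  "compat L U \<longleftrightarrow> covers U \<and> (\<forall>t<3. \<forall>u<m+n. L t u \<le> U t u) \<and>
     (\<forall>u<m+n. \<forall>s<3. \<forall>t<3. s \<noteq> t \<longrightarrow> U s u \<le> L s u \<or> U t u \<le> L t u)"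

definition distinct3 :: "nat \<Rightarrow> nat \<Rightarrow> nat \<Rightarrow> bool" where
  "distinct3 t s r \<longleftrightarrow> t < 3 \<and> s < 3 \<and> r < 3 \<and> t \<noteq> s \<and> t \<noteq> r \<and> s \<noteq> r"

lemma covers_ge: "covers U \<Longrightarrow> opp u v \<Longrightarrow> t < 3 \<Longrightarrow> a u v \<le> U t u + U t v"
  unfolding covers_def by blast

lemma tight_le: "covers U \<Longrightarrow> opp u v \<Longrightarrow> tight U t u v \<Longrightarrow> s < 3 \<Longrightarrow> U t u + U t v \<le> U s u + U s v"
  using covers_ge[of U u v s] by (simp add: tight_def)

lemma min_tight:
  assumes "covers U" "opp u v" "distinct3 t s r"
    "U t u + U t v \<le> U s u + U s v" "U t u + U t v \<le> U r u + U r v"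
  shows "tight U t u v"
proof -
  obtain k where k: "k < 3" "U k u + U k v = a u v" using assms unfolding covers_def by blast
  have "k = t \<or> k = s \<or> k = r" using k(1) assms(3) unfolding distinct3_def by linarith
  then show ?thesis
    using k assms(4,5) covers_ge[OF assms(1,2), of t] assms(3) unfolding tight_def distinct3_def by auto
qed

text \<open>If \<open>u\<close> were raised in \<open>t\<close> and in \<open>s\<close>, then \<open>s\<close> would beat \<open>t\<close> at \<open>g t r\<close>, and \<open>t\<close> would beat \<open>s\<close> at \<open>g s r\<close>,
  against the choice of these two vertices.\<close>

lemma at_most_one_raised:
  assumes U: "covers U" and d: "distinct3 t s r"
    and ex: "\<And>k. k < 3 \<Longrightarrow> \<exists>v. opp u v \<and> tight U k u v"
    and g: "\<And>k l. k < 3 \<Longrightarrow> l < 3 \<Longrightarrow> opp u (g k l)"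
    and min: "\<And>k l v. k < 3 \<Longrightarrow> l < 3 \<Longrightarrow> opp u v \<Longrightarrow> U k (g k l) - U l (g k l) \<le> U k v - U l v"
  shows "tight U t u (g t s) \<or> tight U t u (g t r) \<or> tight U s u (g s t) \<or> tight U s u (g s r)"
proof (rule ccontr)
  have le: "U k u + U k (g k l) \<le> U l u + U l (g k l)" if "k < 3" "l < 3" for k l
  proof -
    obtain v where v: "opp u v" "tight U k u v" using ex[OF \<open>k < 3\<close>] by blast
    then show ?thesis using tight_le[OF U v \<open>l < 3\<close>] min[OF that v(1)] by linarith
  qed
  have d': "t < 3" "s < 3" "r < 3" "distinct3 t r s" "distinct3 s r t" using d by (auto simp: distinct3_def)
  assume "\<not> ?thesis"
  then have "U s u + U s (g t r) < U t u + U t (g t r)" "U t u + U t (g s r) < U s u + U s (g s r)"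
    using min_tight[OF U g[of t r] d'(4)] min_tight[OF U g[of s r] d'(5)] le[of t r] le[of s r] d' by force+
  moreover have "U t (g t r) - U r (g t r) \<le> U t (g s r) - U r (g s r)"
    "U s (g s r) - U r (g s r) \<le> U s (g t r) - U r (g t r)"
    using min g d' by auto
  ultimately show False by linarith
qed

definition extremes :: "(nat \<Rightarrow> nat \<Rightarrow> real) \<Rightarrow> (nat \<Rightarrow> nat \<Rightarrow> nat) \<Rightarrow> (nat \<Rightarrow> nat \<Rightarrow> nat) \<Rightarrow> bool" where
  "extremes U f e \<longleftrightarrow> (\<forall>t<3. \<forall>s<3. f t s < m \<and> m \<le> e t s \<and> e t s < m + n \<and>
     (\<forall>i<m. U t (f t s) - U s (f t s) \<le> U t i - U s i) \<and>
     (\<forall>j. m \<le> j \<and> j < m + n \<longrightarrow> U t (e t s) - U s (e t s) \<le> U t j - U s j))"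

lemma extremes_exist: "\<exists>f e. extremes U f e"
proof -
  have arg_min: "\<exists>i\<in>S. \<forall>k\<in>S. U t i - U s i \<le> U t k - U s k" if "finite S" "S \<noteq> {}" for S t s
    using ex_is_arg_min_if_finite[OF that, of "\<lambda>i. U t i - U s i"] unfolding is_arg_min_def by (meson not_less)
  have "\<exists>i<m. \<forall>k<m. U t i - U s i \<le> U t k - U s k" for t s
    using arg_min[of "{..<m}" t s] m_pos by auto
  moreover have "\<exists>j. m \<le> j \<and> j < m + n \<and> (\<forall>k. m \<le> k \<and> k < m + n \<longrightarrow> U t j - U s j \<le> U t k - U s k)" for t s
    using arg_min[of "{m..<m+n}" t s] n_pos by fastforce
  ultimately show ?thesis unfolding extremes_def by metis
qed

lemma extremal_tight_ex: "extremal U \<Longrightarrow> t < 3 \<Longrightarrow> u < m + n \<Longrightarrow> \<exists>v. opp u v \<and> tight U t u v"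
  by (auto simp: extremal_def)

text \<open>Every row has a column where \<open>t\<close> is tight and hence no worse than
  \<open>s\<close>, and column \<open>e t s\<close> favours \<open>t\<close> over \<open>s\<close>
  at least as much. So \<open>t\<close> is no worse than \<open>s\<close> in the whole column, and
  dually in the whole row \<open>f t s\<close>.\<close>

lemma extremal_le:
  assumes X: "extremal U" "extremes U f e" and ts: "t < 3" "s < 3"
  shows "i < m \<Longrightarrow> U t i + U t (e t s) \<le> U s i + U s (e t s)"
    and "m \<le> j \<Longrightarrow> j < m + n \<Longrightarrow> U t (f t s) + U t j \<le> U s (f t s) + U s j"
proof -
  have U: "covers U" using X by (simp add: extremal_def)
  { assume "i < m"
    then obtain v where v: "opp i v" "tight U t i v" using extremal_tight_ex[OF X(1) ts(1), of i] by auto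
    then have "U t (e t s) - U s (e t s) \<le> U t v - U s v" using X(2) ts \<open>i < m\<close> by (auto simp: extremes_def opp_def)
    then show "U t i + U t (e t s) \<le> U s i + U s (e t s)" using tight_le[OF U v ts(2)] by linarith }
  { assume j: "m \<le> j" "j < m + n"
    then obtain v where v: "opp j v" "tight U t j v" using extremal_tight_ex[OF X(1) ts(1), of j] by auto
    then have "U t (f t s) - U s (f t s) \<le> U t v - U s v" using X(2) ts j by (auto simp: extremes_def opp_def)
    then show "U t (f t s) + U t j \<le> U s (f t s) + U s j" using tight_le[OF U v ts(2)] by linarith }
qed

lemma extremes_side:
  assumes "extremes U f e" "t < 3" "s < 3"
  shows "f t s < m" "m \<le> e t s" "e t s < m + n"
  using assms by (auto simp: extremes_def)

lemma opp_extremes: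
  assumes "extremes U f e" "t < 3" "s < 3" "t' < 3" "s' < 3"
  shows "opp (f t s) (e t' s')"
  using extremes_side[OF assms(1), of t s] extremes_side[OF assms(1), of t' s'] assms by (auto simp: opp_def)

text \<open>Row \<open>f t s\<close> makes \<open>t\<close> no worse than \<open>s\<close>, column
  \<open>e t r\<close> makes it no worse than \<open>r\<close>, and the minimal colour of a cell is
  tight.\<close>

lemma cross_tight:
  assumes X: "extremal U" "extremes U f e" and d: "distinct3 t s r"
  shows "tight U t (f t s) (e t r)"
proof -
  have d': "t < 3" "s < 3" "r < 3" using d by (auto simp: distinct3_def)
  show ?thesis
    by (rule min_tight[OF _ opp_extremes[OF X(2)] d])
      (use extremal_le(1)[OF X, of t r "f t s"] extremal_le(2)[OF X, of t s "e t r"] d'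
        extremes_side[OF X(2)] X in \<open>auto simp: extremal_def\<close>)
qed

text \<open>Combined with \<open>cross_tight\<close>, row \<open>f t s\<close> is then tight in
  \<open>t\<close> at both extreme columns of \<open>t\<close>, so the offset is a difference of two
  entries of that row.\<close>

definition direct :: "(nat \<Rightarrow> nat \<Rightarrow> real) \<Rightarrow> (nat \<Rightarrow> nat \<Rightarrow> nat) \<Rightarrow> (nat \<Rightarrow> nat \<Rightarrow> nat) \<Rightarrow> nat \<Rightarrow> bool" where
  "direct U f e t \<longleftrightarrow> (\<exists>s<3. s \<noteq> t \<and> tight U t (f t s) (e t s))"

text \<open>At the cell of \<open>f t r\<close> and \<open>e t r\<close>, \<open>t\<close> is no
  worse than \<open>r\<close> but not tight, so \<open>s\<close> is strictly better than
  \<open>t\<close>. Passing to \<open>f s r\<close> and \<open>e s r\<close> can only lower the sum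
  of \<open>s\<close> minus that of \<open>r\<close> and raise that of \<open>t\<close> minus that
  of \<open>r\<close>, hence \<open>s\<close> wins there against both.\<close>

lemma direct_other:
  assumes X: "extremal U" "extremes U f e" and d: "distinct3 t s r" and nd: "\<not> direct U f e t"
  shows "direct U f e s"
proof -
  have d': "t < 3" "s < 3" "r < 3" "distinct3 t r s" "distinct3 s r t" "r \<noteq> s" "r \<noteq> t" using d by (auto simp: distinct3_def)
  have U: "covers U" using X by (simp add: extremal_def)
  note o = opp_extremes[OF X(2)]
  have le: "U t (f t r) + U t (e t r) \<le> U r (f t r) + U r (e t r)"
    using extremal_le(1)[OF X, of t r "f t r"] extremes_side[OF X(2)] d' by auto
  have "\<not> tight U t (f t r) (e t r)" using nd d' by (auto simp: direct_def)
  then have 1: "U s (f t r) + U s (e t r) < U t (f t r) + U t (e t r)"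
    using min_tight[OF U o d'(4), of t r t r] le d' by force
  have 3: "U s (f s r) - U r (f s r) \<le> U s (f t r) - U r (f t r)" "U t (f t r) - U r (f t r) \<le> U t (f s r) - U r (f s r)"
    "U s (e s r) - U r (e s r) \<le> U s (e t r) - U r (e t r)" "U t (e t r) - U r (e t r) \<le> U t (e s r) - U r (e s r)"
    using X(2) d' extremes_side[OF X(2)] unfolding extremes_def by simp_all
  have "tight U s (f s r) (e s r)"
    by (rule min_tight[OF U o d'(5)]) (use 1 le 3 d' in \<open>auto\<close>)
  then show ?thesis using d' unfolding direct_def by auto
qed

lemma recolour:
  assumes inv: "\<And>t. t < 3 \<Longrightarrow> \<sigma> t < 3 \<and> \<sigma> (\<sigma> t) = t" and X: "extremal U"
  shows "extremal (\<lambda>t. U (\<sigma> t))"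
proof -
  have tt: "tight (\<lambda>t. U (\<sigma> t)) t u v = tight U (\<sigma> t) u v" for t u v by (simp add: tight_def)
  have on: "only U (\<sigma> t) u v \<Longrightarrow> t < 3 \<Longrightarrow> only (\<lambda>t. U (\<sigma> t)) t u v" for t u v
    unfolding only_def tt using inv by metis
  have pa: "path U k i v \<Longrightarrow> \<forall>t<3. k = \<sigma> t \<longrightarrow> path (\<lambda>t. U (\<sigma> t)) t i v" for k i v
    by (induction rule: path.induct) (use on tt in \<open>auto intro: path.intros\<close>)
  show ?thesis
    unfolding extremal_def
  proof (intro conjI allI impI)
    show "covers (\<lambda>t. U (\<sigma> t))"
      using X inv unfolding extremal_def covers_def by metis
    show "\<exists>v. opp u v \<and> tight (\<lambda>t. U (\<sigma> t)) t u v" if "t < 3" "u < m + n" for t u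
      unfolding tt using X inv that unfolding extremal_def by blast
    show "path (\<lambda>t. U (\<sigma> t)) t 0 v" if "t < 3" "m \<le> v \<and> v < m + n" for t v
      using X inv[OF that(1)] that pa unfolding extremal_def by blast
  qed
qed

text \<open>The one colour that may fail to be \<open>direct\<close> is swapped with colour 0, so
  that only colour 0 needs a special offset.\<close>

lemma extremal_direct_exists:
  assumes "covers U0"
  shows "\<exists>U f e. extremal U \<and> extremes U f e \<and> direct U f e 1 \<and> direct U f e 2"
proof -
  obtain U where U: "extremal U" using extremal_exists[OF assms] by blast
  obtain f e where fe: "extremes U f e" using extremes_exist by blast
  have "\<exists>k<3. \<forall>t<3. t \<noteq> k \<longrightarrow> direct U f e t"
  proof (cases "\<exists>k<3. \<not> direct U f e k")
    case True
    then obtain k where k: "k < 3" "\<not> direct U f e k" by blast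
    have "direct U f e t" if "t < 3" "t \<noteq> k" for t
    proof -
      have "\<exists>r. distinct3 k t r"
        using that k other_colours[OF that(1)] unfolding distinct3_def by metis
      then show ?thesis using direct_other[OF U fe _ k(2)] by blast
    qed
    then show ?thesis using k by blast
  qed (use zero_less_numeral in blast)
  then obtain k where k: "k < 3" "\<And>t. t < 3 \<Longrightarrow> t \<noteq> k \<Longrightarrow> direct U f e t" by blast
  define \<sigma> where "\<sigma> t = (if t = 0 then k else if t = k then 0 else t)" for t
  have inv: "\<sigma> t < 3 \<and> \<sigma> (\<sigma> t) = t" if "t < 3" for t using that k by (auto simp: \<sigma>_def)
  define U' f' e' where "U' = (\<lambda>t. U (\<sigma> t))" and "f' = (\<lambda>t s. f (\<sigma> t) (\<sigma> s))" and "e' = (\<lambda>t s. e (\<sigma> t) (\<sigma> s))"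
  have "extremal U'" unfolding U'_def by (rule recolour[OF inv U])
  moreover have "extremes U' f' e'" using fe inv unfolding extremes_def U'_def f'_def e'_def by auto
  moreover have "direct U' f' e' t" if t: "t < 3" "t \<noteq> 0" for t
  proof -
    have "\<sigma> t < 3" "\<sigma> t \<noteq> k" using inv[OF t(1)] t by (auto simp: \<sigma>_def)
    then obtain s where s: "s < 3" "s \<noteq> \<sigma> t" "tight U (\<sigma> t) (f (\<sigma> t) s) (e (\<sigma> t) s)" using k(2) unfolding direct_def by blast
    then have "\<sigma> s < 3 \<and> \<sigma> s \<noteq> t \<and> tight U' t (f' t (\<sigma> s)) (e' t (\<sigma> s))"
      using inv[OF s(1)] inv[OF t(1)] by (auto simp: tight_def U'_def f'_def e'_def)
    then show ?thesis unfolding direct_def by blast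
  qed
  ultimately have "extremal U' \<and> extremes U' f' e' \<and> direct U' f' e' 1 \<and> direct U' f' e' 2" by simp
  then show ?thesis by blast
qed

text \<open>If \<open>r\<close> sees \<open>d\<close>, then \<open>U t d + U t r\<close> can be computed from \<open>K\<close> and two entries.\<close>

definition sees :: "(nat \<Rightarrow> nat \<Rightarrow> real) \<Rightarrow> (nat \<Rightarrow> nat \<Rightarrow> real) \<Rightarrow> nat \<Rightarrow> nat \<Rightarrow> nat \<Rightarrow> bool" where
  "sees U K t d r \<longleftrightarrow> (\<exists>v x. opp r v \<and> opp x v \<and> x < m \<and> K r v = U t r + U t v \<and> tight U t x v \<and> tight U t x d)"

text \<open>Induction from the end of the path, at a link between row \<open>j\<close> and column
  \<open>w\<close>. If \<open>F\<close> holds there, \<open>Kc\<close> transports what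
  \<open>j\<close> sees to the row \<open>i\<close> before it. If not, some row is tight at
  \<open>w\<close> and at a member of \<open>Ds\<close>, which \<open>i\<close> and \<open>j\<close>
  therefore both see: either it is the target itself, or \<open>j\<close> sees two members.\<close>

lemma path_sees:
  assumes U: "covers U" and t: "t < 3"
    and aK: "\<And>i j. i < m \<Longrightarrow> opp i j \<Longrightarrow> a i j \<le> K i j"
    and KU: "\<And>i j. i < m \<Longrightarrow> opp i j \<Longrightarrow> K i j \<le> U t i + U t j"
    and Kc: "\<And>i j i' j'. i < m \<Longrightarrow> opp i j \<Longrightarrow> F i' j' \<Longrightarrow> i' < m \<Longrightarrow> opp i' j' \<Longrightarrow> K i j' - a i' j' + K i' j \<le> K i j"
    and F: "\<And>i j. i < m \<Longrightarrow> opp i j \<Longrightarrow> only U t i j \<Longrightarrow> \<forall>d\<in>Ds. \<forall>x<m. \<not> (tight U t x j \<and> tight U t x d) \<Longrightarrow> F i j"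
  shows "path U t r d \<Longrightarrow> d \<in> Ds \<Longrightarrow>
     (r < m \<and> sees U K t d r) \<or> (\<exists>r'<m. \<exists>d'\<in>Ds. d' \<noteq> d \<and> sees U K t d r' \<and> sees U K t d' r')"
proof (induction r d rule: path.induct)
  case (here i v)
  have "K i v = U t i + U t v" using aK[of i v] KU[of i v] here by (auto simp: tight_def)
  then show ?case using here unfolding sees_def by blast
next
  case (step i w j v)
  have w: "K i' w = U t i' + U t w" if "i' < m" "tight U t i' w" for i'
  proof -
    have "opp i' w" using step.hyps(2) that \<open>i < m\<close> by (auto simp: opp_def)
    then show ?thesis using aK[of i' w] KU[of i' w] that by (auto simp: tight_def)
  qed
  have jw: "opp j w" using step.hyps by (auto simp: opp_def)
  have tj: "tight U t j w"
  proof -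
    obtain k where "k < 3" "tight U k j w" using U jw unfolding covers_def tight_def by blast
    then show ?thesis using step.hyps(5) unfolding only_def by metis
  qed
  have seen: "sees U K t d i'" if "i' < m" "tight U t i' w" "x < m" "tight U t x w" "tight U t x d" for d i' x
  proof -
    have "opp i' w" "opp x w" using that(1,3) step.hyps(1,2) by (auto simp: opp_def)
    then show ?thesis using w[OF that(1,2)] that unfolding sees_def by blast
  qed
  from step.IH[OF step.prems] show ?case
  proof (elim disjE)
    assume IH: "j < m \<and> sees U K t v j"
    show ?thesis
    proof (cases "\<exists>d\<in>Ds. \<exists>x<m. tight U t x w \<and> tight U t x d")
      case True
      then obtain d x where d: "d \<in> Ds" "x < m" "tight U t x w" "tight U t x d" by blast
      show ?thesis
      proof (cases "d = v")
        case True
        then show ?thesis using seen[OF step.hyps(1,3) d(2,3,4)] step.hyps(1) by blast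
      next
        case False
        then show ?thesis using seen[OF step.hyps(4) tj d(2,3,4)] IH d(1) by blast
      qed
    next
      case False
      then have Fjw: "F j w" using F[OF step.hyps(4) jw step.hyps(5)] by blast
      obtain y x where yx: "opp j y" "opp x y" "x < m" "K j y = U t j + U t y" "tight U t x y" "tight U t x v"
        using IH unfolding sees_def by blast
      have iy: "opp i y" using yx(1) step.hyps(1,4) by (auto simp: opp_def)
      have "K i w - a j w + K j y \<le> K i y"
        by (rule Kc[OF step.hyps(1) iy Fjw step.hyps(4) jw])
      moreover have "U t j + U t w = a j w" using tj by (simp add: tight_def)
      ultimately have "U t i + U t y \<le> K i y"
        using w[OF step.hyps(1,3)] yx(4) by linarith
      then have "K i y = U t i + U t y" using KU[OF step.hyps(1) iy] by linarith
      then have "sees U K t v i" using yx iy unfolding sees_def by blast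
      then show ?thesis using step.hyps(1) by blast
    qed
  qed blast
qed

text \<open>A row that sees both columns gives an expression for each sum with that row, and
  subtraction cancels the row. If row 0 does not see both, \<open>path_sees\<close> provides another
  row that does.\<close>

lemma offset_exists:
  assumes X: "extremal U" and t: "t < 3"
    and c: "m \<le> c" "c < m + n" and d: "m \<le> d" "d < m + n"
    and aK: "\<And>i j. i < m \<Longrightarrow> opp i j \<Longrightarrow> a i j \<le> K i j"
    and KU: "\<And>i j. i < m \<Longrightarrow> opp i j \<Longrightarrow> K i j \<le> U t i + U t j"
    and Kc: "\<And>i j i' j'. i < m \<Longrightarrow> opp i j \<Longrightarrow> F i' j' \<Longrightarrow> i' < m \<Longrightarrow> opp i' j' \<Longrightarrow> K i j' - a i' j' + K i' j \<le> K i j"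
    and F: "\<And>i j. i < m \<Longrightarrow> opp i j \<Longrightarrow> only U t i j \<Longrightarrow>
       \<forall>e\<in>{c, d}. \<forall>x<m. \<not> (tight U t x j \<and> tight U t x e) \<Longrightarrow> F i j"
  shows "\<exists>r<m. \<exists>x<m. \<exists>y<m. \<exists>v w. opp r v \<and> opp r w \<and>
    U t c - U t d = (a y c - a y w + K r w) - (a x d - a x v + K r v)"
proof -
  have U: "covers U" and p: "path U t 0 c" "path U t 0 d" using X t c d by (auto simp: extremal_def)
  have "(r < m \<and> sees U K t e r) \<or> (\<exists>r'<m. \<exists>e'\<in>{c, d}. e' \<noteq> e \<and> sees U K t e r' \<and> sees U K t e' r')"
    if "path U t r e" "e \<in> {c, d}" for r e
    using path_sees[where Ds = "{c, d}" and K = K and F = F, OF U t aK KU Kc F that] by blast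
  from this[OF p(1)] this[OF p(2)] have "\<exists>r<m. sees U K t c r \<and> sees U K t d r"
    by blast
  then obtain r v w x y where r: "r < m" "opp r w" "y < m" "K r w = U t r + U t w" "tight U t y w" "tight U t y c"
    "opp r v" "x < m" "K r v = U t r + U t v" "tight U t x v" "tight U t x d"
    unfolding sees_def by blast
  then have "U t c - U t d = (a y c - a y w + K r w) - (a x d - a x v + K r v)"
    unfolding tight_def by linarith
  then show ?thesis using r by blast
qed

section \<open>Guessing the lower bounds\<close>

text \<open>All loops share one bound, so it has to exceed every vertex number and to be at least 3,
  the number of colours.\<close>

definition bnd :: nat where "bnd = m + n + 3"

definition link_step :: "(nat \<Rightarrow> nat \<Rightarrow> real) \<Rightarrow> nat \<Rightarrow> nat \<times> nat \<Rightarrow> (nat \<Rightarrow> nat \<Rightarrow> real) \<Rightarrow> nat \<Rightarrow> nat \<Rightarrow> real" where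
  "link_step L t p K = (if forced L t (fst p) (snd p) then relax_step (snd p) (fst p) (a (fst p) (snd p)) K else K)"

definition link_closure :: "(nat \<Rightarrow> nat \<Rightarrow> real) \<Rightarrow> nat \<Rightarrow> nat \<Rightarrow> nat \<Rightarrow> real" where
  "link_closure L t = fold (link_step L t) (List.product [0..<bnd] [0..<bnd]) a"

definition codes :: "lit list" where
  "codes = List.product [0..<bnd] (List.product [0..<bnd] [0..<bnd])"

definition reach_init :: "(nat \<Rightarrow> nat \<Rightarrow> real) \<Rightarrow> (nat \<Rightarrow> nat \<Rightarrow> nat \<Rightarrow> real) \<Rightarrow> lit \<Rightarrow> lit \<Rightarrow> real" where
  "reach_init L K l k = (if l = k \<or> (\<exists>z. clash L K l z \<and> clause L z k) then 1 else 0)"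

text \<open>Warshall's algorithm in real arithmetic: for values 0 and 1,
  \<open>R l z - 1 + R z k\<close> is 1 exactly if both are 1, so \<open>relax_step\<close> with
  bound 1 adds the paths through \<open>z\<close>.\<close>

definition reach_closure :: "(nat \<Rightarrow> nat \<Rightarrow> real) \<Rightarrow> (nat \<Rightarrow> nat \<Rightarrow> nat \<Rightarrow> real) \<Rightarrow> lit \<Rightarrow> lit \<Rightarrow> real" where
  "reach_closure L K = fold (\<lambda>z. relax_step z z 1) codes (reach_init L K)"

text \<open>Closedness is tested, not presupposed: under a wrong guess the forced equalities may
  contradict each other, and then a single pass need not yield a closed \<open>K\<close>.\<close>

definition accepts :: "(nat \<Rightarrow> nat \<Rightarrow> real) \<Rightarrow> bool" where
  "accepts L \<longleftrightarrow> closed_under L (link_closure L) \<and> consistent L (link_closure L) (\<lambda>l k. reach_closure L (link_closure L) l k = 1)"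

lemma lits_codes: "lits \<subseteq> set codes"
  by (auto simp: lits_def codes_def bnd_def)

lemma fold_relax_closed:
  assumes "\<And>l k. R l k \<le> 1"
  shows "(\<forall>l k. fold (\<lambda>z. relax_step z z 1) zs R l k \<le> 1) \<and> (\<forall>l k. R l k \<le> fold (\<lambda>z. relax_step z z 1) zs R l k) \<and>
     (\<forall>z\<in>set zs. link_closed z z 1 (fold (\<lambda>z. relax_step z z 1) zs R))"
proof (induction zs rule: rev_induct)
  case Nil then show ?case using assms by simp
next
  case (snoc z zs)
  let ?R = "fold (\<lambda>z. relax_step z z 1) zs R"
  have "relax_step z z 1 ?R l k \<le> 1" for l k
  proof -
    have "?R l z \<le> 1" "?R z k \<le> 1" "?R l k \<le> 1" using snoc by auto
    then show ?thesis unfolding relax_step_def by linarith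
  qed
  moreover have "R l k \<le> relax_step z z 1 ?R l k" for l k
    using snoc relax_step_ge[of ?R l k z z 1] order_trans by blast
  moreover have "link_closed y y 1 (relax_step z z 1 ?R)" if "y \<in> set (zs @ [z])" for y
    using that snoc relax_step_closed[of ?R z z 1] relax_step_preserves_closed[of ?R z z 1 y y 1] by auto
  ultimately show ?case by simp
qed

text \<open>Serves completeness, with \<open>S\<close> the literals that hold in a factorization:
  whatever is reached from a literal that holds also holds.\<close>

lemma fold_relax_invariant:
  assumes "\<And>l k. R l k = 0 \<or> R l k = 1" "\<And>l k. R l k = 1 \<Longrightarrow> l \<in> S \<Longrightarrow> k \<in> S"
  shows "\<forall>l k. (fold (\<lambda>z. relax_step z z 1) zs R l k = 0 \<or> fold (\<lambda>z. relax_step z z 1) zs R l k = 1) \<and>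
     (fold (\<lambda>z. relax_step z z 1) zs R l k = 1 \<longrightarrow> l \<in> S \<longrightarrow> k \<in> S)"
proof (induction zs rule: rev_induct)
  case Nil then show ?case using assms by simp
next
  case (snoc z zs)
  let ?R = "fold (\<lambda>z. relax_step z z 1) zs R"
  show ?case
  proof (intro allI)
    fix l k
    have "(?R l k = 0 \<or> ?R l k = 1) \<and> (?R l z = 0 \<or> ?R l z = 1) \<and> (?R z k = 0 \<or> ?R z k = 1)"
      "?R l k = 1 \<longrightarrow> l \<in> S \<longrightarrow> k \<in> S" "?R l z = 1 \<longrightarrow> l \<in> S \<longrightarrow> z \<in> S" "?R z k = 1 \<longrightarrow> z \<in> S \<longrightarrow> k \<in> S"
      using snoc by auto
    then show "(fold (\<lambda>z. relax_step z z 1) (zs @ [z]) R l k = 0 \<or> fold (\<lambda>z. relax_step z z 1) (zs @ [z]) R l k = 1) \<and>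
      (fold (\<lambda>z. relax_step z z 1) (zs @ [z]) R l k = 1 \<longrightarrow> l \<in> S \<longrightarrow> k \<in> S)"
      by (auto simp: relax_step_def)
  qed
qed

theorem accepts_sound:
  assumes accepts: "accepts L"
  shows "\<exists>U. covers U"
proof -
  let ?K = "link_closure L"
  let ?R = "reach_closure L ?K"
  have "(\<forall>l k. ?R l k \<le> 1) \<and> (\<forall>l k. reach_init L ?K l k \<le> ?R l k) \<and> (\<forall>z\<in>set codes. link_closed z z 1 ?R)"
    unfolding reach_closure_def by (rule fold_relax_closed) (simp add: reach_init_def)
  then have R1: "?R l k \<le> 1" and Ri: "reach_init L ?K l k \<le> ?R l k"
    and Rc: "z \<in> set codes \<Longrightarrow> ?R l z - 1 + ?R z k \<le> ?R l k" for l k z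
    unfolding link_closed_def by blast+
  show ?thesis
  proof (rule consistent_imp_covers[of L ?K "\<lambda>l k. ?R l k = 1"])
    show "?R l l = 1" for l using R1[of l l] Ri[of l l] by (auto simp: reach_init_def)
    show "?R l k = 1" if "clash L ?K l z" "clause L z k" for l z k
    proof -
      have "l = k \<or> (\<exists>z. clash L ?K l z \<and> clause L z k)" using that by blast
      then have "reach_init L ?K l k = 1" by (simp only: reach_init_def if_True)
      then show ?thesis using R1[of l k] Ri[of l k] by linarith
    qed
    show "?R l j = 1" if "?R l k = 1" "?R k j = 1" "k \<in> lits" for l k j
      using Rc[of k l j] R1[of l j] that lits_codes by fastforce
  qed (use accepts in \<open>auto simp: accepts_def\<close>)
qed

text \<open>The sums \<open>U i + U j\<close> dominate every intermediate \<open>K\<close>, so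
  \<open>K\<close> never exceeds the entry of a forced cell. This is the hypothesis under which
  relaxation steps close and stay closed.\<close>

lemma fold_link_invariant:
  fixes U :: "nat \<Rightarrow> real"
  assumes ge: "\<And>i j. i < m \<Longrightarrow> opp i j \<Longrightarrow> a i j \<le> U i + U j"
    and F: "\<And>i j. forced L t i j \<Longrightarrow> U i + U j \<le> a i j"
  shows "(\<forall>i j. i < m \<longrightarrow> opp i j \<longrightarrow> fold (link_step L t) ps a i j \<le> U i + U j) \<and>
    (\<forall>i j. a i j \<le> fold (link_step L t) ps a i j) \<and>
    (\<forall>(i, j)\<in>set ps. forced L t i j \<longrightarrow> link_closed j i (a i j) (fold (link_step L t) ps a))"
proof (induction ps rule: rev_induct)
  case Nil then show ?case using ge by simp
next
  case (snoc p ps)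
  let ?K = "fold (link_step L t) ps a"
  obtain x w where p: "p = (x, w)" by (cases p)
  show ?case
  proof (cases "forced L t x w")
    case False
    then show ?thesis using snoc p by (auto simp: link_step_def)
  next
    case True
    then have xw: "x < m" "opp x w" by (auto simp: forced_def opp_def)
    have 1: "?K i j \<le> U i + U j" if "i < m" "opp i j" for i j using snoc that by blast
    have le: "?K x w \<le> a x w" using 1[OF xw] F[OF True] by linarith
    have step: "fold (link_step L t) (ps @ [p]) a = relax_step w x (a x w) ?K"
      using True p by (simp add: link_step_def)
    show ?thesis
      unfolding step
    proof (intro conjI allI impI ballI)
      fix i j assume ij: "i < m" "opp i j"
      have "opp i w" "opp x j" using ij xw by (auto simp: opp_def)
      then show "relax_step w x (a x w) ?K i j \<le> U i + U j"
        using 1[of i w] 1[of x j] 1[of i j] ij xw F[OF True]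
        unfolding relax_step_def by linarith
    next
      fix i j
      have "a i j \<le> ?K i j" using snoc by blast
      then show "a i j \<le> relax_step w x (a x w) ?K i j" using relax_step_ge[of ?K i j] order_trans by blast
    next
      fix q assume "q \<in> set (ps @ [p])"
      then show "case q of (i, j) \<Rightarrow> forced L t i j \<longrightarrow> link_closed j i (a i j) (relax_step w x (a x w) ?K)"
        using snoc p relax_step_closed[of ?K, OF le] relax_step_preserves_closed[of ?K, OF le] by auto
    qed
  qed
qed

lemma link_closure_closed:
  fixes U :: "nat \<Rightarrow> real"
  assumes ge: "\<forall>i j. i < m \<longrightarrow> opp i j \<longrightarrow> a i j \<le> U i + U j"
    and F: "\<forall>i j. forced L t i j \<longrightarrow> U i + U j \<le> a i j"
  shows "i < m \<Longrightarrow> opp i j \<Longrightarrow> link_closure L t i j \<le> U i + U j" and "a i j \<le> link_closure L t i j"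
    and "forced L t i' j' \<Longrightarrow> link_closure L t i j' - a i' j' + link_closure L t i' j \<le> link_closure L t i j"
proof -
  have inv: "(\<forall>i j. i < m \<longrightarrow> opp i j \<longrightarrow> link_closure L t i j \<le> U i + U j) \<and> (\<forall>i j. a i j \<le> link_closure L t i j) \<and>
      (\<forall>(i, j)\<in>set (List.product [0..<bnd] [0..<bnd]). forced L t i j \<longrightarrow> link_closed j i (a i j) (link_closure L t))"
    unfolding link_closure_def by (rule fold_link_invariant) (use ge F in auto)
  show "i < m \<Longrightarrow> opp i j \<Longrightarrow> link_closure L t i j \<le> U i + U j" and "a i j \<le> link_closure L t i j" using inv by blast+
  assume f: "forced L t i' j'"
  then have "(i', j') \<in> set (List.product [0..<bnd] [0..<bnd])" by (auto simp: forced_def bnd_def)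
  then show "link_closure L t i j' - a i' j' + link_closure L t i' j \<le> link_closure L t i j"
    using inv f unfolding link_closed_def by blast
qed

lemma compat_forced_tight:
  assumes "compat L U" "t < 3" "forced L t i j"
  shows "U t i + U t j = a i j"
proof -
  have "opp i j" using assms(3) by (auto simp: forced_def opp_def)
  then obtain s where s: "s < 3" "U s i + U s j = a i j" using assms(1) unfolding compat_def covers_def by blast
  have "s = t"
  proof (rule ccontr)
    assume "s \<noteq> t"
    then have "a i j < L s i + L s j" using assms(3) s by (auto simp: forced_def excluded_def)
    moreover have "L s i \<le> U s i" "L s j \<le> U s j" using assms(1,3) s by (auto simp: forced_def compat_def)
    ultimately show False using s by linarith
  qed
  then show ?thesis using s by simp
qed

text \<open>The literals that hold for \<open>U\<close> hit every clause, never clash and are closed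
  under propagation. So each clause contains a literal all of whose consequences hold, and these are
  free of conflicts.\<close>

theorem compat_accepts:
  assumes c: "compat L U"
  shows "accepts L"
proof -
  have cov: "covers U" and lower: "\<And>t u. t < 3 \<Longrightarrow> u < m + n \<Longrightarrow> L t u \<le> U t u"
    and one: "\<And>u s t. u < m + n \<Longrightarrow> s < 3 \<Longrightarrow> t < 3 \<Longrightarrow> s \<noteq> t \<Longrightarrow> U s u \<le> L s u \<or> U t u \<le> L t u"
    using c by (auto simp: compat_def)
  have ge: "a i j \<le> U t i + U t j" if "t < 3" "opp i j" for t i j using covers_ge[OF cov] that by blast
  have F: "U t i + U t j \<le> a i j" if "t < 3" "forced L t i j" for t i j
    using compat_forced_tight[OF c that] by simp
  let ?K = "link_closure L"
  have "closed_under L ?K"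
    unfolding closed_under_def
  proof (intro allI impI conjI)
    fix t i j assume t: "t < (3::nat)" and "i < m" "m \<le> j \<and> j < m + n"
    have ge': "\<forall>i j. i < m \<longrightarrow> opp i j \<longrightarrow> a i j \<le> U t i + U t j" using ge t by blast
    have F': "\<forall>i j. forced L t i j \<longrightarrow> U t i + U t j \<le> a i j" using F t by blast
    note Kc = link_closure_closed[of "U t" L t, OF ge' F']
    show "a i j \<le> ?K t i j" by (rule Kc(2))
    show "?K t i j' - a i' j' + ?K t i' j \<le> ?K t i j" if "forced L t i' j'" for i' j' by (rule Kc(3)[OF that])
  qed
  moreover have "consistent L ?K (\<lambda>l k. reach_closure L ?K l k = 1)"
  proof -
    define S where "S = {(t, u, v). U t u \<le> cap L (t, u, v)}"
    have hit: "l \<in> S \<or> k \<in> S" if cl: "clause L l k" for l k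
    proof -
      obtain s u v t where l: "l = (s, u, v)" "k = (t, v, u)" "s < 3" "t < 3" "s \<noteq> t" "u < m + n" "v < m + n"
        "u = v \<or> opp u v \<and> excluded L (3 - s - t) u v"
        using cl by (cases l; cases k) (auto simp: clause_def)
      show ?thesis
      proof (cases "u = v")
        case True
        then show ?thesis using one[of u s t] l by (auto simp: S_def cap_def)
      next
        case False
        with l have o: "opp u v" and nt: "excluded L (3 - s - t) u v" by auto
        obtain r where r: "r < 3" "U r u + U r v = a u v" using cov o unfolding covers_def by blast
        have "r \<noteq> 3 - s - t" using nt r lower[of r u] lower[of r v] l by (auto simp: excluded_def)
        then have "r = s \<or> r = t" using r l by linarith
        then show ?thesis
        proof
          assume "r = s"
          then have "U s u \<le> a u v - L s v" using r lower[OF l(3,7)] by simp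
          then show ?thesis using False l by (simp add: S_def cap_def)
        next
          assume "r = t"
          then have "U t v \<le> a v u - L t u" using r lower[OF l(4,6)] a_sym[of u v] by simp
          then show ?thesis using False l by (simp add: S_def cap_def)
        qed
      qed
    qed
    have free: "\<not> clash L ?K l k" if S: "l \<in> S" "k \<in> S" for l k
    proof
      assume cl: "clash L ?K l k"
      obtain t u v w x where l: "l = (t, u, v)" "k = (t, w, x)" using cl by (cases l; cases k) (auto simp: clash_def)
      have lit: "t < 3" "u < m + n" "w < m + n" using cl l by (auto simp: clash_def lits_def)
      have U: "U t u \<le> cap L l" "U t w \<le> cap L k" using S l by (auto simp: S_def)
      have ge': "\<forall>i j. i < m \<longrightarrow> opp i j \<longrightarrow> a i j \<le> U t i + U t j" using ge lit(1) by blast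
      have F': "\<forall>i j. forced L t i j \<longrightarrow> U t i + U t j \<le> a i j" using F lit(1) by blast
      note Kc = link_closure_closed(1)[of "U t" L t, OF ge' F']
      show False
        using cl U Kc[of u w] Kc[of w u] lower[of t u] lit unfolding clash_def l
        by (auto simp: opp_def)
    qed
    have "\<forall>l k. (reach_closure L ?K l k = 0 \<or> reach_closure L ?K l k = 1) \<and> (reach_closure L ?K l k = 1 \<longrightarrow> l \<in> S \<longrightarrow> k \<in> S)"
      unfolding reach_closure_def
    proof (rule fold_relax_invariant)
      show "k \<in> S" if "reach_init L ?K l k = 1" "l \<in> S" for l k
        using that hit free unfolding reach_init_def by (metis zero_neq_one)
    qed (simp add: reach_init_def)
    then show ?thesis unfolding consistent_def using hit free by blast
  qed
  ultimately show ?thesis by (simp add: accepts_def)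
qed

text \<open>The guess \<open>G\<close> uses the numbering of the registers of the program: the rows \<open>f t (t+1)\<close>, \<open>f t (t+2)\<close> and the columns
  \<open>e t (t+1)\<close>, \<open>e t (t+2)\<close> are at \<open>10 + t\<close>, \<open>13 + t\<close>, \<open>16 + t\<close>, \<open>19 + t\<close>, a row giving the offset of colour \<open>t \<noteq> 0\<close> is
  at \<open>22 + t\<close>, and 25 to 29 hold the witnesses for the offset of colour 0.\<close>

definition offset :: "(nat \<Rightarrow> nat) \<Rightarrow> (nat \<Rightarrow> nat \<Rightarrow> real) \<Rightarrow> nat \<Rightarrow> real" where
  "offset G K t = (if t = 0
    then (a (G 27) (G 16) - a (G 27) (G 29) + K (G 25) (G 29)) - (a (G 26) (G 19) - a (G 26) (G 28) + K (G 25) (G 28))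
    else a (G (22 + t)) (G (16 + t)) - a (G (22 + t)) (G (19 + t)))"

text \<open>The gauge gives column \<open>G (19 + t)\<close> the value 0 in colour \<open>t\<close>,
  hence column \<open>G (16 + t)\<close> the value \<open>th t\<close>. Tight cells then fix the
  values of rows \<open>G (10 + t)\<close> and \<open>G (13 + t)\<close>. Each term is the entry
  with one of these four vertices minus the value of that vertex.\<close>

definition lower :: "(nat \<Rightarrow> nat) \<Rightarrow> (nat \<Rightarrow> real) \<Rightarrow> nat \<Rightarrow> nat \<Rightarrow> real" where
  "lower G th t u = (if u < m then max (a u (G (19 + t))) (a u (G (16 + t)) - th t)
    else max (a u (G (10 + t)) - a (G (10 + t)) (G (19 + t))) (a u (G (13 + t)) - a (G (13 + t)) (G (16 + t)) + th t))"

lemma forced_cong: "(\<And>s u. s < 3 \<Longrightarrow> s \<noteq> t \<Longrightarrow> L s u = L' s u) \<Longrightarrow> forced L t = forced L' t"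
  by (intro ext) (auto simp: forced_def excluded_def)

lemma link_closure_cong: "(\<And>s u. s < 3 \<Longrightarrow> s \<noteq> t \<Longrightarrow> L s u = L' s u) \<Longrightarrow> link_closure L t = link_closure L' t"
  using forced_cong[of t L L'] unfolding link_closure_def link_step_def by simp

text \<open>The closure for colour 0 only depends on the lower bounds in the other two colours. This is why an arbitrary \<open>K0\<close>
  may be used for the first computation of the lower bounds.\<close>

theorem guess_exists:
  assumes U0: "covers U0"
  shows "\<exists>G. (\<forall>k. G k < m + n) \<and> (\<forall>K0. accepts (lower G (offset G (link_closure (lower G (offset G K0)) 0))))"
proof -
  obtain U f e where X: "extremal U" "extremes U f e" and dir: "direct U f e 1" "direct U f e 2"
    using extremal_direct_exists[OF assms] by blast
  have cov: "covers U" using X by (simp add: extremal_def)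
  define nx pv where "nx t = (t + 1) mod 3" and "pv t = (t + 2) mod 3" for t :: nat
  have t3: "t = 0 \<or> t = 1 \<or> t = 2" if "t < 3" for t :: nat using that by linarith
  have d3: "distinct3 t (nx t) (pv t)" if "t < 3" for t
    using t3[OF that] by (auto simp: distinct3_def nx_def pv_def)
  have d3': "distinct3 t (pv t) (nx t)" if "t < 3" for t
    using d3[OF that] by (auto simp: distinct3_def)
  have d3_cases: "s = nx t \<and> r = pv t \<or> s = pv t \<and> r = nx t" if "distinct3 t s r" for t s r
    using that t3[of t] t3[of s] t3[of r] unfolding distinct3_def nx_def pv_def by auto
  define pa pb pc pd where "pa t = f t (nx t)" and "pb t = f t (pv t)" and "pc t = e t (nx t)" and "pd t = e t (pv t)" for t
  have side: "pa t < m" "pb t < m" "m \<le> pc t" "pc t < m + n" "m \<le> pd t" "pd t < m + n" if "t < 3" for t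
    using extremes_side[OF X(2)] that d3[OF that] unfolding pa_def pb_def pc_def pd_def distinct3_def by blast+
  have ad: "tight U t (pa t) (pd t)" and bc: "tight U t (pb t) (pc t)" if "t < 3" for t
    using cross_tight[OF X d3[OF that]] cross_tight[OF X d3'[OF that]] unfolding pa_def pb_def pc_def pd_def .
  \<comment> \<open>In a direct colour one of \<open>pa t\<close> and \<open>pb t\<close> is tight
    at both \<open>pc t\<close> and \<open>pd t\<close>: one cell comes from directness, the other
    from \<open>ad\<close> or \<open>bc\<close>.\<close>
  have "\<exists>i<m. tight U t i (pc t) \<and> tight U t i (pd t)" if t: "t < 3" "t \<noteq> 0" for t
  proof -
    have "direct U f e t" using t dir t3[OF t(1)] by auto
    then obtain s where s: "s < 3" "s \<noteq> t" "tight U t (f t s) (e t s)" by (auto simp: direct_def)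
    have "s = nx t \<or> s = pv t" using s t t3[of s] t3[of t] by (auto simp: nx_def pv_def)
    then show ?thesis
    proof
      assume "s = nx t"
      then show ?thesis using s ad[OF t(1)] side[OF t(1)] by (intro exI[of _ "pa t"]) (simp add: pa_def pc_def)
    next
      assume "s = pv t"
      then show ?thesis using s bc[OF t(1)] side[OF t(1)] by (intro exI[of _ "pb t"]) (simp add: pb_def pd_def)
    qed
  qed
  then obtain g where g: "\<And>t. t < 3 \<Longrightarrow> t \<noteq> 0 \<Longrightarrow> g t < m \<and> tight U t (g t) (pc t) \<and> tight U t (g t) (pd t)"
    by metis
  define th where "th t = U t (pc t) - U t (pd t)" for t
  \<comment> \<open>\<open>U\<close> in the gauge of \<open>lower\<close>: rows and columns are
    shifted oppositely, so sums over cells do not change.\<close>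
  define W where "W t u = (if u < m then U t u + U t (pd t) else U t u - U t (pd t))" for t u
  define LL where "LL t u = (if u < m then max (a u (pd t)) (a u (pc t) - th t)
    else max (a u (pa t) - a (pa t) (pd t)) (a u (pb t) - a (pb t) (pc t) + th t))" for t u
  have WW: "W t u + W t v = U t u + U t v" if "opp u v" for t u v
    using that by (auto simp: W_def opp_def)
  have covW: "covers W" using cov WW unfolding covers_def by metis
  have LW: "LL t u \<le> W t u" if t: "t < 3" "u < m + n" for t u
  proof (cases "u < m")
    case True
    then have "opp u (pd t)" "opp u (pc t)" using side[OF t(1)] by (auto simp: opp_def)
    then show ?thesis using covers_ge[OF cov _ t(1)] True by (force simp: LL_def W_def th_def)
  next
    case False
    then have "opp u (pa t)" "opp u (pb t)" using side[OF t(1)] t by (auto simp: opp_def)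
    then show ?thesis using covers_ge[OF cov _ t(1), of u "pa t"] covers_ge[OF cov _ t(1), of u "pb t"] False ad[OF t(1)] bc[OF t(1)]
      by (auto simp: LL_def W_def th_def tight_def)
  qed
  have rowW: "W t u \<le> LL t u" if "t < 3" "u < m" "tight U t u (pc t) \<or> tight U t u (pd t)" for t u
    using that by (auto simp: LL_def W_def th_def tight_def)
  have colW: "W t u \<le> LL t u" if "t < 3" "\<not> u < m" "tight U t u (pa t) \<or> tight U t u (pb t)" for t u
    using that ad[OF that(1)] bc[OF that(1)] by (auto simp: LL_def W_def th_def tight_def)
  have raised_row: "tight U t u (pc t) \<or> tight U t u (pd t) \<or> tight U s u (pc s) \<or> tight U s u (pd s)"
    if ts: "t < 3" "s < 3" "s \<noteq> t" and u: "u < m" for t s u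
  proof -
    obtain r where r: "distinct3 t s r" using other_colours[OF ts(1)] ts unfolding distinct3_def by metis
    then have r': "distinct3 s t r" by (auto simp: distinct3_def)
    have "tight U t u (e t s) \<or> tight U t u (e t r) \<or> tight U s u (e s t) \<or> tight U s u (e s r)"
    proof (rule at_most_one_raised[OF cov r, where g = e])
      show "\<exists>v. opp u v \<and> tight U k u v" if "k < 3" for k using extremal_tight_ex[OF X(1) that] u by auto
      show "opp u (e k l)" if "k < 3" "l < 3" for k l using extremes_side[OF X(2) that] u by (auto simp: opp_def)
      show "U k (e k l) - U l (e k l) \<le> U k v - U l v" if "k < 3" "l < 3" "opp u v" for k l v
        using X(2) that u unfolding extremes_def opp_def by auto
    qed
    then show ?thesis using d3_cases[OF r] d3_cases[OF r'] unfolding pc_def pd_def by auto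
  qed
  have raised_col: "tight U t u (pa t) \<or> tight U t u (pb t) \<or> tight U s u (pa s) \<or> tight U s u (pb s)"
    if ts: "t < 3" "s < 3" "s \<noteq> t" and u: "m \<le> u" "u < m + n" for t s u
  proof -
    obtain r where r: "distinct3 t s r" using other_colours[OF ts(1)] ts unfolding distinct3_def by metis
    then have r': "distinct3 s t r" by (auto simp: distinct3_def)
    have "tight U t u (f t s) \<or> tight U t u (f t r) \<or> tight U s u (f s t) \<or> tight U s u (f s r)"
    proof (rule at_most_one_raised[OF cov r, where g = f])
      show "\<exists>v. opp u v \<and> tight U k u v" if "k < 3" for k using extremal_tight_ex[OF X(1) that] u by auto
      show "opp u (f k l)" if "k < 3" "l < 3" for k l using extremes_side[OF X(2) that] u by (auto simp: opp_def)
      show "U k (f k l) - U l (f k l) \<le> U k v - U l v" if "k < 3" "l < 3" "opp u v" for k l v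
        using X(2) that u unfolding extremes_def opp_def by auto
    qed
    then show ?thesis using d3_cases[OF r] d3_cases[OF r'] unfolding pa_def pb_def by auto
  qed
  have comp: "compat LL W"
    unfolding compat_def
  proof (intro conjI allI impI)
    fix u s t assume "u < m + n" "s < (3::nat)" "t < (3::nat)" "s \<noteq> t"
    then show "W s u \<le> LL s u \<or> W t u \<le> LL t u"
      using raised_row[of s t u] raised_col[of s t u] rowW[of s u] rowW[of t u] colW[of s u] colW[of t u]
      by (cases "u < m") auto
  qed (use covW LW in auto)
  \<comment> \<open>Without a row linking \<open>j\<close> to \<open>pc 0\<close> or
    \<open>pd 0\<close>, neither end is known to be unraised in colour 0, so both are unraised in
    the other colours. There \<open>LL\<close> equals \<open>W\<close>, and the strict inequality
    for \<open>W\<close> becomes exclusion.\<close>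
  have forced0: "forced LL 0 i j"
    if i: "i < m" and ij: "opp i j" and on: "only U 0 i j"
      and no: "\<forall>e\<in>{pc 0, pd 0}. \<forall>x<m. \<not> (tight U 0 x j \<and> tight U 0 x e)" for i j
  proof -
    have j: "m \<le> j" "j < m + n" using i ij by (auto simp: opp_def)
    have "tight U 0 i j"
    proof -
      obtain k where "k < 3" "U k i + U k j = a i j" using cov ij unfolding covers_def by blast
      then show ?thesis using on unfolding only_def tight_def by metis
    qed
    then have "\<not> tight U 0 i (pc 0)" "\<not> tight U 0 i (pd 0)" using no i by auto
    moreover have "\<not> tight U 0 j (pa 0)" "\<not> tight U 0 j (pb 0)"
      using no ad[of 0] bc[of 0] side[of 0] a_sym[of j] by (auto simp: tight_def add.commute)
    moreover have "excluded LL s i j" if s: "s < 3" "s \<noteq> 0"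
      and c: "\<not> tight U 0 i (pc 0)" "\<not> tight U 0 i (pd 0)" "\<not> tight U 0 j (pa 0)" "\<not> tight U 0 j (pb 0)" for s
    proof -
      have "W s i \<le> LL s i" using raised_row[of 0 s i] rowW[of s i] s c i by auto
      moreover have "W s j \<le> LL s j" using raised_col[of 0 s j] colW[of s j] s c j by auto
      moreover have "a i j < W s i + W s j"
        using on s covers_ge[OF cov ij s(1)] WW[OF ij, of s] unfolding only_def tight_def by force
      ultimately show ?thesis unfolding excluded_def by linarith
    qed
    ultimately show ?thesis using i j unfolding forced_def by blast
  qed
  have ge0: "\<forall>i j. i < m \<longrightarrow> opp i j \<longrightarrow> a i j \<le> W 0 i + W 0 j" using covers_ge[OF covW] by simp
  have F0: "\<forall>i j. forced LL 0 i j \<longrightarrow> W 0 i + W 0 j \<le> a i j" using compat_forced_tight[OF comp, of 0] by simp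
  note Kc = link_closure_closed[of "W 0" LL 0, OF ge0 F0]
  have "\<exists>r<m. \<exists>x<m. \<exists>y<m. \<exists>v w. opp r v \<and> opp r w \<and> U 0 (pc 0) - U 0 (pd 0) =
      (a y (pc 0) - a y w + link_closure LL 0 r w) - (a x (pd 0) - a x v + link_closure LL 0 r v)"
  proof (rule offset_exists[OF X(1), where F = "forced LL 0"])
    show "a i j \<le> link_closure LL 0 i j" for i j by (rule Kc(2))
    show "link_closure LL 0 i j \<le> U 0 i + U 0 j" if "i < m" "opp i j" for i j
      using Kc(1)[OF that] WW[OF that(2), of 0] by simp
    show "link_closure LL 0 i j' - a i' j' + link_closure LL 0 i' j \<le> link_closure LL 0 i j" if "forced LL 0 i' j'" for i j i' j'
      by (rule Kc(3)[OF that])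
  qed (use side[of 0] forced0 in auto)
  then obtain r x y v w where q: "r < m" "x < m" "y < m" "opp r v" "opp r w"
    "th 0 = (a y (pc 0) - a y w + link_closure LL 0 r w) - (a x (pd 0) - a x v + link_closure LL 0 r v)"
    unfolding th_def by blast
  define G where "G k = (if k < 10 then 0 else if k < 13 then pa (k - 10) else if k < 16 then pb (k - 13)
    else if k < 19 then pc (k - 16) else if k < 22 then pd (k - 19) else if k < 23 then 0 else if k < 25 then g (k - 22)
    else if k = 25 then r else if k = 26 then x else if k = 27 then y else if k = 28 then v
    else if k = 29 then w else 0)" for k
  have G: "G (10 + t) = pa t" "G (13 + t) = pb t" "G (16 + t) = pc t" "G (19 + t) = pd t"
    "t \<noteq> 0 \<Longrightarrow> G (22 + t) = g t" if "t < 3" for t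
    using t3[OF that] by (auto simp: G_def)
  have G': "G 25 = r" "G 26 = x" "G 27 = y" "G 28 = v" "G 29 = w" "G 16 = pc 0" "G 19 = pd 0" by (auto simp: G_def)
  have Gb: "G k < m + n" for k
    using side g q m_pos unfolding G_def opp_def by (auto simp: trans_less_add1)
  have lowG: "lower G h t u = LL t u" if "t < 3" "h t = th t" for h t u
    using that by (simp add: lower_def LL_def G)
  have off12: "offset G K t = th t" if "t < 3" "t \<noteq> 0" for K t
  proof -
    have "U t (g t) + U t (pc t) = a (g t) (pc t)" "U t (g t) + U t (pd t) = a (g t) (pd t)"
      using g[OF that] by (auto simp: tight_def)
    then show ?thesis using that by (simp add: offset_def G th_def)
  qed
  \<comment> \<open>Only the bounds of colours 1 and 2 enter, and their offsets do not involve
    \<open>K\<close>.\<close>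
  have K0: "link_closure (lower G (offset G K)) 0 = link_closure LL 0" for K
    by (rule link_closure_cong) (use lowG off12 in auto)
  have off0: "offset G (link_closure LL 0) 0 = th 0" by (simp add: offset_def G' q)
  have "offset G (link_closure LL 0) t = th t" if "t < 3" for t using off12[OF that] off0 by (cases "t = 0") auto
  then have "compat (lower G (offset G (link_closure LL 0))) W"
    using comp lowG unfolding compat_def by simp
  then have "accepts (lower G (offset G (link_closure (lower G (offset G K)) 0)))" for K
    unfolding K0 by (rule compat_accepts)
  then show ?thesis using Gb by blast
qed

end

section \<open>Factor rank\<close>

definition factorizable :: "real mat \<Rightarrow> nat \<Rightarrow> bool" where
  "factorizable A k \<longleftrightarrow> (\<exists>b c. \<forall>i<dim_row A. \<forall>j<dim_col A.
     (\<forall>t<k. A $$ (i, j) \<le> b t i + c t j) \<and> (\<exists>t<k. b t i + c t j = A $$ (i, j)))"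

lemma trop_mult_iff_factorizable:
  assumes "1 \<le> k"
  shows "(\<exists>B \<in> carrier_mat (dim_row A) k. \<exists>C \<in> carrier_mat k (dim_col A). A = trop_mult B C) \<longleftrightarrow> factorizable A k"
proof
  assume "\<exists>B \<in> carrier_mat (dim_row A) k. \<exists>C \<in> carrier_mat k (dim_col A). A = trop_mult B C"
  then obtain B C where BC: "B \<in> carrier_mat (dim_row A) k" "C \<in> carrier_mat k (dim_col A)" "A = trop_mult B C"
    by blast
  show "factorizable A k"
    unfolding factorizable_def
  proof (intro exI allI impI)
    fix i j assume ij: "i < dim_row A" "j < dim_col A"
    let ?S = "(\<lambda>t. B $$ (i, t) + C $$ (t, j)) ` {..<k}"
    have "A $$ (i, j) = trop_mult B C $$ (i, j)" using BC(3) by (rule arg_cong)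
    also have "\<dots> = Min ?S" using BC(1,2) ij by (simp add: trop_mult_def)
    finally have "A $$ (i, j) = Min ?S" .
    moreover have "Min ?S \<in> ?S" using assms by (intro Min_in) (auto simp: lessThan_empty_iff)
    ultimately show "(\<forall>t<k. A $$ (i, j) \<le> (\<lambda>t i. B $$ (i, t)) t i + (\<lambda>t j. C $$ (t, j)) t j) \<and>
        (\<exists>t<k. (\<lambda>t i. B $$ (i, t)) t i + (\<lambda>t j. C $$ (t, j)) t j = A $$ (i, j))"
      by auto
  qed
next
  assume "factorizable A k"
  then obtain b c where bc: "\<And>i j. i < dim_row A \<Longrightarrow> j < dim_col A \<Longrightarrow>
     (\<forall>t<k. A $$ (i, j) \<le> b t i + c t j) \<and> (\<exists>t<k. b t i + c t j = A $$ (i, j))"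
    unfolding factorizable_def by blast
  define B where "B = mat (dim_row A) k (\<lambda>(i, t). b t i)"
  define C where "C = mat k (dim_col A) (\<lambda>(t, j). c t j)"
  have "A = trop_mult B C"
  proof (rule eq_matI)
    fix i j assume "i < dim_row (trop_mult B C)" "j < dim_col (trop_mult B C)"
    then have ij: "i < dim_row A" "j < dim_col A" by (auto simp: trop_mult_def B_def C_def)
    have "(\<lambda>t. B $$ (i, t) + C $$ (t, j)) ` {..<k} = (\<lambda>t. b t i + c t j) ` {..<k}"
      using ij by (auto simp: B_def C_def)
    moreover have "Min ((\<lambda>t. b t i + c t j) ` {..<k}) = A $$ (i, j)"
    proof -
      obtain t where "t < k" "b t i + c t j = A $$ (i, j)" using bc[OF ij] by blast
      then have "A $$ (i, j) \<in> (\<lambda>t. b t i + c t j) ` {..<k}" by (intro image_eqI[of _ _ t]) auto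
      then show ?thesis using bc[OF ij] by (intro Min_eqI) auto
    qed
    ultimately show "A $$ (i, j) = trop_mult B C $$ (i, j)"
      using ij by (simp add: trop_mult_def B_def C_def)
  qed (auto simp: trop_mult_def B_def C_def)
  then show "\<exists>B \<in> carrier_mat (dim_row A) k. \<exists>C \<in> carrier_mat k (dim_col A). A = trop_mult B C"
    by (intro bexI[of _ B] bexI[of _ C]) (auto simp: B_def C_def)
qed

text \<open>Term 0 is repeated as the new term. Monotonicity turns rank 3 into two tests, with 3
  terms and with 2.\<close>

lemma factorizable_Suc:
  assumes "1 \<le> k" "factorizable A k"
  shows "factorizable A (Suc k)"
proof -
  obtain b c where bc: "\<And>i j. i < dim_row A \<Longrightarrow> j < dim_col A \<Longrightarrow>
     (\<forall>t<k. A $$ (i, j) \<le> b t i + c t j) \<and> (\<exists>t<k. b t i + c t j = A $$ (i, j))"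
    using assms(2) unfolding factorizable_def by blast
  let ?p = "\<lambda>t. if t < k then t else 0"
  have "(\<forall>t<Suc k. A $$ (i, j) \<le> b (?p t) i + c (?p t) j) \<and> (\<exists>t<Suc k. b (?p t) i + c (?p t) j = A $$ (i, j))"
    if ij: "i < dim_row A" "j < dim_col A" for i j
  proof -
    obtain t where "t < k" "b t i + c t j = A $$ (i, j)" using bc[OF ij] by blast
    then have "\<exists>t<Suc k. b (?p t) i + c (?p t) j = A $$ (i, j)" by (intro exI[of _ t]) simp
    moreover have "A $$ (i, j) \<le> b (?p t) i + c (?p t) j" for t
      using bc[OF ij, THEN conjunct1, rule_format, of "?p t"] assms(1) by simp
    ultimately show ?thesis by simp
  qed
  then show ?thesis
    unfolding factorizable_def
    by (intro exI[of _ "\<lambda>t. b (?p t)"] exI[of _ "\<lambda>t. c (?p t)"] allI impI)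
qed

lemma factor_rank_3_iff: "factor_rank A = 3 \<longleftrightarrow> factorizable A 3 \<and> \<not> factorizable A 2"
proof -
  have eq: "factor_rank A = (LEAST k. 1 \<le> k \<and> factorizable A k)"
    unfolding factor_rank_def using trop_mult_iff_factorizable by (metis (no_types, lifting))
  have ex: "\<exists>k\<ge>1. factorizable A k"
  proof -
    \<comment> \<open>One term more than columns keeps the number of terms positive even for a
      matrix without columns.\<close>
    have "factorizable A (Suc (dim_col A))"
    proof -
      define M where "M = Max (insert 0 ((\<lambda>(i, j). \<bar>A $$ (i, j)\<bar>) ` ({..<dim_row A} \<times> {..<dim_col A})))"
      have M: "\<bar>A $$ (i, j)\<bar> \<le> M" if "i < dim_row A" "j < dim_col A" for i j
        unfolding M_def using that by (intro Max_ge) auto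
      define b where "b t i = (if t < dim_col A then A $$ (i, t) else 2 * M)" for t i
      \<comment> \<open>Term \<open>t\<close> reproduces column \<open>t\<close>; on other columns
        the penalty \<open>2 * M\<close> is at least the difference of any two entries.\<close>
      define c where "c t j = (if t = j then 0 else 2 * M)" for t j :: nat
      have le: "A $$ (i, j) \<le> b t i + c t j" if "i < dim_row A" "j < dim_col A" for t i j
        using M[OF that] M[OF that(1), of t] by (auto simp: b_def c_def)
      have "b j i + c j j = A $$ (i, j)" if "j < dim_col A" for i j
        using that by (auto simp: b_def c_def)
      then have "\<exists>t<Suc (dim_col A). b t i + c t j = A $$ (i, j)" if "j < dim_col A" for i j
        using that less_SucI by blast
      with le show ?thesis
        unfolding factorizable_def by (intro exI[of _ b] exI[of _ c] allI impI conjI)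
    qed
    then show ?thesis by (intro exI[of _ "Suc (dim_col A)"]) auto
  qed
  show ?thesis
  proof
    assume 3: "factor_rank A = 3"
    then have "factorizable A 3" using LeastI_ex[OF ex] eq by simp
    moreover have "\<not> factorizable A 2"
    proof
      assume "factorizable A 2"
      then have "factor_rank A \<le> 2" unfolding eq by (intro Least_le) simp
      then show False using 3 by simp
    qed
    ultimately show "factorizable A 3 \<and> \<not> factorizable A 2" by blast
  next
    assume f: "factorizable A 3 \<and> \<not> factorizable A 2"
    show "factor_rank A = 3"
      unfolding eq
    proof (rule Least_equality)
      fix k assume k: "1 \<le> k \<and> factorizable A k"
      show "3 \<le> k"
      proof (rule ccontr)
        assume "\<not> 3 \<le> k"
        then have "k = 1 \<or> k = 2" using k by linarith
        then show False using f k factorizable_Suc[of 1 A] by (auto simp: numeral_2_eq_2)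
      qed
    qed (use f in simp)
  qed
qed

text \<open>Pairs that are not cells get 0, so that the square array of the program can agree with
  this function at all indices.\<close>

definition entry :: "real mat \<Rightarrow> nat \<Rightarrow> nat \<Rightarrow> real" where
  "entry A u v = (if u < dim_row A \<and> dim_row A \<le> v \<and> v < dim_row A + dim_col A then A $$ (u, v - dim_row A)
    else if v < dim_row A \<and> dim_row A \<le> u \<and> u < dim_row A + dim_col A then A $$ (v, u - dim_row A) else 0)"

lemma entry_sym: "entry A u v = entry A v u"
  by (simp add: entry_def)

lemma factorizable_3_iff:
  assumes "0 < dim_row A" "0 < dim_col A"
  shows "factorizable A 3 \<longleftrightarrow> (\<exists>U. bipartite_form.covers (dim_row A) (dim_col A) (entry A) U)"
proof -
  interpret bipartite_form "dim_row A" "dim_col A" "entry A" by unfold_locales (use assms entry_sym in auto)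
  show ?thesis
  proof
    assume "factorizable A 3"
    then obtain b c where bc: "\<And>i j. i < dim_row A \<Longrightarrow> j < dim_col A \<Longrightarrow>
       (\<forall>t<3::nat. A $$ (i, j) \<le> b t i + c t j) \<and> (\<exists>t<3::nat. b t i + c t j = A $$ (i, j))"
      unfolding factorizable_def by blast
    define U where "U t u = (if u < dim_row A then b t u else c t (u - dim_row A))" for t u
    have "covers U"
      unfolding covers_def
    proof (intro allI impI)
      fix u v assume "opp u v"
      then consider "u < dim_row A" "dim_row A \<le> v" "v < dim_row A + dim_col A"
        | "v < dim_row A" "dim_row A \<le> u" "u < dim_row A + dim_col A"
        unfolding opp_def by linarith
      then show "(\<forall>t<3. entry A u v \<le> U t u + U t v) \<and> (\<exists>t<3. U t u + U t v = entry A u v)"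
      proof cases
        case 1
        then have "v - dim_row A < dim_col A" by linarith
        from bc[OF 1(1) this] 1 show ?thesis by (simp only: entry_def U_def) simp
      next
        case 2
        then have "u - dim_row A < dim_col A" by linarith
        from bc[OF 2(1) this] 2 show ?thesis by (simp only: entry_def U_def) (simp add: add.commute)
      qed
    qed
    then show "\<exists>U. covers U" by blast
  next
    assume "\<exists>U. covers U"
    then obtain U where U: "covers U" by blast
    have "(\<forall>t<3. A $$ (i, j) \<le> U t i + U t (dim_row A + j)) \<and> (\<exists>t<3. U t i + U t (dim_row A + j) = A $$ (i, j))"
      if "i < dim_row A" "j < dim_col A" for i j
    proof -
      have "opp i (dim_row A + j)" "entry A i (dim_row A + j) = A $$ (i, j)"
        using that by (auto simp: opp_def entry_def)
      then show ?thesis using U unfolding covers_def by metis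
    qed
    then show "factorizable A 3"
      unfolding factorizable_def by (intro exI[of _ U] exI[of _ "\<lambda>t j. U t (dim_row A + j)"] allI impI)
  qed
qed

text \<open>Column \<open>e\<close> serves as the row part of a term, whose least column part is the
  maximum over \<open>k\<close> of \<open>a k j - a k e\<close>. The inner conditions say that row
  \<open>i\<close> attains this maximum.\<close>

definition two_columns :: "real mat \<Rightarrow> bool" where
  "two_columns A \<longleftrightarrow> (let m = dim_row A; n = dim_col A; a = entry A in
    \<exists>e e'. m \<le> e \<and> e < m + n \<and> m \<le> e' \<and> e' < m + n \<and>
    (\<forall>i<m. \<forall>j. m \<le> j \<and> j < m + n \<longrightarrow>
       (\<forall>k<m. a k j - a k e \<le> a i j - a i e) \<or> (\<forall>k<m. a k j - a k e' \<le> a i j - a i e')))"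

text \<open>A factorization with two terms may be assumed to use two columns of the matrix, namely those with the extreme
  differences of the two terms.\<close>

lemma column_dominates:
  fixes A :: "nat \<Rightarrow> nat \<Rightarrow> real"
  assumes le: "\<And>k j t. k \<in> I \<Longrightarrow> j \<in> J \<Longrightarrow> A k j \<le> b (t::bool) k + c t j"
    and eq: "\<And>k j. k \<in> I \<Longrightarrow> j \<in> J \<Longrightarrow> \<exists>t. A k j = b t k + c t j"
    and e: "e \<in> J" "\<And>j. j \<in> J \<Longrightarrow> c t e - c (\<not> t) e \<le> c t j - c (\<not> t) j"
    and t: "i \<in> I" "j \<in> J" "A i j = b t i + c t j" and k: "k \<in> I"
  shows "A k j - A k e \<le> A i j - A i e"
proof -
  have "A i e \<le> b t i + c t e" using le t e by blast
  moreover have "A k j - A k e \<le> c t j - c t e"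
  proof -
    obtain s where s: "A k e = b s k + c s e" using eq k e by blast
    show ?thesis
    proof (cases "s = t")
      case True
      show ?thesis using s le[OF k t(2), of t] unfolding True by linarith
    next
      case False
      \<comment> \<open>The entry in column \<open>e\<close> comes from the other term; here the
        extremal choice of \<open>e\<close> compares the two terms.\<close>
      then have "s = (\<not> t)" by auto
      then show ?thesis using s le[OF k t(2), of "\<not> t"] e(2)[OF t(2)] by auto
    qed
  qed
  ultimately show ?thesis using t by linarith
qed

lemma factorizable_2_iff:
  assumes "0 < dim_row A" "0 < dim_col A"
  shows "factorizable A 2 \<longleftrightarrow> two_columns A"
proof
  define m n where "m = dim_row A" and "n = dim_col A"
  have ent: "entry A i (m + j) = A $$ (i, j)" if "i < m" "j < n" for i j
    using that by (auto simp: entry_def m_def n_def)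
  assume "factorizable A 2"
  then obtain b c where bc: "\<And>i j. i < m \<Longrightarrow> j < n \<Longrightarrow>
     (\<forall>t<2::nat. A $$ (i, j) \<le> b t i + c t j) \<and> (\<exists>t<2::nat. b t i + c t j = A $$ (i, j))"
    unfolding factorizable_def m_def n_def by blast
  let ?I = "{..<m}" and ?J = "{..<n}"
  \<comment> \<open>Truth values as term numbers make the other term a negation, as in
    \<open>column_dominates\<close>.\<close>
  define b' c' where "b' t = b (if t then 0 else 1 :: nat)" and "c' t = c (if t then 0 else 1 :: nat)" for t
  have le: "A $$ (k, j) \<le> b' t k + c' t j" if "k \<in> ?I" "j \<in> ?J" for k j t
    using bc that by (auto simp: b'_def c'_def)
  have eq: "\<exists>t. A $$ (k, j) = b' t k + c' t j" if "k \<in> ?I" "j \<in> ?J" for k j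
  proof -
    obtain t where "t < 2" "b t k + c t j = A $$ (k, j)" using bc \<open>k \<in> ?I\<close> \<open>j \<in> ?J\<close> by blast
    moreover from \<open>t < 2\<close> have "t = 0 \<or> t = 1" by linarith
    ultimately show ?thesis by (intro exI[of _ "t = 0"]) (auto simp: b'_def c'_def)
  qed
  have "\<exists>e\<in>?J. \<forall>j\<in>?J. c' t e - c' (\<not> t) e \<le> c' t j - c' (\<not> t) j" for t
    using ex_is_arg_min_if_finite[of ?J "\<lambda>j. c' t j - c' (\<not> t) j"] assms(2)
    unfolding is_arg_min_def n_def by (metis finite_lessThan lessThan_empty_iff less_numeral_extra(3) not_less)
  then obtain e where e: "\<And>t. e t \<in> ?J" "\<And>t j. j \<in> ?J \<Longrightarrow> c' t (e t) - c' (\<not> t) (e t) \<le> c' t j - c' (\<not> t) j"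
    by metis
  have cell: "\<exists>t. \<forall>k\<in>?I. A $$ (k, j) - A $$ (k, e t) \<le> A $$ (i, j) - A $$ (i, e t)" if ij: "i \<in> ?I" "j \<in> ?J" for i j
  proof -
    obtain t where t: "A $$ (i, j) = b' t i + c' t j" using eq[OF ij] by blast
    show ?thesis
      using column_dominates[of ?I ?J "\<lambda>i j. A $$ (i, j)" b' c' "e t" t i j, OF le eq e ij t] by blast
  qed
  show "two_columns A"
    unfolding two_columns_def Let_def m_def[symmetric] n_def[symmetric]
  proof (rule exI[of _ "m + e True"], rule exI[of _ "m + e False"], intro conjI allI impI)
    fix i j assume ij: "i < m" "m \<le> j \<and> j < m + n"
    define j' where "j' = j - m"
    have j: "j = m + j'" "j' < n" using ij by (auto simp: j'_def)
    have en: "e t < n" for t using e(1)[of t] by simp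
    obtain t where t: "\<forall>k\<in>?I. A $$ (k, j') - A $$ (k, e t) \<le> A $$ (i, j') - A $$ (i, e t)"
      using cell[of i j'] ij(1) j(2) by auto
    have "\<forall>k<m. entry A k j - entry A k (m + e t) \<le> entry A i j - entry A i (m + e t)"
      using t ij(1) unfolding j(1) by (simp add: ent j(2) en)
    then show "(\<forall>k<m. entry A k j - entry A k (m + e True) \<le> entry A i j - entry A i (m + e True)) \<or>
       (\<forall>k<m. entry A k j - entry A k (m + e False) \<le> entry A i j - entry A i (m + e False))"
      by (cases t) simp_all
  qed (use e(1) in auto)
next
  define m n where "m = dim_row A" and "n = dim_col A"
  have ent: "entry A i (m + j) = A $$ (i, j)" if "i < m" "j < n" for i j
    using that by (auto simp: entry_def m_def n_def)
  assume "two_columns A"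
  then obtain e e' where e: "\<And>i j. i < m \<Longrightarrow> m \<le> j \<and> j < m + n \<Longrightarrow>
       (\<forall>k<m. entry A k j - entry A k e \<le> entry A i j - entry A i e) \<or>
       (\<forall>k<m. entry A k j - entry A k e' \<le> entry A i j - entry A i e')"
    unfolding two_columns_def Let_def m_def[symmetric] n_def[symmetric] by blast
  define d where "d t = (if t = 0 then e else e')" for t :: nat
  define c where "c t j = Max ((\<lambda>k. A $$ (k, j) - entry A k (d t)) ` {..<m})" for t j
  have cge: "A $$ (k, j) - entry A k (d t) \<le> c t j" if "k < m" for k j t
    unfolding c_def using that by (intro Max_ge) auto
  have cin: "c t j \<in> (\<lambda>k. A $$ (k, j) - entry A k (d t)) ` {..<m}" for t j
    unfolding c_def using assms by (intro Max_in) (auto simp: m_def lessThan_empty_iff)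
  have "\<exists>t<2. entry A i (d t) + c t j = A $$ (i, j)" if ij: "i < m" "j < n" for i j
  proof -
    have col: "\<exists>t<2. \<forall>k<m. A $$ (k, j) - entry A k (d t) \<le> A $$ (i, j) - entry A i (d t)"
      using e[OF ij(1), of "m + j", simplified, OF ij(2)]
    proof
      assume "\<forall>k<m. entry A k (m + j) - entry A k e \<le> entry A i (m + j) - entry A i e"
      then show ?thesis using ij by (intro exI[of _ 0]) (simp add: ent d_def)
    next
      assume "\<forall>k<m. entry A k (m + j) - entry A k e' \<le> entry A i (m + j) - entry A i e'"
      then show ?thesis using ij by (intro exI[of _ 1]) (simp add: ent d_def)
    qed
    then obtain t where t: "t < 2" "\<forall>k<m. A $$ (k, j) - entry A k (d t) \<le> A $$ (i, j) - entry A i (d t)"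
      by blast
    obtain k where k: "k < m" "c t j = A $$ (k, j) - entry A k (d t)" using cin[of t j] by auto
    have "entry A i (d t) + c t j = A $$ (i, j)" using t(2) k cge[OF ij(1), of j t] by force
    then show ?thesis using t by blast
  qed
  moreover have "A $$ (i, j) \<le> entry A i (d t) + c t j" if "i < m" for i j t
    using cge[OF that, of j t] by linarith
  ultimately have "(\<forall>t<2. A $$ (i, j) \<le> entry A i (d t) + c t j) \<and> (\<exists>t<2. entry A i (d t) + c t j = A $$ (i, j))"
    if "i < m" "j < n" for i j
    using that by blast
  then have "\<forall>i<m. \<forall>j<n. (\<forall>t<2. A $$ (i, j) \<le> entry A i (d t) + c t j) \<and> (\<exists>t<2. entry A i (d t) + c t j = A $$ (i, j))"
    by blast
  then show "factorizable A 2"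
    unfolding factorizable_def m_def n_def
    by (intro exI[of _ "\<lambda>t i. entry A i (d t)"] exI[of _ c])
qed

section \<open>Loop programs\<close>

text \<open>All loops run up to the contents of register 2, which is never overwritten, and they reset their counter to 0.\<close>

abbreviation St :: "(nat \<Rightarrow> nat) \<Rightarrow> (nat \<Rightarrow> real) \<Rightarrow> state" where
  "St I r \<equiv> \<lparr>imem = I, rmem = r\<rparr>"

abbreviation V :: "nat \<Rightarrow> iexp" where "V k \<equiv> ICell (Num k)"

datatype prog = PSkip | PI nat iexp | PR iexp rexp | PSeq prog prog | PIf bexp prog prog | PFor nat prog

primrec compile :: "prog \<Rightarrow> com" where
  "compile PSkip = Skip"
| "compile (PI k e) = IAssign (Num k) e"
| "compile (PR a e) = RAssign a e"
| "compile (PSeq p q) = Seq (compile p) (compile q)"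
| "compile (PIf b p q) = Cond b (compile p) (compile q)"
| "compile (PFor k p) = Seq (IAssign (Num k) (Num 0)) (Seq
     (While (ILess (V k) (V 2)) (Seq (compile p) (IAssign (Num k) (IAdd (V k) (Num 1)))))
     (IAssign (Num k) (Num 0)))"

text \<open>A round sets the counter afresh instead of incrementing it. This agrees with the
  compiled loop because \<open>wf\<close> forbids the body to assign the counter.\<close>

primrec sem :: "prog \<Rightarrow> state \<Rightarrow> state" where
  "sem PSkip s = s"
| "sem (PI k e) s = s\<lparr>imem := (imem s)(k := ival e s)\<rparr>"
| "sem (PR a e) s = s\<lparr>rmem := (rmem s)(ival a s := rval e s)\<rparr>"
| "sem (PSeq p q) s = sem q (sem p s)"
| "sem (PIf b p q) s = (if bval b s then sem p s else sem q s)"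
| "sem (PFor k p) s = (let s' = fold (\<lambda>j s. sem p (s\<lparr>imem := (imem s)(k := j)\<rparr>)) [0..<imem s 2] s
     in s'\<lparr>imem := (imem s')(k := 0)\<rparr>)"

primrec asg :: "prog \<Rightarrow> nat set" where
  "asg PSkip = {}"
| "asg (PI k e) = {k}"
| "asg (PR a e) = {}"
| "asg (PSeq p q) = asg p \<union> asg q"
| "asg (PIf b p q) = asg p \<union> asg q"
| "asg (PFor k p) = insert k (asg p)"

primrec wf :: "prog \<Rightarrow> bool" where
  "wf PSkip = True"
| "wf (PI k e) = True"
| "wf (PR a e) = True"
| "wf (PSeq p q) = (wf p \<and> wf q)"
| "wf (PIf b p q) = (wf p \<and> wf q)"
| "wf (PFor k p) = (wf p \<and> k \<notin> asg p)"

text \<open>Guard and increment cost 6 each per round; the final 12 pays for the failing guard and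
  two assignments of cost 3.\<close>

primrec cost :: "prog \<Rightarrow> nat \<Rightarrow> nat" where
  "cost PSkip B = 1"
| "cost (PI k e) B = icost e + 2"
| "cost (PR a e) B = icost a + rcost e + 1"
| "cost (PSeq p q) B = cost p B + cost q B"
| "cost (PIf b p q) B = bcost b + cost p B + cost q B + 1"
| "cost (PFor k p) B = B * (cost p B + 12) + 12"

lemma sem_asg: "k \<notin> asg p \<Longrightarrow> imem (sem p s) k = imem s k"
proof (induction p arbitrary: s)
  case (PFor j p)
  have "imem (fold (\<lambda>i s. sem p (s\<lparr>imem := (imem s)(j := i)\<rparr>)) is s) k = imem s k" for "is"
    by (induction "is" arbitrary: s) (use PFor in auto)
  then show ?case using PFor.prems by (simp add: Let_def)
qed auto

lemma exec_cost_eq: "exec c s t s' \<Longrightarrow> t = t' \<Longrightarrow> exec c s t' s'"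
  by simp

text \<open>Register 2 keeps its value, so every loop makes \<open>B\<close> rounds and the time is
  bounded by a function of the program text and \<open>B\<close> alone.\<close>

lemma exec_compile:
  "wf p \<Longrightarrow> 2 \<notin> asg p \<Longrightarrow> imem s 2 = B \<Longrightarrow> \<exists>t\<le>cost p B. exec (compile p) s t (sem p s)"
proof (induction p arbitrary: s)
  case PSkip
  then show ?case using exec.Skip by auto
next
  case (PI k e)
  then show ?case using exec.IAssign[of "Num k" e s] by (intro exI[of _ "icost e + 2"]) simp
next
  case (PR a e)
  then show ?case using exec.RAssign[of a e s] by (intro exI[of _ "icost a + rcost e + 1"]) simp
next
  case (PSeq p q)
  obtain t1 where t1: "t1 \<le> cost p B" "exec (compile p) s t1 (sem p s)" using PSeq by auto
  have "imem (sem p s) 2 = B" using PSeq sem_asg by auto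
  then obtain t2 where t2: "t2 \<le> cost q B" "exec (compile q) (sem p s) t2 (sem q (sem p s))" using PSeq by auto
  show ?case using exec.Seq[OF t1(2) t2(2)] t1(1) t2(1) by (intro exI[of _ "t1 + t2"]) simp
next
  case (PIf b p q)
  show ?case
  proof (cases "bval b s")
    case True
    obtain t where t: "t \<le> cost p B" "exec (compile p) s t (sem p s)" using PIf by auto
    show ?thesis using exec.CondTrue[OF True t(2)] t(1) True by (intro exI[of _ "bcost b + t + 1"]) simp
  next
    case False
    obtain t where t: "t \<le> cost q B" "exec (compile q) s t (sem q s)" using PIf by auto
    show ?thesis using exec.CondFalse[OF False t(2)] t(1) False by (intro exI[of _ "bcost b + t + 1"]) simp
  qed
next
  case (PFor k p)
  let ?body = "Seq (compile p) (IAssign (Num k) (IAdd (V k) (Num 1)))"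
  let ?W = "While (ILess (V k) (V 2)) ?body"
  let ?f = "\<lambda>j s. sem p (s\<lparr>imem := (imem s)(k := j)\<rparr>)"
  have k: "k \<noteq> 2" "k \<notin> asg p" "2 \<notin> asg p" "wf p" using PFor.prems by auto
  have loop: "\<exists>t\<le>d * (cost p B + 12) + 6. exec ?W (s\<lparr>imem := (imem s)(k := j)\<rparr>) t
      ((fold ?f [j..<B] s)\<lparr>imem := (imem (fold ?f [j..<B] s))(k := B)\<rparr>)"
    if "imem s 2 = B" "j + d = B" for d j s
    using that
  proof (induction d arbitrary: j s)
    case 0
    then have j: "j = B" by simp
    have w: "exec ?W (s\<lparr>imem := (imem s)(k := B)\<rparr>) 6 (s\<lparr>imem := (imem s)(k := B)\<rparr>)"
      by (rule exec_cost_eq[OF exec.WhileFalse]) (use 0 k in simp_all)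
    have e: "[B..<B] = []" by simp
    show ?case unfolding j e fold_simps by (intro exI[of _ 6] conjI w) simp
  next
    case (Suc d)
    let ?s = "s\<lparr>imem := (imem s)(k := j)\<rparr>"
    have "imem ?s 2 = B" using Suc.prems k by simp
    then obtain t1 where t1: "t1 \<le> cost p B" "exec (compile p) ?s t1 (?f j s)" using PFor.IH k by blast
    have fj: "imem (?f j s) k = j" "imem (?f j s) 2 = B" using sem_asg[OF k(2)] sem_asg[OF k(3)] Suc.prems k by simp_all
    have "\<exists>t\<le>d * (cost p B + 12) + 6. exec ?W ((?f j s)\<lparr>imem := (imem (?f j s))(k := Suc j)\<rparr>) t
      ((fold ?f [Suc j..<B] (?f j s))\<lparr>imem := (imem (fold ?f [Suc j..<B] (?f j s)))(k := B)\<rparr>)"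
      by (rule Suc.IH) (use fj(2) Suc.prems(2) in simp_all)
    then obtain t2 where t2: "t2 \<le> d * (cost p B + 12) + 6" "exec ?W ((?f j s)\<lparr>imem := (imem (?f j s))(k := Suc j)\<rparr>) t2
      ((fold ?f [Suc j..<B] (?f j s))\<lparr>imem := (imem (fold ?f [Suc j..<B] (?f j s)))(k := B)\<rparr>)" by blast
    have inc: "exec (IAssign (Num k) (IAdd (V k) (Num 1))) (?f j s) 6 ((?f j s)\<lparr>imem := (imem (?f j s))(k := Suc j)\<rparr>)"
      using exec_cost_eq[OF exec.IAssign[of "Num k" "IAdd (V k) (Num 1)" "?f j s"], of 6] fj by simp
    have up: "[j..<B] = j # [Suc j..<B]" using Suc.prems by (simp add: upt_conv_Cons)
    have "bval (ILess (V k) (V 2)) ?s" using Suc.prems k by simp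
    from exec.WhileTrue[OF this exec.Seq[OF t1(2) inc] t2(2)]
    have E: "exec ?W ?s (t1 + 6 + t2 + 6) ((fold ?f [j..<B] s)\<lparr>imem := (imem (fold ?f [j..<B] s))(k := B)\<rparr>)"
      by (simp add: up exec_cost_eq algebra_simps)
    show ?case by (intro exI[of _ "t1 + 6 + t2 + 6"] conjI E) (use t1(1) t2(1) in simp)
  qed
  obtain t where t: "t \<le> B * (cost p B + 12) + 6" "exec ?W (s\<lparr>imem := (imem s)(k := 0)\<rparr>) t
      ((fold ?f [0..<B] s)\<lparr>imem := (imem (fold ?f [0..<B] s))(k := B)\<rparr>)"
    using loop[of s 0 B] PFor.prems by auto
  have i: "exec (IAssign (Num k) (Num 0)) s' 3 (s'\<lparr>imem := (imem s')(k := 0)\<rparr>)" for s'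
    using exec_cost_eq[OF exec.IAssign[of "Num k" "Num 0" s'], of 3] by simp
  have E: "exec (compile (PFor k p)) s (3 + (t + 3)) (sem (PFor k p) s)"
    using exec.Seq[OF i exec.Seq[OF t(2) i]] PFor.prems by (simp add: Let_def)
  show ?case by (intro exI[of _ "3 + (t + 3)"] conjI E) (use t(1) in simp)
qed

text \<open>Each loop contributes one factor \<open>B\<close>, so the degree depends on the program
  only.\<close>

lemma cost_poly: "\<exists>K d. \<forall>B. cost p B \<le> K * (B + 1) ^ d"
proof (induction p)
  have const: "\<exists>K d. \<forall>B. (c::nat) \<le> K * (B + 1) ^ d" for c
    by (intro exI[of _ c] exI[of _ 0]) simp
  have add: "\<exists>K d. \<forall>B. f B + g B \<le> K * (B + 1) ^ d"
    if fg: "\<exists>K d. \<forall>B. f B \<le> K * (B + 1) ^ d" "\<exists>K d. \<forall>B. (g B :: nat) \<le> K * (B + 1) ^ d" for f g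
  proof -
    obtain K d K' d' where h: "\<And>B. f B \<le> K * (B + 1) ^ d" "\<And>B. g B \<le> K' * (B + 1) ^ d'" using fg by blast
    have "f B + g B \<le> (K + K') * (B + 1) ^ (d + d')" for B
    proof -
      have "K * (B + 1) ^ d \<le> K * (B + 1) ^ (d + d')" "K' * (B + 1) ^ d' \<le> K' * (B + 1) ^ (d + d')"
        by (intro mult_left_mono power_increasing; simp)+
      then show ?thesis using h[of B] unfolding add_mult_distrib by linarith
    qed
    then show ?thesis by blast
  qed
  {
    case PSkip show ?case unfolding cost.simps by (rule const)
  next
    case (PI k e) show ?case unfolding cost.simps by (rule const)
  next
    case (PR a e) show ?case unfolding cost.simps by (rule const)
  next
    case (PSeq p q) then show ?case unfolding cost.simps by (rule add)
  next
    case (PIf b p q)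
    show ?case unfolding cost.simps by (rule add[OF add[OF add[OF const[of "bcost b"] PIf(1)] PIf(2)] const[of 1]])
  next
    case (PFor k p)
    obtain K d where h: "\<And>B. cost p B + 12 \<le> K * (B + 1) ^ d" using add[OF PFor const[of 12]] by blast
    have "B * (cost p B + 12) \<le> K * (B + 1) ^ Suc d" for B
    proof -
      have "B * (cost p B + 12) \<le> (B + 1) * (K * (B + 1) ^ d)" using h[of B] by (intro mult_mono) auto
      then show ?thesis by (simp add: mult.commute mult.left_commute)
    qed
    then have "\<exists>K d. \<forall>B. B * (cost p B + 12) \<le> K * (B + 1) ^ d" by blast
    then show ?case unfolding cost.simps by (rule add[OF _ const[of 12]])
  }
qed

section \<open>Nests of loops as folds over tuples\<close>

primrec tuples :: "nat \<Rightarrow> nat \<Rightarrow> nat list list" where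
  "tuples B 0 = [[]]"
| "tuples B (Suc d) = concat (map (\<lambda>j. map ((#) j) (tuples B d)) [0..<B])"

lemma set_tuples: "set (tuples B d) = {js. length js = d \<and> set js \<subseteq> {..<B}}"
proof (induction d)
  case (Suc d)
  show ?case by (auto simp: Suc length_Suc_conv image_iff)
qed auto

primrec nest :: "nat list \<Rightarrow> prog \<Rightarrow> prog" where
  "nest [] b = b"
| "nest (k # ks) b = PFor k (nest ks b)"

fun upds :: "(nat \<Rightarrow> nat) \<Rightarrow> nat list \<Rightarrow> nat list \<Rightarrow> nat \<Rightarrow> nat" where
  "upds I (k # ks) (j # js) = upds (I(k := j)) ks js"
| "upds I _ _ = I"

lemma upds_other: "k \<notin> set ks \<Longrightarrow> upds I ks js k = I k"
  by (induction I ks js rule: upds.induct) auto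

lemma fold_concat_map: "fold f (concat xss) s = fold (\<lambda>xs. fold f xs) xss s"
  by (induction xss arbitrary: s) auto

text \<open>The counter is 0 before the loop and reset to 0 after it, so the registers come out
  unchanged and the loop is a fold on the real memory.\<close>

lemma sem_PFor:
  assumes "I k = 0" "k \<noteq> 2"
    and body: "\<And>j r. j < I 2 \<Longrightarrow> sem p (St (I(k := j)) r) = St (I(k := j)) (act j r)"
  shows "sem (PFor k p) (St I r) = St I (fold act [0..<I 2] r)"
proof -
  have "fold (\<lambda>j s. sem p (s\<lparr>imem := (imem s)(k := j)\<rparr>)) [0..<i] (St I r) =
      St (I(k := (if i = 0 then I k else i - 1))) (fold act [0..<i] r)" if "i \<le> I 2" for i
    using that
  proof (induction i)
    case (Suc i)
    then show ?case using body[of i] by (simp del: fun_upd_apply)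
  qed simp
  moreover have "I(k := 0) = I" using assms(1) by (simp add: fun_upd_idem)
  ultimately show ?thesis by (simp add: Let_def del: fun_upd_apply)
qed

lemma sem_nest:
  assumes "distinct ks" "2 \<notin> set ks" "\<And>k. k \<in> set ks \<Longrightarrow> I k = 0"
    and body: "\<And>js r. length js = length ks \<Longrightarrow> set js \<subseteq> {..<I 2} \<Longrightarrow>
       sem b (St (upds I ks js) r) = St (upds I ks js) (act js r)"
  shows "sem (nest ks b) (St I r) = St I (fold act (tuples (I 2) (length ks)) r)"
  using assms
proof (induction ks arbitrary: I act r)
  case Nil
  then show ?case using Nil(4)[of "[]"] by simp
next
  case (Cons k ks)
  have "sem (nest ks b) (St (I(k := j)) r) = St (I(k := j)) (fold (\<lambda>js. act (j # js)) (tuples (I 2) (length ks)) r)"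
    if j: "j < I 2" for j r
  proof -
    have 2: "(I(k := j)) 2 = I 2" using Cons.prems by auto
    have "sem (nest ks b) (St (I(k := j)) r) = St (I(k := j)) (fold (\<lambda>js. act (j # js)) (tuples ((I(k := j)) 2) (length ks)) r)"
    proof (rule Cons.IH)
      show "(I(k := j)) l = 0" if "l \<in> set ks" for l using Cons.prems that by auto
      show "sem b (St (upds (I(k := j)) ks js) r) = St (upds (I(k := j)) ks js) (act (j # js) r)"
        if "length js = length ks" "set js \<subseteq> {..<(I(k := j)) 2}" for js r
        using Cons.prems(4)[of "j # js" r] that j 2 by simp
    qed (use Cons.prems in auto)
    then show ?thesis unfolding 2 .
  qed
  then have "sem (PFor k (nest ks b)) (St I r) =
      St I (fold (\<lambda>j. fold (\<lambda>js. act (j # js)) (tuples (I 2) (length ks))) [0..<I 2] r)"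
    by (intro sem_PFor) (use Cons.prems in auto)
  then show ?case by (simp add: fold_concat_map fold_map o_def)
qed

lemma asg_nest: "asg (nest ks b) = set ks \<union> asg b"
  by (induction ks) auto

lemma wf_nest: "distinct ks \<Longrightarrow> set ks \<inter> asg b = {} \<Longrightarrow> wf b \<Longrightarrow> wf (nest ks b)"
  by (induction ks) (auto simp: asg_nest)

section \<open>Evaluating quantified formulas by loops\<close>

text \<open>Quantifiers range up to register 2. The registers from 100 on are flags for the values of subformulas;
  they and the registers of bound variables are 0 before and after a test.\<close>

datatype fm = FA bexp | FNot fm | FAnd fm fm | FEx nat fm

primrec fval :: "fm \<Rightarrow> (nat \<Rightarrow> nat) \<Rightarrow> (nat \<Rightarrow> real) \<Rightarrow> bool" where
  "fval (FA b) I r = bval b (St I r)"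
| "fval (FNot f) I r = (\<not> fval f I r)"
| "fval (FAnd f g) I r = (fval f I r \<and> fval g I r)"
| "fval (FEx k f) I r = (\<exists>j<I 2. fval f (I(k := j)) r)"

primrec bound_regs :: "fm \<Rightarrow> nat set" where
  "bound_regs (FA b) = {}"
| "bound_regs (FNot f) = bound_regs f"
| "bound_regs (FAnd f g) = bound_regs f \<union> bound_regs g"
| "bound_regs (FEx k f) = insert k (bound_regs f)"

text \<open>Registers are read at constant addresses below 100, so setting flags cannot alter the
  value of an expression.\<close>

primrec iplain :: "iexp \<Rightarrow> bool" where
  "iplain (Num k) = True"
| "iplain (ICell a) = (\<exists>k<100. a = Num k)"
| "iplain (IAdd a b) = (iplain a \<and> iplain b)"
| "iplain (ISub a b) = (iplain a \<and> iplain b)"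
| "iplain (IMul a b) = (iplain a \<and> iplain b)"

primrec rplain :: "rexp \<Rightarrow> bool" where
  "rplain RZero = True"
| "rplain ROne = True"
| "rplain (RCell a) = iplain a"
| "rplain (RAdd a b) = (rplain a \<and> rplain b)"
| "rplain (RSub a b) = (rplain a \<and> rplain b)"
| "rplain (RMul a b) = (rplain a \<and> rplain b)"
| "rplain (RDiv a b) = (rplain a \<and> rplain b)"

primrec bplain :: "bexp \<Rightarrow> bool" where
  "bplain (ILess a b) = (iplain a \<and> iplain b)"
| "bplain (IEq a b) = (iplain a \<and> iplain b)"
| "bplain (RLess a b) = (rplain a \<and> rplain b)"
| "bplain (REq a b) = (rplain a \<and> rplain b)"
| "bplain (BNot b) = bplain b"
| "bplain (BAnd b c) = (bplain b \<and> bplain c)"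

primrec fplain :: "fm \<Rightarrow> bool" where
  "fplain (FA b) = bplain b"
| "fplain (FNot f) = fplain f"
| "fplain (FAnd f g) = (fplain f \<and> fplain g)"
| "fplain (FEx k f) = (fplain f \<and> k \<notin> bound_regs f \<and> 2 < k \<and> k < 100)"

lemma fplain_bound_regs: "fplain f \<Longrightarrow> k \<in> bound_regs f \<Longrightarrow> 2 < k \<and> k < 100"
  by (induction f) auto

lemma iplain_upd: "iplain e \<Longrightarrow> 100 \<le> y \<Longrightarrow> ival e (St (I(y := v)) r) = ival e (St I r)"
  by (induction e) auto

lemma rplain_upd: "rplain e \<Longrightarrow> 100 \<le> y \<Longrightarrow> rval e (St (I(y := v)) r) = rval e (St I r)"
  by (induction e) (auto simp: iplain_upd)

lemma bplain_upd: "bplain e \<Longrightarrow> 100 \<le> y \<Longrightarrow> bval e (St (I(y := v)) r) = bval e (St I r)"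
  by (induction e) (auto simp: iplain_upd rplain_upd)

lemma fplain_upd: "fplain f \<Longrightarrow> 100 \<le> y \<Longrightarrow> fval f (I(y := v)) r = fval f I r"
proof (induction f arbitrary: I)
  case (FEx k f)
  then have "(I(y := v))(k := j) = (I(k := j))(y := v)" for j by (auto simp: fun_upd_twist)
  then show ?case using FEx by (simp del: fun_upd_apply) (simp add: fun_upd_def)
qed (auto simp: bplain_upd)

text \<open>A quantified formula is no \<open>bexp\<close>, so loops compute its truth value into
  flag \<open>z\<close>. Flags above \<open>z\<close> are scratch and are cleared again.\<close>

primrec test :: "fm \<Rightarrow> nat \<Rightarrow> prog" where
  "test (FA b) z = PIf b (PI z (Num 1)) PSkip"
| "test (FNot f) z = PSeq (test f (Suc z)) (PSeq (PIf (IEq (V (Suc z)) (Num 0)) (PI z (Num 1)) PSkip) (PI (Suc z) (Num 0)))"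
| "test (FAnd f g) z = PSeq (test f (Suc z)) (PIf (IEq (V (Suc z)) (Num 1)) (PSeq (PI (Suc z) (Num 0)) (test g z)) PSkip)"
| "test (FEx k f) z = PFor k (PSeq (test f (Suc z))
     (PIf (IEq (V (Suc z)) (Num 1)) (PSeq (PI z (Num 1)) (PI (Suc z) (Num 0))) PSkip))"

lemma sem_test:
  "fplain f \<Longrightarrow> 100 \<le> z \<Longrightarrow> \<forall>y\<ge>z. I y = 0 \<Longrightarrow> \<forall>k\<in>bound_regs f. I k = 0 \<Longrightarrow>
   sem (test f z) (St I r) = St (I(z := (if fval f I r then 1 else 0))) r"
proof (induction f arbitrary: z I)
  case (FA b)
  then have "I(z := 0) = I" by (simp add: fun_upd_idem)
  then show ?case by (simp del: fun_upd_apply)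
next
  case (FNot f)
  have "sem (test f (Suc z)) (St I r) = St (I(Suc z := (if fval f I r then 1 else 0))) r"
    using FNot.prems by (intro FNot.IH) auto
  then show ?case using FNot.prems by (auto simp: fun_eq_iff)
next
  case (FAnd f g)
  have f: "sem (test f (Suc z)) (St I r) = St (I(Suc z := (if fval f I r then 1 else 0))) r"
    using FAnd.prems by (intro FAnd.IH) auto
  have g: "sem (test g z) (St I r) = St (I(z := (if fval g I r then 1 else 0))) r"
    using FAnd.prems by (intro FAnd.IH) auto
  have "I(Suc z := 0) = I" "I(z := 0) = I" "I (Suc z) = 0" using FAnd.prems by (auto simp: fun_eq_iff)
  then show ?case using f g
    by (cases "fval f I r"; cases "fval g I r") (simp_all add: fun_upd_same del: fun_upd_apply)
next
  case (FEx k f)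
  let ?b = "PSeq (test f (Suc z)) (PIf (IEq (V (Suc z)) (Num 1)) (PSeq (PI z (Num 1)) (PI (Suc z) (Num 0))) PSkip)"
  have k: "k \<notin> bound_regs f" "2 < k" "k < 100" "fplain f" using FEx.prems by auto
  have z: "100 \<le> z" "z \<noteq> k" "Suc z \<noteq> k" using FEx.prems k by auto
  have I0: "I k = 0" "I z = 0" "I (Suc z) = 0" using FEx.prems by auto
  have body: "sem ?b (St (I(z := (if P then 1 else 0), k := j)) r) =
      St (I(z := (if P \<or> fval f (I(k := j)) r then 1 else 0), k := j)) r" for P j
  proof -
    let ?J = "I(z := (if P then 1 else 0), k := j)"
    have "sem (test f (Suc z)) (St ?J r) = St (?J(Suc z := (if fval f ?J r then 1 else 0))) r"
      using FEx.prems k z fplain_bound_regs[OF k(4), of z] by (intro FEx.IH) auto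
    moreover have "fval f ?J r = fval f (I(k := j)) r"
      using fplain_upd[OF k(4) z(1), of "I(k := j)" _ r] z by (simp add: fun_upd_twist)
    ultimately show ?thesis using z I0 by (auto simp: fun_eq_iff)
  qed
  have "fold (\<lambda>j s. sem ?b (s\<lparr>imem := (imem s)(k := j)\<rparr>)) [0..<i] (St I r) =
      St (I(z := (if \<exists>j<i. fval f (I(k := j)) r then 1 else 0), k := (if i = 0 then 0 else i - 1))) r" for i
  proof (induction i)
    case 0
    have "I(z := 0, k := 0) = I" using I0 by (auto simp: fun_eq_iff)
    then show ?case by (simp del: fun_upd_apply)
  next
    case (Suc i)
    have "(\<exists>j<Suc i. fval f (I(k := j)) r) \<longleftrightarrow> (\<exists>j<i. fval f (I(k := j)) r) \<or> fval f (I(k := i)) r"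
      by (auto simp: less_Suc_eq)
    then show ?case using Suc body[of "\<exists>j<i. fval f (I(k := j)) r" i] by (simp del: sem.simps fun_upd_apply)
  qed
  from this[of "I 2"] have "sem (PFor k ?b) (St I r) =
      St (I(z := (if \<exists>j<I 2. fval f (I(k := j)) r then 1 else 0), k := 0)) r"
    by (simp add: Let_def del: fun_upd_apply)
  moreover have "I(z := v, k := 0) = I(z := v)" for v using I0 z by (auto simp: fun_eq_iff)
  ultimately show ?case by (simp del: fun_upd_apply)
qed

lemma asg_test: "asg (test f z) \<subseteq> bound_regs f \<union> {z..}"
proof (induction f arbitrary: z)
  case (FAnd f g)
  from FAnd(1)[of "Suc z"] FAnd(2)[of z] show ?case by auto
qed (auto, (use Suc_leD in blast)+)

lemma wf_test: "fplain f \<Longrightarrow> 100 \<le> z \<Longrightarrow> wf (test f z)"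
proof (induction f arbitrary: z)
  case (FEx k f)
  then show ?case using asg_test[of f "Suc z"] by auto
qed auto

section \<open>Arrays in the real memory\<close>

text \<open>Sixteen arrays of arbitrary dimension are interleaved behind the \<open>m * n\<close> entries of the input.\<close>

primrec enc :: "nat \<Rightarrow> nat list \<Rightarrow> nat" where
  "enc B [] = 0"
| "enc B (i # is) = i + B * enc B is"

definition addr :: "(nat \<Rightarrow> nat) \<Rightarrow> nat \<Rightarrow> nat list \<Rightarrow> nat" where
  "addr I d is = I 0 * I 1 + (d + 16 * enc (I 2) is)"

definition get :: "(nat \<Rightarrow> nat) \<Rightarrow> (nat \<Rightarrow> real) \<Rightarrow> nat \<Rightarrow> nat list \<Rightarrow> real" where
  "get I r d is = r (addr I d is)"

primrec encE :: "iexp list \<Rightarrow> iexp" where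
  "encE [] = Num 0"
| "encE (e # es) = IAdd e (IMul (V 2) (encE es))"

definition addrE :: "nat \<Rightarrow> iexp list \<Rightarrow> iexp" where
  "addrE d es = IAdd (IMul (V 0) (V 1)) (IAdd (Num d) (IMul (Num 16) (encE es)))"

definition rd :: "nat \<Rightarrow> iexp list \<Rightarrow> rexp" where
  "rd d es = RCell (addrE d es)"

lemma ival_encE: "ival (encE es) (St I r) = enc (I 2) (map (\<lambda>e. ival e (St I r)) es)"
  by (induction es) auto

lemma ival_addrE: "ival (addrE d es) (St I r) = addr I d (map (\<lambda>e. ival e (St I r)) es)"
  by (simp add: addrE_def addr_def ival_encE)

lemma rval_rd [simp]: "rval (rd d es) (St I r) = get I r d (map (\<lambda>e. ival e (St I r)) es)"
  by (simp add: rd_def ival_addrE get_def)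

lemma iplain_encE: "iplain (encE es) \<longleftrightarrow> (\<forall>e\<in>set es. iplain e)"
  by (induction es) auto

lemma rplain_rd [simp]: "rplain (rd d es) \<longleftrightarrow> (\<forall>e\<in>set es. iplain e)"
  by (auto simp: rd_def addrE_def iplain_encE)

lemma addr_cong: "J 0 = I 0 \<Longrightarrow> J 1 = I 1 \<Longrightarrow> J 2 = I 2 \<Longrightarrow> addr J = addr I"
  by (simp add: addr_def fun_eq_iff)

lemma get_cong: "J 0 = I 0 \<Longrightarrow> J 1 = I 1 \<Longrightarrow> J 2 = I 2 \<Longrightarrow> get J = get I"
  by (simp add: get_def addr_def fun_eq_iff)

lemma get_upd [simp]: "2 < k \<Longrightarrow> get (I(k := v)) = get I"
  by (rule get_cong) auto

lemma addr_upd [simp]: "2 < k \<Longrightarrow> addr (I(k := v)) = addr I"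
  by (rule addr_cong) auto

lemma get_upds: "\<forall>k\<in>set ks. 2 < k \<Longrightarrow> get (upds I ks js) = get I"
  by (rule get_cong) (subst upds_other; force)+

lemma addr_upds: "\<forall>k\<in>set ks. 2 < k \<Longrightarrow> addr (upds I ks js) = addr I"
  by (rule addr_cong) (subst upds_other; force)+

lemma enc_inj:
  "length xs = length ys \<Longrightarrow> set xs \<subseteq> {..<B} \<Longrightarrow> set ys \<subseteq> {..<B} \<Longrightarrow> enc B xs = enc B ys \<Longrightarrow> xs = ys"
proof (induction xs ys rule: list_induct2)
  case (Cons x xs y ys)
  then have "(x + B * enc B xs) mod B = (y + B * enc B ys) mod B" by simp
  then have "x = y" using Cons.prems by simp
  then show ?case using Cons by auto
qed simp

lemma addr_inj:
  assumes "d < 16" "d' < 16" "addr I d xs = addr I d' ys"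
  shows "d = d'" "enc (I 2) xs = enc (I 2) ys"
proof -
  have e: "d + 16 * enc (I 2) xs = d' + 16 * enc (I 2) ys" using assms by (simp add: addr_def)
  then have "(d + 16 * enc (I 2) xs) mod 16 = (d' + 16 * enc (I 2) ys) mod 16" by simp
  then show "d = d'" using assms by simp
  then show "enc (I 2) xs = enc (I 2) ys" using e by simp
qed

text \<open>Every write of the program to the real memory goes through this form, so one correctness
  argument serves all of them.\<close>

definition tab :: "nat list \<Rightarrow> nat \<Rightarrow> iexp list \<Rightarrow> fm \<Rightarrow> rexp \<Rightarrow> rexp \<Rightarrow> prog" where
  "tab ks d idx f e1 e2 = nest ks (PSeq (test f 100) (PSeq
     (PIf (IEq (V 100) (Num 1)) (PR (addrE d idx) e1) (PR (addrE d idx) e2)) (PI 100 (Num 0))))"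

definition cell :: "fm \<Rightarrow> rexp \<Rightarrow> rexp \<Rightarrow> (nat \<Rightarrow> nat) \<Rightarrow> (nat \<Rightarrow> real) \<Rightarrow> real" where
  "cell f e1 e2 I r = (if fval f I r then rval e1 (St I r) else rval e2 (St I r))"

lemma sem_tab:
  assumes ks: "distinct ks" "\<forall>k\<in>set ks. 2 < k \<and> k < 100 \<and> I k = 0 \<and> k \<notin> bound_regs f"
    and plain: "fplain f" "rplain e1" "rplain e2" "\<forall>e\<in>set idx. iplain e"
    and zero: "\<forall>y\<ge>100. I y = 0" "\<forall>k\<in>bound_regs f. I k = 0"
  shows "sem (tab ks d idx f e1 e2) (St I r) = St I (fold (\<lambda>js r. let J = upds I ks js in
      r(addr I d (map (\<lambda>e. ival e (St J r)) idx) := cell f e1 e2 J r)) (tuples (I 2) (length ks)) r)"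
  unfolding tab_def
proof (rule sem_nest)
  fix js :: "nat list" and r
  define J where "J = upds I ks js"
  have J100: "\<forall>y\<ge>100. J y = 0" unfolding J_def
    by (intro allI impI, subst upds_other) (use ks zero in auto)
  have Jb: "\<forall>k\<in>bound_regs f. J k = 0" unfolding J_def
    by (intro ballI, subst upds_other) (use ks zero in auto)
  have t: "sem (test f 100) (St J r) = St (J(100 := (if fval f J r then 1 else 0))) r"
    by (rule sem_test) (use plain J100 Jb in auto)
  have ad: "ival (addrE d idx) (St (J(100 := v)) r) = addr I d (map (\<lambda>e. ival e (St J r)) idx)" for v
    using plain addr_upds[of ks I js] ks
    by (simp add: ival_addrE iplain_upd J_def cong: map_cong)
  have J0: "J(100 := 0) = J" using J100 by (auto simp: fun_eq_iff)
  show "sem (PSeq (test f 100) (PSeq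
     (PIf (IEq (V 100) (Num 1)) (PR (addrE d idx) e1) (PR (addrE d idx) e2)) (PI 100 (Num 0)))) (St (upds I ks js) r) =
     St (upds I ks js) (let J = upds I ks js in r(addr I d (map (\<lambda>e. ival e (St J r)) idx) := cell f e1 e2 J r))"
    unfolding J_def[symmetric] using t ad J0 plain
    by (simp add: cell_def rplain_upd Let_def)
qed (use ks in auto)

text \<open>Sequential writes act like a simultaneous assignment when the targets are distinct and
  the values ignore all cells being written.\<close>

lemma fold_writes:
  fixes W :: "'x \<Rightarrow> nat" and v :: "'x \<Rightarrow> (nat \<Rightarrow> real) \<Rightarrow> real"
  assumes indep: "\<And>x r'. x \<in> set xs \<Longrightarrow> (\<And>l. l \<notin> W ` set xs \<Longrightarrow> r' l = r l) \<Longrightarrow> v x r' = v x r"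
    and inj: "inj_on W (set xs)"
  shows "(\<forall>x\<in>set xs. fold (\<lambda>x r. r(W x := v x r)) xs r (W x) = v x r) \<and>
    (\<forall>l. l \<notin> W ` set xs \<longrightarrow> fold (\<lambda>x r. r(W x := v x r)) xs r l = r l)"
proof -
  have "(\<forall>x\<in>set ys. fold (\<lambda>x r. r(W x := v x r)) ys r (W x) = v x r) \<and>
    (\<forall>l. l \<notin> W ` set ys \<longrightarrow> fold (\<lambda>x r. r(W x := v x r)) ys r l = r l)" if "set ys \<subseteq> set xs" for ys
    using that
  proof (induction ys rule: rev_induct)
    case (snoc y ys)
    let ?r = "fold (\<lambda>x r. r(W x := v x r)) ys r"
    have h: "(\<forall>x\<in>set ys. ?r (W x) = v x r) \<and> (\<forall>l. l \<notin> W ` set ys \<longrightarrow> ?r l = r l)"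
      by (rule snoc.IH) (use snoc.prems in simp)
    have vy: "v y ?r = v y r"
    proof (rule indep)
      fix l assume "l \<notin> W ` set xs"
      then have "l \<notin> W ` set ys" using snoc.prems by auto
      then show "?r l = r l" using h by blast
    qed (use snoc.prems in simp)
    show ?case
    proof (intro conjI ballI allI impI)
      fix x assume x: "x \<in> set (ys @ [y])"
      show "fold (\<lambda>x r. r(W x := v x r)) (ys @ [y]) r (W x) = v x r"
      proof (cases "W x = W y")
        case True
        then have "x = y" using inj x snoc.prems by (auto dest: inj_onD)
        then show ?thesis using vy by simp
      next
        case False
        then show ?thesis using x h by auto
      qed
    next
      fix l assume l: "l \<notin> W ` set (ys @ [y])"
      have "?r l = r l" using h l by simp
      then show "fold (\<lambda>x r. r(W x := v x r)) (ys @ [y]) r l = r l" using l by (simp add: fun_upd_other del: fun_upd_apply)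
    qed
  qed simp
  then show ?thesis by blast
qed

section \<open>The program\<close>

text \<open>The constant real memory is a placeholder: index expressions read registers only, see
  \<open>ival_mem\<close>.\<close>

definition idx_of :: "iexp list \<Rightarrow> nat list \<Rightarrow> (nat \<Rightarrow> nat) \<Rightarrow> nat list \<Rightarrow> nat list" where
  "idx_of idx ks I js = map (\<lambda>e. ival e (St (upds I ks js) (\<lambda>_. 0))) idx"

lemma ival_mem: "ival e (St I r) = ival e (St I r')"
  by (induction e) auto

definition clean :: "(nat \<Rightarrow> nat) \<Rightarrow> nat list \<Rightarrow> fm \<Rightarrow> bool" where
  "clean I ks f \<longleftrightarrow> (\<forall>y\<ge>100. I y = 0) \<and> (\<forall>k\<in>bound_regs f. I k = 0) \<and> (\<forall>k\<in>set ks. I k = 0)"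

definition tab_ok :: "nat list \<Rightarrow> nat \<Rightarrow> iexp list \<Rightarrow> fm \<Rightarrow> rexp \<Rightarrow> rexp \<Rightarrow> bool" where
  "tab_ok ks d idx f e1 e2 \<longleftrightarrow> distinct ks \<and> (\<forall>k\<in>set ks. 2 < k \<and> k < 100 \<and> k \<notin> bound_regs f) \<and>
     d < 16 \<and> fplain f \<and> rplain e1 \<and> rplain e2 \<and> (\<forall>e\<in>set idx. iplain e)"

text \<open>The last conclusion, on entries of the same array that are not addressed, is for
  \<open>lowP\<close>, which writes the slice of one colour.\<close>

lemma tab_arr:
  assumes ok: "tab_ok ks d idx f e1 e2" and cl: "clean I ks f"
    and rng: "\<And>js. length js = length ks \<Longrightarrow> set js \<subseteq> {..<I 2} \<Longrightarrow> set (idx_of idx ks I js) \<subseteq> {..<I 2}"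
    and inj: "\<And>js js'. length js = length ks \<Longrightarrow> length js' = length ks \<Longrightarrow> idx_of idx ks I js = idx_of idx ks I js' \<Longrightarrow> js = js'"
    and indep: "\<And>js r'. length js = length ks \<Longrightarrow> set js \<subseteq> {..<I 2} \<Longrightarrow>
       (\<And>d'. d' < 16 \<Longrightarrow> d' \<noteq> d \<Longrightarrow> get I r' d' = get I r d') \<Longrightarrow> (\<And>l. l < I 0 * I 1 \<Longrightarrow> r' l = r l) \<Longrightarrow>
       cell f e1 e2 (upds I ks js) r' = cell f e1 e2 (upds I ks js) r"
  shows "\<exists>r'. sem (tab ks d idx f e1 e2) (St I r) = St I r' \<and>
    (\<forall>js. length js = length ks \<longrightarrow> set js \<subseteq> {..<I 2} \<longrightarrow> get I r' d (idx_of idx ks I js) = cell f e1 e2 (upds I ks js) r) \<and>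
    (\<forall>d'. d' < 16 \<longrightarrow> d' \<noteq> d \<longrightarrow> get I r' d' = get I r d') \<and> (\<forall>l<I 0 * I 1. r' l = r l) \<and>
    (\<forall>is. length is = length idx \<longrightarrow> set is \<subseteq> {..<I 2} \<longrightarrow>
       (\<forall>js. length js = length ks \<longrightarrow> set js \<subseteq> {..<I 2} \<longrightarrow> is \<noteq> idx_of idx ks I js) \<longrightarrow> get I r' d is = get I r d is)"
proof -
  let ?T = "tuples (I 2) (length ks)"
  let ?W = "\<lambda>js. addr I d (idx_of idx ks I js)"
  let ?v = "\<lambda>js r. cell f e1 e2 (upds I ks js) r"
  let ?r = "fold (\<lambda>js r. r(?W js := ?v js r)) ?T r"
  have T: "js \<in> set ?T \<longleftrightarrow> length js = length ks \<and> set js \<subseteq> {..<I 2}" for js by (simp add: set_tuples)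
  have d16: "d < 16" using ok by (simp add: tab_ok_def)
  have li: "length (idx_of idx ks I js) = length idx" for js by (simp add: idx_of_def)
  have injW: "inj_on ?W (set ?T)"
  proof (rule inj_onI)
    fix x y assume xy: "x \<in> set ?T" "y \<in> set ?T" "?W x = ?W y"
    then have "enc (I 2) (idx_of idx ks I x) = enc (I 2) (idx_of idx ks I y)" using addr_inj(2)[OF d16 d16] by blast
    then have "idx_of idx ks I x = idx_of idx ks I y" using enc_inj[of "idx_of idx ks I x" "idx_of idx ks I y" "I 2"] rng xy T li by metis
    then show "x = y" using inj xy T by blast
  qed
  have notW: "addr I d' is \<notin> ?W ` set ?T" if "d' < 16" "d' \<noteq> d" for d' "is"
    using addr_inj(1)[OF that(1) d16] that by blast
  have lowW: "l \<notin> ?W ` set ?T" if "l < I 0 * I 1" for l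
    using that by (auto simp: addr_def)
  have fw: "(\<forall>x\<in>set ?T. ?r (?W x) = ?v x r) \<and> (\<forall>l. l \<notin> ?W ` set ?T \<longrightarrow> ?r l = r l)"
  proof (rule fold_writes[OF _ injW])
    fix x r' assume x: "x \<in> set ?T" and same: "\<And>l. l \<notin> ?W ` set ?T \<Longrightarrow> r' l = r l"
    have "get I r' d' = get I r d'" if "d' < 16" "d' \<noteq> d" for d'
      using same[OF notW[OF that]] by (simp add: get_def fun_eq_iff)
    moreover have "r' l = r l" if "l < I 0 * I 1" for l using same[OF lowW[OF that]] .
    ultimately show "?v x r' = ?v x r" using indep T x by blast
  qed
  have "sem (tab ks d idx f e1 e2) (St I r) = St I (fold (\<lambda>js r. let J = upds I ks js in
      r(addr I d (map (\<lambda>e. ival e (St J r)) idx) := cell f e1 e2 J r)) ?T r)"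
    by (rule sem_tab) (use ok cl in \<open>auto simp: tab_ok_def clean_def\<close>)
  also have "(\<lambda>js r. let J = upds I ks js in
      r(addr I d (map (\<lambda>e. ival e (St J r)) idx) := cell f e1 e2 J r)) = (\<lambda>js r. r(?W js := ?v js r))"
    unfolding Let_def idx_of_def by (subst ival_mem[where r' = "\<lambda>_. 0"]) (rule refl)
  finally have sem: "sem (tab ks d idx f e1 e2) (St I r) = St I ?r" .
  have other: "get I ?r d is = get I r d is"
    if "length is = length idx" "set is \<subseteq> {..<I 2}"
      "\<forall>js. length js = length ks \<longrightarrow> set js \<subseteq> {..<I 2} \<longrightarrow> is \<noteq> idx_of idx ks I js" for "is"
  proof -
    have "addr I d is \<notin> ?W ` set ?T"
    proof
      assume "addr I d is \<in> ?W ` set ?T"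
      then obtain js where js: "js \<in> set ?T" "addr I d is = ?W js" by blast
      then have "enc (I 2) is = enc (I 2) (idx_of idx ks I js)" using addr_inj(2)[OF d16 d16] by blast
      then have "is = idx_of idx ks I js" using enc_inj[of "is" "idx_of idx ks I js" "I 2"] rng js T li that by metis
      then show False using that T js by blast
    qed
    then show ?thesis using fw by (simp add: get_def)
  qed
  show ?thesis
    using sem fw other notW lowW T by (intro exI[of _ ?r]) (simp add: get_def fun_eq_iff)
qed

lemma asg_tab: "asg (tab ks d idx f e1 e2) \<subseteq> set ks \<union> bound_regs f \<union> {100..}"
  using asg_test[of f 100] by (auto simp: tab_def asg_nest)

lemma wf_tab: "tab_ok ks d idx f e1 e2 \<Longrightarrow> wf (tab ks d idx f e1 e2)"
  unfolding tab_def
proof (rule wf_nest)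
  assume ok: "tab_ok ks d idx f e1 e2"
  have "set ks \<inter> (bound_regs f \<union> {100..}) = {}" using ok by (force simp: tab_ok_def)
  then show "set ks \<inter> asg (PSeq (test f 100) (PSeq (PIf (IEq (V 100) (Num 1)) (PR (addrE d idx) e1) (PR (addrE d idx) e2)) (PI 100 (Num 0)))) = {}"
    using asg_test[of f 100] by auto
qed (auto simp: tab_ok_def wf_test)

text \<open>Arrays: 0 entries by vertices, 1 lower bounds, 2 closure of the forced equalities, 3 intermediate values, 4 offset,
  5 reachability of literals, 6 values of \<open>cap\<close>, 7 and 8 the two terms of the lower bounds, 15 answer.\<close>

definition trueF :: fm where "trueF = FA (IEq (Num 0) (Num 0))"
definition orF :: "fm \<Rightarrow> fm \<Rightarrow> fm" where "orF f g = FNot (FAnd (FNot f) (FNot g))"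
definition rowF :: "nat \<Rightarrow> fm" where "rowF u = FA (ILess (V u) (V 0))"
definition vtxF :: "nat \<Rightarrow> fm" where "vtxF u = FA (ILess (V u) (IAdd (V 0) (V 1)))"
definition eqF :: "nat \<Rightarrow> nat \<Rightarrow> fm" where "eqF u v = FA (IEq (V u) (V v))"
definition colF :: "nat \<Rightarrow> fm" where "colF t = FA (ILess (V t) (Num 3))"
definition oppF :: "nat \<Rightarrow> nat \<Rightarrow> fm" where
  "oppF u v = FAnd (vtxF u) (FAnd (vtxF v) (orF (FAnd (rowF u) (FNot (rowF v))) (FAnd (rowF v) (FNot (rowF u)))))"
definition notinF :: "iexp \<Rightarrow> nat \<Rightarrow> nat \<Rightarrow> fm" where
  "notinF t u v = FA (RLess (rd 0 [V u, V v]) (RAdd (rd 1 [t, V u]) (rd 1 [t, V v])))"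
definition forcedF :: "nat \<Rightarrow> nat \<Rightarrow> nat \<Rightarrow> fm" where
  "forcedF t i j = FAnd (rowF i) (FAnd (FNot (rowF j)) (FAnd (vtxF j)
     (FNot (FEx 40 (FAnd (colF 40) (FAnd (FNot (eqF 40 t)) (FNot (notinF (V 40) i j))))))))"

type_synonym lreg = "nat \<times> nat \<times> nat"

definition litF :: "lreg \<Rightarrow> fm" where
  "litF = (\<lambda>(t, u, v). FAnd (colF t) (FAnd (vtxF u) (FAnd (vtxF v) (orF (eqF u v) (oppF u v)))))"
definition clauseF :: "lreg \<Rightarrow> lreg \<Rightarrow> fm" where
  "clauseF = (\<lambda>(s, u, v) (t, w, x). FAnd (colF s) (FAnd (colF t) (FAnd (FNot (eqF s t)) (FAnd (vtxF u) (FAnd (vtxF v)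
     (FAnd (eqF w v) (FAnd (eqF x u) (orF (eqF u v) (FAnd (oppF u v) (notinF (ISub (ISub (Num 3) (V s)) (V t)) u v))))))))))"
definition capE :: "lreg \<Rightarrow> rexp" where "capE = (\<lambda>(t, u, v). rd 6 [V t, V u, V v])"
definition clashF :: "lreg \<Rightarrow> lreg \<Rightarrow> fm" where
  "clashF l k = FAnd (litF l) (FAnd (litF k) (case (l, k) of ((s, u, v), (t, w, x)) \<Rightarrow> FAnd (eqF s t)
     (orF (FAnd (rowF u) (FAnd (FNot (rowF w)) (FA (RLess (RAdd (capE l) (capE k)) (rd 2 [V t, V u, V w])))))
       (orF (FAnd (rowF w) (FAnd (FNot (rowF u)) (FA (RLess (RAdd (capE l) (capE k)) (rd 2 [V t, V w, V u])))))
         (FAnd (FAnd (eqF u w) (eqF v x)) (FA (RLess (capE l) (rd 1 [V s, V u]))))))))"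
definition exF :: "lreg \<Rightarrow> fm \<Rightarrow> fm" where "exF = (\<lambda>(t, u, v) f. FEx t (FEx u (FEx v f)))"
definition reachE :: "lreg \<Rightarrow> lreg \<Rightarrow> rexp" where
  "reachE = (\<lambda>(s, u, v) (t, w, x). rd 5 [V s, V u, V v, V t, V w, V x])"
definition reachF :: "lreg \<Rightarrow> lreg \<Rightarrow> fm" where "reachF l k = FA (REq (reachE l k) ROne)"
definition badF :: "lreg \<Rightarrow> fm" where
  "badF l = exF (46, 47, 48) (exF (49, 50, 51) (FAnd (litF (46, 47, 48)) (FAnd (litF (49, 50, 51))
     (FAnd (reachF l (46, 47, 48)) (FAnd (reachF l (49, 50, 51)) (clashF (46, 47, 48) (49, 50, 51)))))))"
definition consistentF :: fm where
  "consistentF = FNot (exF (52, 53, 54) (exF (43, 44, 45) (FAnd (litF (52, 53, 54)) (FAnd (litF (43, 44, 45))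
     (FAnd (clauseF (52, 53, 54) (43, 44, 45)) (FAnd (badF (52, 53, 54)) (badF (43, 44, 45))))))))"
definition sumE :: "nat \<Rightarrow> nat \<Rightarrow> nat \<Rightarrow> nat \<Rightarrow> nat \<Rightarrow> rexp" where
  "sumE t u v i j = RAdd (RSub (rd 2 [V t, V u, V j]) (rd 0 [V i, V j])) (rd 2 [V t, V i, V v])"
definition closedF :: fm where
  "closedF = FNot (FEx 43 (FEx 44 (FEx 45 (FAnd (colF 43) (FAnd (rowF 44) (FAnd (FNot (rowF 45)) (FAnd (vtxF 45)
     (orF (FA (RLess (rd 2 [V 43, V 44, V 45]) (rd 0 [V 44, V 45])))
       (FEx 46 (FEx 47 (FAnd (forcedF 43 46 47) (FA (RLess (rd 2 [V 43, V 44, V 45]) (sumE 43 44 45 46 47))))))))))))))"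

text \<open>A relaxation step reads the array that it updates, whereas a simultaneous assignment
  must not read its target; the new values therefore go through array 3.\<close>

definition copyP :: "nat \<Rightarrow> nat list \<Rightarrow> prog" where
  "copyP d ks = tab ks d (map V ks) trueF (rd 3 (map V ks)) RZero"

text \<open>There are three cases but \<open>tab\<close> has two branches, so the column-row half is
  first built in array 7.\<close>

definition entryP :: prog where
  "entryP = PSeq
    (tab [30, 31] 7 [V 30, V 31] (FAnd (rowF 31) (FAnd (FNot (rowF 30)) (vtxF 30)))
      (RCell (IAdd (IMul (V 31) (V 1)) (ISub (V 30) (V 0)))) RZero)
    (tab [30, 31] 0 [V 30, V 31] (FAnd (rowF 30) (FAnd (FNot (rowF 31)) (vtxF 31)))
      (RCell (IAdd (IMul (V 30) (V 1)) (ISub (V 31) (V 0)))) (rd 7 [V 30, V 31]))"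

definition offE :: "nat \<Rightarrow> rexp" where
  "offE t = (if t = 0 then
     RSub (RAdd (RSub (rd 0 [V 27, V 16]) (rd 0 [V 27, V 29])) (rd 2 [Num 0, V 25, V 29]))
       (RAdd (RSub (rd 0 [V 26, V 19]) (rd 0 [V 26, V 28])) (rd 2 [Num 0, V 25, V 28]))
   else RSub (rd 0 [V (22 + t), V (16 + t)]) (rd 0 [V (22 + t), V (19 + t)]))"

definition lowP :: "nat \<Rightarrow> prog" where
  "lowP t = PSeq (tab [] 4 [] trueF (offE t) RZero) (PSeq
    (tab [30] 7 [V 30] (rowF 30) (rd 0 [V 30, V (19 + t)]) (RSub (rd 0 [V 30, V (10 + t)]) (rd 0 [V (10 + t), V (19 + t)]))) (PSeq
    (tab [30] 8 [V 30] (rowF 30) (RSub (rd 0 [V 30, V (16 + t)]) (rd 4 []))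
      (RAdd (RSub (rd 0 [V 30, V (13 + t)]) (rd 0 [V (13 + t), V (16 + t)])) (rd 4 [])))
    (tab [30] 1 [Num t, V 30] (FA (RLess (rd 7 [V 30]) (rd 8 [V 30]))) (rd 8 [V 30]) (rd 7 [V 30]))))"

definition linkP :: prog where
  "linkP = PSeq (tab [30, 31, 32] 3 [V 30, V 31, V 32]
      (FAnd (forcedF 30 36 37) (FA (RLess (rd 2 [V 30, V 31, V 32]) (sumE 30 31 32 36 37))))
      (sumE 30 31 32 36 37) (rd 2 [V 30, V 31, V 32])) (copyP 2 [30, 31, 32])"

definition closureP :: prog where
  "closureP = PSeq (tab [30, 31, 32] 2 [V 30, V 31, V 32] trueF (rd 0 [V 31, V 32]) RZero) (nest [36, 37] linkP)"

definition stageP :: prog where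
  "stageP = PSeq (lowP 0) (PSeq (lowP 1) (PSeq (lowP 2) closureP))"

definition capP :: prog where
  "capP = tab [30, 31, 32] 6 [V 30, V 31, V 32] (eqF 31 32) (rd 1 [V 30, V 31]) (RSub (rd 0 [V 31, V 32]) (rd 1 [V 30, V 32]))"

abbreviation R6 :: "nat list" where "R6 \<equiv> [30, 31, 32, 33, 34, 35]"

definition reach_linkP :: prog where
  "reach_linkP = PSeq (tab R6 3 (map V R6)
      (FA (RLess (reachE (30, 31, 32) (33, 34, 35))
         (RAdd (RSub (reachE (30, 31, 32) (36, 37, 38)) ROne) (reachE (36, 37, 38) (33, 34, 35)))))
      (RAdd (RSub (reachE (30, 31, 32) (36, 37, 38)) ROne) (reachE (36, 37, 38) (33, 34, 35)))
      (reachE (30, 31, 32) (33, 34, 35))) (copyP 5 R6)"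

definition reachP :: prog where
  "reachP = PSeq (tab R6 5 (map V R6)
      (orF (FAnd (eqF 30 33) (FAnd (eqF 31 34) (eqF 32 35)))
        (exF (40, 41, 42) (FAnd (clashF (30, 31, 32) (40, 41, 42)) (clauseF (40, 41, 42) (33, 34, 35)))))
      ROne RZero) (nest [36, 37, 38] reach_linkP)"

text \<open>On rejection the old value is kept, so over all guesses the cell accumulates a
  disjunction.\<close>

definition verdictP :: prog where
  "verdictP = tab [] 15 [] (FAnd closedF consistentF) ROne (rd 15 [])"

text \<open>The second stage recomputes the lower bounds with the closure for colour 0 that the first one has found.\<close>

definition guessP :: prog where
  "guessP = PSeq stageP (PSeq stageP (PSeq capP (PSeq reachP verdictP)))"

definition twoF :: fm where
  "twoF = FEx 40 (FEx 41 (FAnd (FAnd (FNot (rowF 40)) (vtxF 40)) (FAnd (FAnd (FNot (rowF 41)) (vtxF 41))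
     (FNot (FEx 42 (FEx 43 (FAnd (rowF 42) (FAnd (FAnd (FNot (rowF 43)) (vtxF 43)) (FAnd
       (FEx 44 (FAnd (rowF 44) (FA (RLess (RSub (rd 0 [V 42, V 43]) (rd 0 [V 42, V 40])) (RSub (rd 0 [V 44, V 43]) (rd 0 [V 44, V 40]))))))
       (FEx 45 (FAnd (rowF 45) (FA (RLess (RSub (rd 0 [V 42, V 43]) (rd 0 [V 42, V 41])) (RSub (rd 0 [V 45, V 43]) (rd 0 [V 45, V 41])))))))))))))))"

text \<open>\<open>offset\<close> and \<open>lower\<close> read \<open>G\<close> within this range;
  the twenty nested loops try \<open>bnd ^ 20\<close> assignments.\<close>

definition guess_regs :: "nat list" where "guess_regs = [10..<30]"

text \<open>Registers 0 and 1 hold the dimensions, on which all addresses depend, so the answer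
  overwrites register 0 at the very end.\<close>

definition mainP :: prog where
  "mainP = PSeq entryP (PSeq (nest guess_regs guessP) (PSeq (test twoF 100)
     (PIf (BAnd (REq (rd 15 []) ROne) (IEq (V 100) (Num 0))) (PI 0 (Num 1)) (PI 0 (Num 0)))))"

section \<open>Side conditions on formulas and registers\<close>

lemmas fm_defs = trueF_def orF_def rowF_def vtxF_def eqF_def colF_def oppF_def notinF_def forcedF_def litF_def
  clauseF_def capE_def clashF_def exF_def reachE_def reachF_def badF_def consistentF_def sumE_def closedF_def offE_def

lemma fval_or [simp]: "fval (orF f g) I r \<longleftrightarrow> fval f I r \<or> fval g I r"
  by (simp add: orF_def)

lemma bound_regs_fm [simp]:
  "bound_regs trueF = {}" "bound_regs (orF f g) = bound_regs f \<union> bound_regs g" "bound_regs (rowF u) = {}" "bound_regs (vtxF u) = {}"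
  "bound_regs (eqF u v) = {}" "bound_regs (colF t) = {}" "bound_regs (oppF u v) = {}" "bound_regs (notinF e u v) = {}"
  "bound_regs (forcedF t u v) = {40}" "bound_regs (litF l) = {}" "bound_regs (clauseF l k) = {}" "bound_regs (clashF l k) = {}"
  "bound_regs (exF l f) = insert (fst l) (insert (fst (snd l)) (insert (snd (snd l)) (bound_regs f)))" "bound_regs (reachF l k) = {}"
  "bound_regs (badF l) = {46, 47, 48, 49, 50, 51}"
  "bound_regs consistentF = {43, 44, 45, 46, 47, 48, 49, 50, 51, 52, 53, 54}"
  "bound_regs closedF = {40, 43, 44, 45, 46, 47}"
  by (auto simp: fm_defs split: prod.splits)

lemma rplain_fm [simp]:
  "rplain (capE (t, u, v)) \<longleftrightarrow> t < 100 \<and> u < 100 \<and> v < 100"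
  "rplain (sumE t u v i j) \<longleftrightarrow> t < 100 \<and> u < 100 \<and> v < 100 \<and> i < 100 \<and> j < 100"
  "rplain (reachE (s, u, v) (t, w, x)) \<longleftrightarrow> s < 100 \<and> u < 100 \<and> v < 100 \<and> t < 100 \<and> w < 100 \<and> x < 100"
  "t < 10 \<Longrightarrow> rplain (offE t)"
  by (auto simp: capE_def sumE_def reachE_def offE_def)

lemma fplain_fm [simp]:
  "fplain trueF" "fplain (orF f g) \<longleftrightarrow> fplain f \<and> fplain g" "fplain (rowF u) \<longleftrightarrow> u < 100" "fplain (vtxF u) \<longleftrightarrow> u < 100"
  "fplain (eqF u v) \<longleftrightarrow> u < 100 \<and> v < 100" "fplain (colF t) \<longleftrightarrow> t < 100"
  "fplain (oppF u v) \<longleftrightarrow> u < 100 \<and> v < 100" "fplain (notinF e u v) \<longleftrightarrow> iplain e \<and> u < 100 \<and> v < 100"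
  "fplain (forcedF t u v) \<longleftrightarrow> t < 100 \<and> u < 100 \<and> v < 100"
  "fplain (litF (t, u, v)) \<longleftrightarrow> t < 100 \<and> u < 100 \<and> v < 100"
  "fplain (clauseF (s, u, v) (t, w, x)) \<longleftrightarrow> s < 100 \<and> u < 100 \<and> v < 100 \<and> t < 100 \<and> w < 100 \<and> x < 100"
  "fplain (clashF (s, u, v) (t, w, x)) \<longleftrightarrow> s < 100 \<and> u < 100 \<and> v < 100 \<and> t < 100 \<and> w < 100 \<and> x < 100"
  "fplain (reachF (s, u, v) (t, w, x)) \<longleftrightarrow> s < 100 \<and> u < 100 \<and> v < 100 \<and> t < 100 \<and> w < 100 \<and> x < 100"
  by (auto simp: trueF_def orF_def rowF_def vtxF_def eqF_def colF_def oppF_def notinF_def forcedF_def litF_def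
      clauseF_def clashF_def reachF_def)

lemma fplain_ex [simp]:
  "fplain (exF (t, u, v) f) \<longleftrightarrow> fplain f \<and> 2 < t \<and> t < 100 \<and> 2 < u \<and> u < 100 \<and> 2 < v \<and> v < 100 \<and>
     distinct [t, u, v] \<and> t \<notin> bound_regs f \<and> u \<notin> bound_regs f \<and> v \<notin> bound_regs f"
  by (auto simp: exF_def)

lemma fplain_bad [simp]: "fplain (badF (t, u, v)) \<longleftrightarrow> t < 100 \<and> u < 100 \<and> v < 100"
  by (auto simp: badF_def exF_def)

lemma fplain_closed_consistent [simp]: "fplain closedF" "fplain consistentF" "fplain twoF"
  by (auto simp: closedF_def consistentF_def exF_def twoF_def)

lemma asg_main: "wf mainP \<and> 2 \<notin> asg mainP"
proof -
  have tab: "wf (tab ks d idx f e1 e2) \<and> asg (tab ks d idx f e1 e2) \<subseteq> S \<union> {100..}"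
    if "tab_ok ks d idx f e1 e2" "set ks \<union> bound_regs f \<subseteq> S" for ks d idx f e1 e2 S
    using wf_tab[OF that(1)] asg_tab[of ks d idx f e1 e2] that(2) by blast
  let ?S = "{30..99} :: nat set"
  have link: "wf linkP \<and> asg linkP \<subseteq> {30, 31, 32, 40} \<union> {100..}"
    unfolding linkP_def copyP_def
    using tab[of "[30, 31, 32]" 3 "[V 30, V 31, V 32]" "FAnd (forcedF 30 36 37) (FA (RLess (rd 2 [V 30, V 31, V 32]) (sumE 30 31 32 36 37)))"
        "sumE 30 31 32 36 37" "rd 2 [V 30, V 31, V 32]" "{30, 31, 32, 40}"]
      tab[of "[30, 31, 32]" 2 "map V [30, 31, 32]" trueF "rd 3 (map V [30, 31, 32])" RZero "{30, 31, 32, 40}"]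
    by (simp add: tab_ok_def)
  have rlink: "wf reach_linkP \<and> asg reach_linkP \<subseteq> set R6 \<union> {100..}"
    unfolding reach_linkP_def copyP_def wf.simps asg.simps
    by (intro conjI Un_least wf_tab conjunct2[OF tab]) (simp_all add: tab_ok_def)
  have n: "wf (nest [36, 37] linkP)" "asg (nest [36, 37] linkP) \<subseteq> ?S \<union> {100..}"
    using link wf_nest[of "[36, 37]" linkP] by (auto simp: asg_nest)
  have n': "wf (nest [36, 37, 38] reach_linkP)" "asg (nest [36, 37, 38] reach_linkP) \<subseteq> ?S \<union> {100..}"
    using rlink wf_nest[of "[36, 37, 38]" reach_linkP] by (auto simp: asg_nest)
  have "wf guessP \<and> asg guessP \<subseteq> ?S \<union> {100..}"
    unfolding guessP_def stageP_def lowP_def closureP_def capP_def reachP_def verdictP_def wf.simps asg.simps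
    by (intro conjI Un_least n n' wf_tab conjunct2[OF tab]) (auto simp: tab_ok_def)
  then have "wf (nest guess_regs guessP) \<and> asg (nest guess_regs guessP) \<subseteq> {10..99} \<union> {100..}"
    using wf_nest[of guess_regs guessP] by (auto simp: asg_nest guess_regs_def)
  moreover have "wf entryP \<and> asg entryP \<subseteq> ?S \<union> {100..}"
    unfolding entryP_def wf.simps asg.simps
    by (intro conjI Un_least wf_tab conjunct2[OF tab]) (auto simp: tab_ok_def)
  moreover have "wf (test twoF 100) \<and> asg (test twoF 100) \<subseteq> {3..}"
    using wf_test[of twoF 100] asg_test[of twoF 100] fplain_bound_regs[of twoF] by fastforce
  ultimately show ?thesis unfolding mainP_def by auto
qed

section \<open>Correctness of the program\<close>

lemma upds_V: "distinct ks \<Longrightarrow> length js = length ks \<Longrightarrow> map (upds I ks js) ks = js"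
proof (induction ks arbitrary: js I)
  case (Cons k ks)
  then obtain j js' where js: "js = j # js'" by (cases js) auto
  then show ?case using Cons upds_other[of k ks "I(k := j)" js'] by simp
qed simp

lemma idx_of_V: "distinct ks \<Longrightarrow> length js = length ks \<Longrightarrow> idx_of (map V ks) ks I js = js"
  using upds_V[of ks js I] by (simp add: idx_of_def comp_def)

definition tab_post :: "nat list \<Rightarrow> nat \<Rightarrow> fm \<Rightarrow> rexp \<Rightarrow> rexp \<Rightarrow> (nat \<Rightarrow> nat) \<Rightarrow> (nat \<Rightarrow> real) \<Rightarrow> (nat \<Rightarrow> real) \<Rightarrow> bool" where
  "tab_post ks d f e1 e2 I r r' \<longleftrightarrow>
    (\<forall>js. length js = length ks \<longrightarrow> set js \<subseteq> {..<I 2} \<longrightarrow> get I r' d js = cell f e1 e2 (upds I ks js) r) \<and>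
    (\<forall>d'<16. d' \<noteq> d \<longrightarrow> get I r' d' = get I r d') \<and> (\<forall>l<I 0 * I 1. r' l = r l)"

definition tab_indep :: "nat list \<Rightarrow> nat \<Rightarrow> fm \<Rightarrow> rexp \<Rightarrow> rexp \<Rightarrow> (nat \<Rightarrow> nat) \<Rightarrow> (nat \<Rightarrow> real) \<Rightarrow> bool" where
  "tab_indep ks d f e1 e2 I r \<longleftrightarrow> (\<forall>js r'. length js = length ks \<longrightarrow> set js \<subseteq> {..<I 2} \<longrightarrow>
     (\<forall>d'<16. d' \<noteq> d \<longrightarrow> get I r' d' = get I r d') \<longrightarrow> (\<forall>l<I 0 * I 1. r' l = r l) \<longrightarrow>
     cell f e1 e2 (upds I ks js) r' = cell f e1 e2 (upds I ks js) r)"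

lemma tab_full:
  assumes ok: "tab_ok ks d idx f e1 e2" and cl: "clean I ks f" and idx: "idx = map V ks"
    and indep: "tab_indep ks d f e1 e2 I r"
  shows "\<exists>r'. sem (tab ks d idx f e1 e2) (St I r) = St I r' \<and> tab_post ks d f e1 e2 I r r'"
proof -
  have ks: "distinct ks" using ok by (simp add: tab_ok_def)
  have "\<exists>r'. sem (tab ks d idx f e1 e2) (St I r) = St I r' \<and>
    (\<forall>js. length js = length ks \<longrightarrow> set js \<subseteq> {..<I 2} \<longrightarrow> get I r' d (idx_of idx ks I js) = cell f e1 e2 (upds I ks js) r) \<and>
    (\<forall>d'. d' < 16 \<longrightarrow> d' \<noteq> d \<longrightarrow> get I r' d' = get I r d') \<and> (\<forall>l<I 0 * I 1. r' l = r l) \<and>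
    (\<forall>is. length is = length idx \<longrightarrow> set is \<subseteq> {..<I 2} \<longrightarrow>
       (\<forall>js. length js = length ks \<longrightarrow> set js \<subseteq> {..<I 2} \<longrightarrow> is \<noteq> idx_of idx ks I js) \<longrightarrow> get I r' d is = get I r d is)"
    (is "\<exists>r'. ?A r' \<and> ?B r' \<and> ?C r' \<and> ?D r' \<and> ?E r'")
  proof (rule tab_arr[OF ok cl])
    fix js r' assume h: "length js = length ks" "set js \<subseteq> {..<I 2}"
      "\<And>d'. d' < 16 \<Longrightarrow> d' \<noteq> d \<Longrightarrow> get I r' d' = get I r d'" "\<And>l. l < I 0 * I 1 \<Longrightarrow> r' l = r l"
    show "cell f e1 e2 (upds I ks js) r' = cell f e1 e2 (upds I ks js) r"
      by (rule indep[unfolded tab_indep_def, rule_format]) (use h in blast)+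
  qed (simp_all add: idx idx_of_V[OF ks])
  then obtain r' where r': "?A r'" "?B r'" "?C r'" "?D r'" by (elim exE conjE) (rule that)
  have "tab_post ks d f e1 e2 I r r'"
    using r'(2-4) unfolding tab_post_def by (simp add: idx idx_of_V[OF ks])
  with r'(1) show ?thesis by blast
qed

lemma sem_nest_ex:
  assumes "distinct ks" "2 \<notin> set ks" "\<And>k. k \<in> set ks \<Longrightarrow> I k = 0"
    and body: "\<And>js r. length js = length ks \<Longrightarrow> set js \<subseteq> {..<I 2} \<Longrightarrow> \<exists>r'. sem b (St (upds I ks js) r) = St (upds I ks js) r'"
  shows "sem (nest ks b) (St I r) = St I (fold (\<lambda>js r. rmem (sem b (St (upds I ks js) r))) (tuples (I 2) (length ks)) r)"
proof (rule sem_nest[OF assms(1-3)])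
  fix js r assume "length js = length ks" "set js \<subseteq> {..<I 2}"
  then obtain r' where "sem b (St (upds I ks js) r) = St (upds I ks js) r'" using body by blast
  then show "sem b (St (upds I ks js) r) = St (upds I ks js) (rmem (sem b (St (upds I ks js) r)))" by simp
qed

lemma fold_related:
  assumes "\<And>x r K. x \<in> set xs \<Longrightarrow> Q r K \<Longrightarrow> Q (f x r) (g x K)" "Q r K"
  shows "Q (fold f xs r) (fold g xs K)"
  using assms by (induction xs arbitrary: r K) auto

lemma tuples_1: "tuples B (Suc 0) = map (\<lambda>j. [j]) [0..<B]"
  by (simp add: comp_def concat_map_singleton)

text \<open>Relaxations are specified as folds in a fixed order; the loops visit links and literals
  in that same order.\<close>

lemma tuples_product:
  "map (\<lambda>js. (js ! 0, js ! 1)) (tuples B 2) = List.product [0..<B] [0..<B]"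
  "map (\<lambda>js. (js ! 0, js ! 1, js ! 2)) (tuples B 3) = List.product [0..<B] (List.product [0..<B] [0..<B])"
  unfolding numeral_2_eq_2 numeral_3_eq_3
  by (simp_all only: tuples.simps(2)[of B "Suc 0"] tuples.simps(2)[of B "Suc (Suc 0)"] tuples_1)
    (simp_all add: product_concat_map map_concat comp_def)

abbreviation Lr :: "(nat \<Rightarrow> nat) \<Rightarrow> (nat \<Rightarrow> real) \<Rightarrow> nat \<Rightarrow> nat \<Rightarrow> real" where
  "Lr I r \<equiv> \<lambda>t u. get I r 1 [t, u]"
abbreviation Kr :: "(nat \<Rightarrow> nat) \<Rightarrow> (nat \<Rightarrow> real) \<Rightarrow> nat \<Rightarrow> nat \<Rightarrow> nat \<Rightarrow> real" where
  "Kr I r \<equiv> \<lambda>t u v. get I r 2 [t, u, v]"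

definition rg :: "(nat \<Rightarrow> nat) \<Rightarrow> lreg \<Rightarrow> lit" where "rg I = (\<lambda>(t, u, v). (I t, I u, I v))"

lemma rg_simp [simp]: "rg I (t, u, v) = (I t, I u, I v)" by (simp add: rg_def)

section \<open>Meaning of the formulas under the memory layout\<close>

context bipartite_form
begin

definition env :: "(nat \<Rightarrow> nat) \<Rightarrow> (nat \<Rightarrow> real) \<Rightarrow> bool" where
  "env I r \<longleftrightarrow> I 0 = m \<and> I 1 = n \<and> I 2 = bnd \<and> (\<forall>u<bnd. \<forall>v<bnd. get I r 0 [u, v] = a u v)"

lemma env_upd [simp]: "2 < k \<Longrightarrow> env (I(k := v)) r = env I r"
  by (simp add: env_def)

lemma bnd_gt: "3 \<le> bnd" "m + n < bnd"
  by (auto simp: bnd_def)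

lemma env_entry: "env I r \<Longrightarrow> opp u v \<Longrightarrow> get I r 0 [u, v] = a u v"
  using bnd_gt by (auto simp: env_def opp_def)

lemma fval_simple [simp]:
  assumes "env I r"
  shows "fval trueF I r" "fval (rowF u) I r \<longleftrightarrow> I u < m" "fval (vtxF u) I r \<longleftrightarrow> I u < m + n"
    "fval (eqF u v) I r \<longleftrightarrow> I u = I v" "fval (colF u) I r \<longleftrightarrow> I u < 3"
    "fval (oppF u v) I r \<longleftrightarrow> opp (I u) (I v)"
  using assms by (auto simp: env_def trueF_def rowF_def vtxF_def eqF_def colF_def oppF_def opp_def)

lemma fval_notin [simp]:
  "env I r \<Longrightarrow> opp (I u) (I v) \<Longrightarrow> fval (notinF t u v) I r \<longleftrightarrow> excluded (Lr I r) (ival t (St I r)) (I u) (I v)"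
  by (simp add: notinF_def excluded_def env_entry)

lemma fval_forced [simp]:
  assumes e: "env I r" and ne: "t \<noteq> 40" "i \<noteq> 40" "j \<noteq> 40"
  shows "fval (forcedF t i j) I r \<longleftrightarrow> forced (Lr I r) (I t) (I i) (I j)"
proof (cases "I i < m \<and> \<not> I j < m \<and> I j < m + n")
  case True
  then have "opp (I i) (I j)" by (auto simp: opp_def)
  moreover have "(\<exists>s<bnd. s < 3 \<and> P s) \<longleftrightarrow> (\<exists>s<3. P s)" for P using bnd_gt(1) by (meson less_le_trans)
  moreover have "I 2 = bnd" using e by (simp add: env_def)
  ultimately show ?thesis using e ne True by (auto simp: forcedF_def forced_def)
next
  case False
  then show ?thesis using e by (auto simp: forcedF_def forced_def)
qed

lemma fval_lit [simp]: "env I r \<Longrightarrow> fval (litF l) I r \<longleftrightarrow> rg I l \<in> lits"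
  by (cases l) (auto simp: litF_def lits_def)

lemma fval_clause [simp]: "env I r \<Longrightarrow> fval (clauseF l k) I r \<longleftrightarrow> clause (Lr I r) (rg I l) (rg I k)"
  by (cases l; cases k) (auto simp: clauseF_def clause_def)

definition caps :: "(nat \<Rightarrow> nat) \<Rightarrow> (nat \<Rightarrow> real) \<Rightarrow> bool" where
  "caps I r \<longleftrightarrow> (\<forall>l\<in>lits. get I r 6 [fst l, fst (snd l), snd (snd l)] = cap (Lr I r) l)"

lemma caps_upd [simp]: "2 < k \<Longrightarrow> caps (I(k := v)) r = caps I r"
  by (simp add: caps_def)

lemma caps_get: "caps I r \<Longrightarrow> (t, u, v) \<in> lits \<Longrightarrow> get I r 6 [t, u, v] = cap (Lr I r) (t, u, v)"
  unfolding caps_def by force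

lemma fval_clash [simp]:
  assumes "env I r" "caps I r"
  shows "fval (clashF l k) I r \<longleftrightarrow> clash (Lr I r) (Kr I r) (rg I l) (rg I k)"
proof (cases "rg I l \<in> lits \<and> rg I k \<in> lits")
  case True
  obtain s u v t w x where lk: "l = (s, u, v)" "k = (t, w, x)" by (cases l; cases k)
  have "get I r 6 [I s, I u, I v] = cap (Lr I r) (I s, I u, I v)" "get I r 6 [I t, I w, I x] = cap (Lr I r) (I t, I w, I x)"
    using True caps_get[OF assms(2)] lk by auto
  then show ?thesis using assms(1) True by (auto simp: lk clashF_def clash_def capE_def)
next
  case False
  then show ?thesis using assms(1) by (auto simp: clashF_def clash_def)
qed

lemma fval_ex [simp]:
  "I 2 = bnd \<Longrightarrow> 2 < t \<Longrightarrow> 2 < u \<Longrightarrow> fval (exF (t, u, v) f) I r \<longleftrightarrow>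
    (\<exists>p<bnd. \<exists>q<bnd. \<exists>z<bnd. fval f (I(t := p, u := q, v := z)) r)"
  by (simp add: exF_def)

lemma lits_bnd: "(p, q, z) \<in> lits \<Longrightarrow> p < bnd \<and> q < bnd \<and> z < bnd"
  using bnd_gt by (auto simp: lits_def)

definition Rr :: "(nat \<Rightarrow> nat) \<Rightarrow> (nat \<Rightarrow> real) \<Rightarrow> lit \<Rightarrow> lit \<Rightarrow> real" where
  "Rr I r l k = get I r 5 [fst l, fst (snd l), snd (snd l), fst k, fst (snd k), snd (snd k)]"

lemma Rr_upd [simp]: "2 < k \<Longrightarrow> Rr (I(k := v)) = Rr I"
  by (simp add: Rr_def fun_eq_iff)

lemma fval_reach [simp]: "fval (reachF l k) I r \<longleftrightarrow> Rr I r (rg I l) (rg I k) = 1"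
  by (cases l; cases k) (simp add: reachF_def reachE_def Rr_def)

lemma env2: "env I r \<Longrightarrow> I 2 = bnd"
  by (simp add: env_def)

lemma ex_lits2: "(\<exists>p<bnd. \<exists>q<bnd. \<exists>z<bnd. \<exists>p'<bnd. \<exists>q'<bnd. \<exists>z'<bnd. (p, q, z) \<in> lits \<and> (p', q', z') \<in> lits \<and> P (p, q, z) (p', q', z')) \<longleftrightarrow>
    (\<exists>l\<in>lits. \<exists>k\<in>lits. P l k)"
proof
  assume "\<exists>l\<in>lits. \<exists>k\<in>lits. P l k"
  then obtain p q z p' q' z' where "(p, q, z) \<in> lits" "(p', q', z') \<in> lits" "P (p, q, z) (p', q', z')" by auto
  with lits_bnd[OF this(1)] lits_bnd[OF this(2)]
  show "\<exists>p<bnd. \<exists>q<bnd. \<exists>z<bnd. \<exists>p'<bnd. \<exists>q'<bnd. \<exists>z'<bnd. (p, q, z) \<in> lits \<and> (p', q', z') \<in> lits \<and> P (p, q, z) (p', q', z')"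
    by metis
qed blast

lemma fval_bad [simp]:
  assumes e: "env I r" "caps I r" and l: "l = (t, u, v)" "t \<notin> {46..51}" "u \<notin> {46..51}" "v \<notin> {46..51}"
  shows "fval (badF l) I r \<longleftrightarrow> (\<exists>i\<in>lits. \<exists>j\<in>lits. Rr I r (rg I l) i = 1 \<and> Rr I r (rg I l) j = 1 \<and> clash (Lr I r) (Kr I r) i j)"
proof -
  have ne: "t \<noteq> 46" "t \<noteq> 47" "t \<noteq> 48" "t \<noteq> 49" "t \<noteq> 50" "t \<noteq> 51"
    "u \<noteq> 46" "u \<noteq> 47" "u \<noteq> 48" "u \<noteq> 49" "u \<noteq> 50" "u \<noteq> 51"
    "v \<noteq> 46" "v \<noteq> 47" "v \<noteq> 48" "v \<noteq> 49" "v \<noteq> 50" "v \<noteq> 51" using l by auto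
  have F: "fval (badF l) I r \<longleftrightarrow> (\<exists>p<bnd. \<exists>q<bnd. \<exists>z<bnd. \<exists>p'<bnd. \<exists>q'<bnd. \<exists>z'<bnd. (p, q, z) \<in> lits \<and> (p', q', z') \<in> lits \<and>
      (Rr I r (rg I l) (p, q, z) = 1 \<and> Rr I r (rg I l) (p', q', z') = 1 \<and> clash (Lr I r) (Kr I r) (p, q, z) (p', q', z')))"
    using e env2[OF e(1)] ne by (simp add: badF_def l(1))
  show ?thesis unfolding F
    by (rule ex_lits2[of "\<lambda>i j. Rr I r (rg I l) i = 1 \<and> Rr I r (rg I l) j = 1 \<and> clash (Lr I r) (Kr I r) i j"])
qed

lemma fval_consistent [simp]:
  assumes e: "env I r" "caps I r"
  shows "fval consistentF I r \<longleftrightarrow> consistent (Lr I r) (Kr I r) (\<lambda>l k. Rr I r l k = 1)"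
proof -
  let ?bad = "\<lambda>l. \<exists>i\<in>lits. \<exists>j\<in>lits. Rr I r l i = 1 \<and> Rr I r l j = 1 \<and> clash (Lr I r) (Kr I r) i j"
  have "fval consistentF I r \<longleftrightarrow> \<not> (\<exists>p<bnd. \<exists>q<bnd. \<exists>z<bnd. \<exists>p'<bnd. \<exists>q'<bnd. \<exists>z'<bnd. (p, q, z) \<in> lits \<and> (p', q', z') \<in> lits \<and>
      (clause (Lr I r) (p, q, z) (p', q', z') \<and> ?bad (p, q, z) \<and> ?bad (p', q', z')))"
    using e env2[OF e(1)] by (simp add: consistentF_def)
  also have "\<dots> \<longleftrightarrow> \<not> (\<exists>l\<in>lits. \<exists>k\<in>lits. clause (Lr I r) l k \<and> ?bad l \<and> ?bad k)"
    by (rule arg_cong[OF ex_lits2[of "\<lambda>l k. clause (Lr I r) l k \<and> ?bad l \<and> ?bad k"]])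
  finally show ?thesis unfolding consistent_def by blast
qed

lemma fval_closed [simp]:
  assumes e: "env I r"
  shows "fval closedF I r \<longleftrightarrow> closed_under (Lr I r) (Kr I r)"
proof -
  have f: "forced L t i j \<Longrightarrow> i < bnd \<and> j < bnd \<and> opp i j" for L t i j using bnd_gt by (auto simp: forced_def opp_def)
  have o: "opp i j" if "i < m" "m \<le> j" "j < m + n" for i j using that by (auto simp: opp_def)
  have F: "fval closedF I r \<longleftrightarrow> \<not> (\<exists>t<bnd. \<exists>i<bnd. \<exists>j<bnd. t < 3 \<and> i < m \<and> \<not> j < m \<and> j < m + n \<and>
     (Kr I r t i j < get I r 0 [i, j] \<or> (\<exists>i'<bnd. \<exists>j'<bnd. forced (Lr I r) t i' j' \<and>
       Kr I r t i j < Kr I r t i j' - get I r 0 [i', j'] + Kr I r t i' j)))"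
    using e env2[OF e] by (simp add: closedF_def sumE_def)
  show ?thesis
  proof
    assume h: "fval closedF I r"
    show "closed_under (Lr I r) (Kr I r)"
      unfolding closed_under_def
    proof (intro allI impI conjI)
      fix t i j assume tij: "t < (3::nat)" "i < m" "m \<le> j \<and> j < m + n"
      then have b: "t < bnd" "i < bnd" "j < bnd" "\<not> j < m" "j < m + n" using bnd_gt by auto
      show "a i j \<le> Kr I r t i j"
        using h tij b env_entry[OF e o] unfolding F by (metis not_less)
      fix i' j' assume "forced (Lr I r) t i' j'"
      then show "Kr I r t i j' - a i' j' + Kr I r t i' j \<le> Kr I r t i j"
        using h tij b f[of "Lr I r" t i' j'] env_entry[OF e, of i' j'] unfolding F by (metis not_less)
    qed
  next
    assume h: "closed_under (Lr I r) (Kr I r)"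
    have c1: "\<not> (Kr I r t i j < get I r 0 [i, j])"
      if "t < 3" "i < m" "m \<le> j" "j < m + n" for t i j
      using h that env_entry[OF e o[OF that(2-4)]] unfolding closed_under_def by force
    have c2: "\<not> Kr I r t i j < Kr I r t i j' - get I r 0 [i', j'] + Kr I r t i' j"
      if "t < 3" "i < m" "m \<le> j" "j < m + n" "forced (Lr I r) t i' j'" for t i j i' j'
    proof -
      have "i' < m" using that(5) by (simp add: forced_def)
      then have "Kr I r t i j' - a i' j' + Kr I r t i' j \<le> Kr I r t i j"
        using h that unfolding closed_under_def by blast
      then show ?thesis using env_entry[OF e, of i' j'] f[OF that(5)] by simp
    qed
    show "fval closedF I r"
      unfolding F
    proof (rule notI, elim exE conjE disjE)
      fix t i j :: nat assume tij: "t < 3" "i < m" "\<not> j < m" "j < m + n"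
      { assume "Kr I r t i j < get I r 0 [i, j]"
        then show False using c1[of t i j] tij by simp }
      { fix i' j' assume "forced (Lr I r) t i' j'" "Kr I r t i j < Kr I r t i j' - get I r 0 [i', j'] + Kr I r t i' j"
        then show False using c2[of t i j i' j'] tij by simp }
    qed
  qed
qed

lemma fval_two:
  assumes e: "env I r"
  shows "fval twoF I r \<longleftrightarrow> (\<exists>e e'. m \<le> e \<and> e < m + n \<and> m \<le> e' \<and> e' < m + n \<and>
    (\<forall>i<m. \<forall>j. m \<le> j \<and> j < m + n \<longrightarrow>
       (\<forall>k<m. a k j - a k e \<le> a i j - a i e) \<or> (\<forall>k<m. a k j - a k e' \<le> a i j - a i e')))"
proof -
  have o: "opp i j" if "i < m" "\<not> j < m" "j < m + n" for i j using that by (auto simp: opp_def)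
  have "fval twoF I r \<longleftrightarrow> (\<exists>e<bnd. \<exists>e'<bnd. (\<not> e < m \<and> e < m + n) \<and> (\<not> e' < m \<and> e' < m + n) \<and>
    \<not> (\<exists>i<bnd. \<exists>j<bnd. i < m \<and> (\<not> j < m \<and> j < m + n) \<and>
      (\<exists>k<bnd. k < m \<and> get I r 0 [i, j] - get I r 0 [i, e] < get I r 0 [k, j] - get I r 0 [k, e]) \<and>
      (\<exists>k<bnd. k < m \<and> get I r 0 [i, j] - get I r 0 [i, e'] < get I r 0 [k, j] - get I r 0 [k, e'])))"
    using e env2[OF e] by (simp add: twoF_def)
  also have "\<dots> \<longleftrightarrow> (\<exists>e<bnd. \<exists>e'<bnd. (\<not> e < m \<and> e < m + n) \<and> (\<not> e' < m \<and> e' < m + n) \<and>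
    \<not> (\<exists>i<bnd. \<exists>j<bnd. i < m \<and> (\<not> j < m \<and> j < m + n) \<and>
      (\<exists>k<bnd. k < m \<and> a i j - a i e < a k j - a k e) \<and>
      (\<exists>k<bnd. k < m \<and> a i j - a i e' < a k j - a k e')))"
    by (intro ex_cong1 conj_cong refl arg_cong[of _ _ Not]) (simp_all add: env_entry[OF e o])
  also have "\<dots> \<longleftrightarrow> (\<exists>e e'. m \<le> e \<and> e < m + n \<and> m \<le> e' \<and> e' < m + n \<and>
    (\<forall>i<m. \<forall>j. m \<le> j \<and> j < m + n \<longrightarrow>
       (\<forall>k<m. a k j - a k e \<le> a i j - a i e) \<or> (\<forall>k<m. a k j - a k e' \<le> a i j - a i e')))"
  proof -
    have b: "x < m + n \<Longrightarrow> x < bnd" "x < m \<Longrightarrow> x < bnd" for x using bnd_gt by auto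
    have e1: "(\<exists>k<bnd. k < m \<and> P k) \<longleftrightarrow> (\<exists>k<m. P k)" for P using b by blast
    have e2: "(\<exists>i<bnd. \<exists>j<bnd. i < m \<and> (\<not> j < m \<and> j < m + n) \<and> Q i j) \<longleftrightarrow> (\<exists>i<m. \<exists>j. m \<le> j \<and> j < m + n \<and> Q i j)" for Q
      using b unfolding not_less by blast
    have e3: "(\<exists>i<bnd. \<exists>j<bnd. (\<not> i < m \<and> i < m + n) \<and> (\<not> j < m \<and> j < m + n) \<and> Q i j) \<longleftrightarrow>
       (\<exists>i j. m \<le> i \<and> i < m + n \<and> m \<le> j \<and> j < m + n \<and> Q i j)" for Q
      using b unfolding not_less by blast
    show ?thesis unfolding e1 e2 e3 unfolding not_less[symmetric] by (intro ex_cong1) blast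
  qed
  finally show ?thesis .
qed

section \<open>Effect of each subprogram\<close>

definition work_clear :: "(nat \<Rightarrow> nat) \<Rightarrow> bool" where
  "work_clear I \<longleftrightarrow> (\<forall>k\<ge>30. I k = 0)"

lemma clean_work: "work_clear I \<Longrightarrow> \<forall>k\<in>bound_regs f \<union> set ks. 30 \<le> k \<Longrightarrow> clean I ks f"
  by (auto simp: work_clear_def clean_def)

lemma env_frame: "get I r' 0 = get I r 0 \<Longrightarrow> env I r' = env I r"
  by (simp add: env_def)

lemma tab_postD:
  assumes "tab_post ks d f e1 e2 I r r'"
  shows "length js = length ks \<Longrightarrow> set js \<subseteq> {..<I 2} \<Longrightarrow> get I r' d js = cell f e1 e2 (upds I ks js) r"
    and "d' < 16 \<Longrightarrow> d' \<noteq> d \<Longrightarrow> get I r' d' = get I r d'"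
  using assms by (auto simp: tab_post_def)

lemma sem_lowP:
  assumes e: "env I r" and w: "work_clear I" and t: "t < 3" and G: "\<And>k. k < 30 \<Longrightarrow> 10 \<le> k \<Longrightarrow> I k < bnd"
  shows "\<exists>r'. sem (lowP t) (St I r) = St I r' \<and> (\<forall>d. d < 16 \<longrightarrow> d \<notin> {1, 4, 7, 8} \<longrightarrow> get I r' d = get I r d) \<and>
    (\<forall>u<bnd. get I r' 1 [t, u] = lower I (\<lambda>t. rval (offE t) (St I r)) t u) \<and>
    (\<forall>s<bnd. \<forall>u<bnd. s \<noteq> t \<longrightarrow> get I r' 1 [s, u] = get I r 1 [s, u])"
proof -
  have I2: "I 2 = bnd" using e by (rule env2)
  have "\<exists>r1. sem (tab [] 4 [] trueF (offE t) RZero) (St I r) = St I r1 \<and> tab_post [] 4 trueF (offE t) RZero I r r1"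
    by (rule tab_full) (use t w in \<open>auto simp: tab_ok_def clean_work tab_indep_def cell_def trueF_def offE_def\<close>)
  then obtain r1 where r1: "sem (tab [] 4 [] trueF (offE t) RZero) (St I r) = St I r1"
    "tab_post [] 4 trueF (offE t) RZero I r r1" by blast
  note f1 = tab_postD(2)[OF r1(2)]
  have th: "get I r1 4 [] = rval (offE t) (St I r)"
    using tab_postD(1)[OF r1(2), of "[]"] by (simp add: cell_def trueF_def)
  let ?x7 = "rd 0 [V 30, V (19 + t)]" and ?y7 = "RSub (rd 0 [V 30, V (10 + t)]) (rd 0 [V (10 + t), V (19 + t)])"
  have "\<exists>r2. sem (tab [30] 7 [V 30] (rowF 30) ?x7 ?y7) (St I r1) = St I r2 \<and> tab_post [30] 7 (rowF 30) ?x7 ?y7 I r1 r2"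
    by (rule tab_full) (use t w in \<open>auto simp: tab_ok_def clean_work tab_indep_def cell_def rowF_def length_Suc_conv\<close>)
  then obtain r2 where r2: "sem (tab [30] 7 [V 30] (rowF 30) ?x7 ?y7) (St I r1) = St I r2"
    "tab_post [30] 7 (rowF 30) ?x7 ?y7 I r1 r2" by blast
  note f2 = tab_postD(2)[OF r2(2)]
  let ?x8 = "RSub (rd 0 [V 30, V (16 + t)]) (rd 4 [])" and ?y8 = "RAdd (RSub (rd 0 [V 30, V (13 + t)]) (rd 0 [V (13 + t), V (16 + t)])) (rd 4 [])"
  have "\<exists>r3. sem (tab [30] 8 [V 30] (rowF 30) ?x8 ?y8) (St I r2) = St I r3 \<and> tab_post [30] 8 (rowF 30) ?x8 ?y8 I r2 r3"
    by (rule tab_full) (use t w in \<open>auto simp: tab_ok_def clean_work tab_indep_def cell_def rowF_def length_Suc_conv\<close>)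
  then obtain r3 where r3: "sem (tab [30] 8 [V 30] (rowF 30) ?x8 ?y8) (St I r2) = St I r3"
    "tab_post [30] 8 (rowF 30) ?x8 ?y8 I r2 r3" by blast
  note f3 = tab_postD(2)[OF r3(2)]
  let ?f = "FA (RLess (rd 7 [V 30]) (rd 8 [V 30]))"
  have ix: "idx_of [Num t, V 30] [30] I js = [t, hd js]" if "length js = length [30::nat]" for js
    using that by (auto simp: idx_of_def length_Suc_conv)
  have "\<exists>r4. sem (tab [30] 1 [Num t, V 30] ?f (rd 8 [V 30]) (rd 7 [V 30])) (St I r3) = St I r4 \<and>
    (\<forall>js. length js = length [30::nat] \<longrightarrow> set js \<subseteq> {..<I 2} \<longrightarrow>
       get I r4 1 (idx_of [Num t, V 30] [30] I js) = cell ?f (rd 8 [V 30]) (rd 7 [V 30]) (upds I [30] js) r3) \<and>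
    (\<forall>d'. d' < 16 \<longrightarrow> d' \<noteq> 1 \<longrightarrow> get I r4 d' = get I r3 d') \<and> (\<forall>l<I 0 * I 1. r4 l = r3 l) \<and>
    (\<forall>is. length is = length [Num t, V 30] \<longrightarrow> set is \<subseteq> {..<I 2} \<longrightarrow>
       (\<forall>js. length js = length [30::nat] \<longrightarrow> set js \<subseteq> {..<I 2} \<longrightarrow> is \<noteq> idx_of [Num t, V 30] [30] I js) \<longrightarrow>
       get I r4 1 is = get I r3 1 is)" (is "\<exists>r4. ?A r4 \<and> ?B r4 \<and> ?C r4 \<and> ?D r4 \<and> ?E r4")
  proof (rule tab_arr)
    show "set (idx_of [Num t, V 30] [30] I js) \<subseteq> {..<I 2}" if "length js = length [30::nat]" "set js \<subseteq> {..<I 2}" for js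
      using that t bnd_gt I2 by (auto simp: idx_of_def length_Suc_conv)
    show "js = js'" if "length js = length [30::nat]" "length js' = length [30::nat]"
      "idx_of [Num t, V 30] [30] I js = idx_of [Num t, V 30] [30] I js'" for js js'
      using that by (auto simp: idx_of_def length_Suc_conv)
  qed (use w in \<open>auto simp: tab_ok_def clean_work cell_def length_Suc_conv\<close>)
  then obtain r4 where r4: "?A r4" "?B r4" "?C r4" "?E r4" by (elim exE conjE) (rule that)
  have "sem (lowP t) (St I r) = St I r4"
    by (simp only: lowP_def sem.simps r1(1) r2(1) r3(1) r4(1))
  moreover have "get I r4 d = get I r d" if "d < 16" "d \<notin> {1, 4, 7, 8}" for d
    using r4(3) f1 f2 f3 that by simp
  moreover have "get I r4 1 [t, u] = lower I (\<lambda>t. rval (offE t) (St I r)) t u" if u: "u < bnd" for u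
  proof -
    have c: "get I r4 1 [t, u] = cell ?f (rd 8 [V 30]) (rd 7 [V 30]) (upds I [30] [u]) r3"
      using r4(2) u I2 ix[of "[u]"] by (metis (no_types, lifting) length_Cons list.sel(1) list.set(1) list.set(2)
          list.size(3) empty_subsetI insert_subset lessThan_iff)
    have 7: "get I r3 7 [u] = cell (rowF 30) ?x7 ?y7 (upds I [30] [u]) r1"
      using f3[of 7] tab_postD(1)[OF r2(2), of "[u]"] u I2 by simp
    have 8: "get I r3 8 [u] = cell (rowF 30) ?x8 ?y8 (upds I [30] [u]) r2"
      using tab_postD(1)[OF r3(2), of "[u]"] u I2 by simp
    have a: "get I r1 0 [p, q] = a p q" "get I r2 0 [p, q] = a p q" if "p < bnd" "q < bnd" for p q
      using e that f1[of 0] f2[of 0] by (auto simp: env_def)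
    have I0: "I 0 = m" using e by (simp add: env_def)
    have 4: "get I r2 4 [] = rval (offE t) (St I r)" using f2[of 4] th by simp
    have G': "I (10 + t) < bnd" "I (13 + t) < bnd" "I (16 + t) < bnd" "I (19 + t) < bnd" using G t by auto
    show ?thesis
      unfolding c using u t I0 G'
      by (simp add: cell_def 7 8 rowF_def a 4 lower_def max_def)
  qed
  moreover have "get I r4 1 [s, u] = get I r 1 [s, u]" if "s < bnd" "u < bnd" "s \<noteq> t" for s u
  proof -
    have "get I r4 1 [s, u] = get I r3 1 [s, u]"
      using r4(4)[rule_format, of "[s, u]"] that I2 ix by auto
    then show ?thesis using f1[of 1] f2[of 1] f3[of 1] by simp
  qed
  ultimately show ?thesis by blast
qed

text \<open>Preservation of registers is stated without \<open>env\<close>, because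
  \<open>sem_nest_ex\<close> asks for it on every real memory.\<close>

lemma sem_linkP:
  assumes w: "\<forall>k\<in>{30, 31, 32, 40} \<union> {100..}. I k = 0"
  shows "\<exists>r'. sem linkP (St I r) = St I r' \<and> (\<forall>d. d < 16 \<longrightarrow> d \<notin> {2, 3} \<longrightarrow> get I r' d = get I r d) \<and>
    (env I r \<longrightarrow> I 36 < bnd \<longrightarrow> I 37 < bnd \<longrightarrow> (\<forall>t<bnd. \<forall>u<bnd. \<forall>v<bnd.
       get I r' 2 [t, u, v] = link_step (Lr I r) t (I 36, I 37) (Kr I r t) u v))"
proof -
  let ?f = "FAnd (forcedF 30 36 37) (FA (RLess (rd 2 [V 30, V 31, V 32]) (sumE 30 31 32 36 37)))"
  let ?e1 = "sumE 30 31 32 36 37" and ?e2 = "rd 2 [V 30, V 31, V 32]"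
  have "\<exists>r1. sem (tab [30, 31, 32] 3 [V 30, V 31, V 32] ?f ?e1 ?e2) (St I r) = St I r1 \<and> tab_post [30, 31, 32] 3 ?f ?e1 ?e2 I r r1"
    by (rule tab_full) (use w in \<open>auto simp: tab_ok_def clean_def tab_indep_def cell_def length_Suc_conv fm_defs\<close>)
  then obtain r1 where r1: "sem (tab [30, 31, 32] 3 [V 30, V 31, V 32] ?f ?e1 ?e2) (St I r) = St I r1"
    "tab_post [30, 31, 32] 3 ?f ?e1 ?e2 I r r1" by blast
  note f1 = tab_postD(2)[OF r1(2)]
  have "\<exists>r2. sem (copyP 2 [30, 31, 32]) (St I r1) = St I r2 \<and> tab_post [30, 31, 32] 2 trueF (rd 3 (map V [30, 31, 32])) RZero I r1 r2"
    unfolding copyP_def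
    by (rule tab_full) (use w in \<open>auto simp: tab_ok_def clean_def tab_indep_def cell_def length_Suc_conv trueF_def\<close>)
  then obtain r2 where r2: "sem (copyP 2 [30, 31, 32]) (St I r1) = St I r2"
    "tab_post [30, 31, 32] 2 trueF (rd 3 (map V [30, 31, 32])) RZero I r1 r2" by blast
  note f2 = tab_postD(2)[OF r2(2)]
  have "get I r2 2 [t, u, v] = link_step (Lr I r) t (I 36, I 37) (Kr I r t) u v"
    if e: "env I r" "I 36 < bnd" "I 37 < bnd" "t < bnd" "u < bnd" "v < bnd" for t u v
  proof -
    let ?J = "I(30 := t, 31 := u, 32 := v)"
    have I2: "I 2 = bnd" using e by (simp add: env_def)
    have "get I r2 2 [t, u, v] = get I r1 3 [t, u, v]"
      using tab_postD(1)[OF r2(2), of "[t, u, v]"] e I2 by (simp add: cell_def trueF_def)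
    also have "\<dots> = cell ?f ?e1 ?e2 ?J r"
      using tab_postD(1)[OF r1(2), of "[t, u, v]"] e I2 by simp
    also have "\<dots> = link_step (Lr I r) t (I 36, I 37) (Kr I r t) u v"
    proof -
      have F: "fval (forcedF 30 36 37) ?J r \<longleftrightarrow> forced (Lr I r) t (I 36) (I 37)"
        using e by (subst fval_forced) auto
      have a: "get I r 0 [I 36, I 37] = a (I 36) (I 37)" using e by (simp add: env_def)
      show ?thesis by (simp add: cell_def F sumE_def a link_step_def relax_step_def max_def)
    qed
    finally show ?thesis .
  qed
  moreover have "sem linkP (St I r) = St I r2" by (simp add: linkP_def r1(1) r2(1))
  ultimately show ?thesis using f1 f2 by (intro exI[of _ r2]) auto
qed

text \<open>The arrays represent \<open>L\<close> and \<open>K\<close> only below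
  \<open>bnd\<close>. This and the next lemmas show that nothing beyond is consulted.\<close>

lemma forced_cong_bnd: "(\<And>s u. s < 3 \<Longrightarrow> u < bnd \<Longrightarrow> L s u = L' s u) \<Longrightarrow> forced L = forced L'"
  using bnd_gt(2) by (intro ext) (auto simp: forced_def excluded_def)

lemma link_closure_cong_bnd: "(\<And>s u. s < 3 \<Longrightarrow> u < bnd \<Longrightarrow> L s u = L' s u) \<Longrightarrow> link_closure L = link_closure L'"
  using forced_cong_bnd[of L L'] by (simp add: link_closure_def[abs_def] link_step_def[abs_def])

lemma cap_cong: "(\<And>s u. s < 3 \<Longrightarrow> u < bnd \<Longrightarrow> L s u = L' s u) \<Longrightarrow> l \<in> lits \<Longrightarrow> cap L l = cap L' l"
  using bnd_gt(2) by (auto simp: cap_def lits_def)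

lemma clause_cong:
  assumes "\<And>s u. s < 3 \<Longrightarrow> u < bnd \<Longrightarrow> L s u = L' s u"
  shows "clause L = clause L'"
proof (intro ext)
  fix l k :: lit
  obtain s u v t w x :: nat where lk: "l = (s, u, v)" "k = (t, w, x)" by (cases l; cases k)
  have "3 - s - t < 3" if "s < 3" "t < 3" "s \<noteq> t" using that by linarith
  then show "clause L l k = clause L' l k"
    using assms bnd_gt(2) unfolding lk clause_def by (auto simp: excluded_def)
qed

lemma clash_cong:
  assumes "\<And>s u. s < 3 \<Longrightarrow> u < bnd \<Longrightarrow> L s u = L' s u" "\<And>t u v. t < 3 \<Longrightarrow> u < bnd \<Longrightarrow> v < bnd \<Longrightarrow> K t u v = K' t u v"
  shows "clash L K = clash L' K'"
proof (intro ext)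
  fix l k :: lit
  obtain s u v t w x :: nat where lk: "l = (s, u, v)" "k = (t, w, x)" by (cases l; cases k)
  show "clash L K l k = clash L' K' l k"
  proof (cases "l \<in> lits \<and> k \<in> lits")
    case True
    then have "s < 3" "u < bnd" "v < bnd" "t < 3" "w < bnd" "x < bnd"
      using lk lits_bnd by (auto simp: lits_def)
    moreover have c: "cap L l = cap L' l" "cap L k = cap L' k"
      using True by (auto intro!: cap_cong assms(1))
    ultimately show ?thesis
      using True assms unfolding lk clash_def by auto
  qed (auto simp: clash_def)
qed

text \<open>\<open>K\<close> is a separate argument since the computed array equals the closure only
  below \<open>bnd\<close>.\<close>

definition accepts_with :: "(nat \<Rightarrow> nat \<Rightarrow> real) \<Rightarrow> (nat \<Rightarrow> nat \<Rightarrow> nat \<Rightarrow> real) \<Rightarrow> bool" where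
  "accepts_with L K \<longleftrightarrow> closed_under L K \<and> consistent L K (\<lambda>l k. reach_closure L K l k = 1)"

lemma accepts_with_cong:
  assumes L: "\<And>s u. s < 3 \<Longrightarrow> u < bnd \<Longrightarrow> L s u = L' s u" and K: "\<And>t u v. t < 3 \<Longrightarrow> u < bnd \<Longrightarrow> v < bnd \<Longrightarrow> K t u v = K' t u v"
  shows "accepts_with L K = accepts_with L' K'"
proof -
  have cl: "clause L = clause L'" by (rule clause_cong) (rule L)
  have ca: "clash L K = clash L' K'" by (rule clash_cong) (fact L, fact K)
  have fo: "forced L = forced L'" by (rule forced_cong_bnd) (rule L)
  note c = cl ca
  have "closed_under L K = closed_under L' K'"
    using K bnd_gt(2) unfolding closed_under_def fo
    by (intro all_cong1 imp_cong refl conj_cong) (auto simp: forced_def)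
  moreover have "reach_closure L K = reach_closure L' K'" by (simp add: reach_closure_def reach_init_def[abs_def] c)
  ultimately show ?thesis by (simp add: accepts_with_def consistent_def c)
qed

text \<open>The program relaxes all colours in one pass, while \<open>link_closure\<close> treats
  each colour by itself.\<close>

lemma fold_pointwise: "fold (\<lambda>x K t. g x t (K t)) xs K t = fold (\<lambda>x. g x t) xs (K t)"
  by (induction xs arbitrary: K) auto

lemma sem_closureP:
  assumes e: "env I r" and w: "work_clear I"
  shows "\<exists>r'. sem closureP (St I r) = St I r' \<and> (\<forall>d. d < 16 \<longrightarrow> d \<notin> {2, 3} \<longrightarrow> get I r' d = get I r d) \<and>
    (\<forall>t<bnd. \<forall>u<bnd. \<forall>v<bnd. get I r' 2 [t, u, v] = link_closure (Lr I r) t u v)"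
proof -
  have I2: "I 2 = bnd" using e by (rule env2)
  have "\<exists>r1. sem (tab [30, 31, 32] 2 [V 30, V 31, V 32] trueF (rd 0 [V 31, V 32]) RZero) (St I r) = St I r1 \<and>
      tab_post [30, 31, 32] 2 trueF (rd 0 [V 31, V 32]) RZero I r r1"
    by (rule tab_full) (use w in \<open>auto simp: tab_ok_def clean_work tab_indep_def cell_def length_Suc_conv trueF_def\<close>)
  then obtain r1 where r1: "sem (tab [30, 31, 32] 2 [V 30, V 31, V 32] trueF (rd 0 [V 31, V 32]) RZero) (St I r) = St I r1"
    "tab_post [30, 31, 32] 2 trueF (rd 0 [V 31, V 32]) RZero I r r1" by blast
  define act where "act js r = rmem (sem linkP (St (upds I [36, 37] js) r))" for js r
  have zero: "\<forall>k\<in>{30, 31, 32, 40} \<union> {100..}. (I(36 := i, 37 := j)) k = 0" for i j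
    using w by (auto simp: work_clear_def)
  have nest: "sem (nest [36, 37] linkP) (St I r1) = St I (fold act (tuples (I 2) (length [36::nat, 37])) r1)"
    unfolding act_def
  proof (rule sem_nest_ex)
    fix js :: "nat list" and r assume "length js = length [36::nat, 37]"
    then obtain i j where "js = [i, j]" by (auto simp: length_Suc_conv)
    moreover obtain r' where "sem linkP (St (I(36 := i, 37 := j)) r) = St (I(36 := i, 37 := j)) r'"
      using sem_linkP[OF zero[of i j], of r] by (elim exE conjE) (rule that)
    ultimately show "\<exists>r'. sem linkP (St (upds I [36, 37] js) r) = St (upds I [36, 37] js) r'"
      by (intro exI[of _ r']) (simp only: upds.simps)
  qed (use w in \<open>auto simp: work_clear_def\<close>)
  have len: "length [36::nat, 37] = 2" by simp
  \<comment> \<open>Simulation relation between the real memory and the closure under construction,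
    carried through both folds.\<close>
  define Q where "Q r' K \<longleftrightarrow> (\<forall>d. d < 16 \<longrightarrow> d \<notin> {2, 3} \<longrightarrow> get I r' d = get I r d) \<and>
      (\<forall>t<bnd. \<forall>u<bnd. \<forall>v<bnd. get I r' 2 [t, u, v] = K t u v)" for r' and K :: "nat \<Rightarrow> nat \<Rightarrow> nat \<Rightarrow> real"
  define g where "g js K t = link_step (Lr I r) t (js ! 0, js ! 1) (K t)" for js and K :: "nat \<Rightarrow> nat \<Rightarrow> nat \<Rightarrow> real" and t
  let ?T = "tuples bnd 2"
  have Q: "Q (fold act ?T r1) (fold g ?T (\<lambda>t. a))"
  proof (rule fold_related[where Q = Q and f = act and g = g])
    fix js r' K assume js: "js \<in> set ?T" and q: "Q r' K"
    obtain i j where ij: "js = [i, j]" "i < bnd" "j < bnd"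
      using js by (auto simp: set_tuples numeral_2_eq_2 length_Suc_conv)
    let ?J = "I(36 := i, 37 := j)"
    obtain r2 where r2: "sem linkP (St ?J r') = St ?J r2" "\<forall>d. d < 16 \<longrightarrow> d \<notin> {2, 3} \<longrightarrow> get ?J r2 d = get ?J r' d"
      "env ?J r' \<longrightarrow> ?J 36 < bnd \<longrightarrow> ?J 37 < bnd \<longrightarrow> (\<forall>t<bnd. \<forall>u<bnd. \<forall>v<bnd.
       get ?J r2 2 [t, u, v] = link_step (Lr ?J r') t (?J 36, ?J 37) (Kr ?J r' t) u v)"
      using sem_linkP[OF zero[of i j], of r'] by blast
    have a: "act js r' = r2" using r2(1) by (simp add: act_def ij)
    have "env ?J r'" using e q env_frame[of I r' r] by (simp add: Q_def)
    then have K: "get I r2 2 [t, u, v] = link_step (Lr I r') t (i, j) (Kr I r' t) u v" if "t < bnd" "u < bnd" "v < bnd" for t u v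
      using r2(3) ij that by simp
    have "get I r' 1 = get I r 1" using q by (simp add: Q_def)
    then have "get I r2 2 [t, u, v] = g js K t u v" if "t < bnd" "u < bnd" "v < bnd" for t u v
      using K[OF that] q that ij by (auto simp: g_def link_step_def relax_step_def Q_def)
    then show "Q (act js r') (g js K)" using r2(2) q unfolding a by (auto simp: Q_def)
  next
    have "get I r1 2 [t, u, v] = a u v" if "t < bnd" "u < bnd" "v < bnd" for t u v
      using tab_postD(1)[OF r1(2), of "[t, u, v]"] that I2 e by (simp add: cell_def trueF_def env_def)
    then show "Q r1 (\<lambda>t. a)" using tab_postD(2)[OF r1(2)] by (auto simp: Q_def)
  qed
  have "fold g ?T (\<lambda>t. a) t = link_closure (Lr I r) t" for t
  proof -
    have "fold g ?T (\<lambda>t. a) t = fold (\<lambda>js. link_step (Lr I r) t (js ! 0, js ! 1)) ?T a"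
      unfolding g_def[abs_def] by (rule fold_pointwise)
    also have "\<dots> = fold (link_step (Lr I r) t) (map (\<lambda>js. (js ! 0, js ! 1)) ?T) a"
      by (simp add: fold_map o_def)
    finally show ?thesis by (simp only: tuples_product link_closure_def)
  qed
  then have KE: "fold g ?T (\<lambda>t. a) = link_closure (Lr I r)" by (rule ext)
  have "Q (fold act ?T r1) (link_closure (Lr I r))" using Q unfolding KE .
  moreover have "sem closureP (St I r) = St I (fold act ?T r1)"
    using nest[unfolded I2 len] by (simp only: closureP_def sem.simps(4) r1(1))
  ultimately show ?thesis unfolding Q_def by blast
qed

lemma rval_offE:
  assumes "env I r" "t < 3" "\<And>k. k < 30 \<Longrightarrow> 10 \<le> k \<Longrightarrow> I k < bnd"
  shows "rval (offE t) (St I r) = offset I (Kr I r 0) t"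
proof -
  have "get I r 0 [I p, I q] = a (I p) (I q)" if "10 \<le> p" "p < 30" "10 \<le> q" "q < 30" for p q
    using assms that by (simp add: env_def)
  then show ?thesis using assms(2) by (auto simp: offE_def offset_def)
qed

text \<open>\<open>lowP\<close> leaves array 2 alone, so all three colours compute their offsets
  from the closure present at the start of the stage; the new closure comes last.\<close>

lemma sem_stageP:
  assumes e: "env I r" and w: "work_clear I" and G: "\<And>k. k < 30 \<Longrightarrow> 10 \<le> k \<Longrightarrow> I k < bnd"
  shows "\<exists>r'. sem stageP (St I r) = St I r' \<and> get I r' 0 = get I r 0 \<and> get I r' 15 = get I r 15 \<and>
    (\<forall>t<3. \<forall>u<bnd. get I r' 1 [t, u] = lower I (offset I (Kr I r 0)) t u) \<and>
    (\<forall>t<bnd. \<forall>u<bnd. \<forall>v<bnd. get I r' 2 [t, u, v] = link_closure (Lr I r') t u v)"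
proof -
  have lower: "\<exists>r2. sem (lowP t) (St I r1) = St I r2 \<and> (\<forall>d. d < 16 \<longrightarrow> d \<notin> {1, 4, 7, 8} \<longrightarrow> get I r2 d = get I r d) \<and>
    (\<forall>u<bnd. get I r2 1 [t, u] = lower I (offset I (Kr I r 0)) t u) \<and>
    (\<forall>s<bnd. \<forall>u<bnd. s \<noteq> t \<longrightarrow> get I r2 1 [s, u] = get I r1 1 [s, u])"
    if t: "t < 3" and f: "\<forall>d. d < 16 \<longrightarrow> d \<notin> {1, 4, 7, 8} \<longrightarrow> get I r1 d = get I r d" for t r1
  proof -
    have e1: "env I r1" using e f env_frame[of I r1 r] by simp
    have o: "rval (offE t) (St I r1) = offset I (Kr I r 0) t"
      using rval_offE[OF e1 t G] f by simp
    have "lower I (\<lambda>t. rval (offE t) (St I r1)) t u = lower I (offset I (Kr I r 0)) t u" for u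
      using o by (simp add: lower_def)
    then show ?thesis using sem_lowP[OF e1 w t G] f by auto
  qed
  obtain r0 where r0: "sem (lowP 0) (St I r) = St I r0" "\<forall>d. d < 16 \<longrightarrow> d \<notin> {1, 4, 7, 8} \<longrightarrow> get I r0 d = get I r d"
    "\<forall>u<bnd. get I r0 1 [0, u] = lower I (offset I (Kr I r 0)) 0 u"
    using lower[of 0 r] by auto
  obtain r1 where r1: "sem (lowP 1) (St I r0) = St I r1" "\<forall>d. d < 16 \<longrightarrow> d \<notin> {1, 4, 7, 8} \<longrightarrow> get I r1 d = get I r d"
    "\<forall>u<bnd. get I r1 1 [1, u] = lower I (offset I (Kr I r 0)) 1 u"
    "\<forall>s<bnd. \<forall>u<bnd. s \<noteq> 1 \<longrightarrow> get I r1 1 [s, u] = get I r0 1 [s, u]"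
    using lower[OF _ r0(2), of 1] by auto
  obtain r2 where r2: "sem (lowP 2) (St I r1) = St I r2" "\<forall>d. d < 16 \<longrightarrow> d \<notin> {1, 4, 7, 8} \<longrightarrow> get I r2 d = get I r d"
    "\<forall>u<bnd. get I r2 1 [2, u] = lower I (offset I (Kr I r 0)) 2 u"
    "\<forall>s<bnd. \<forall>u<bnd. s \<noteq> 2 \<longrightarrow> get I r2 1 [s, u] = get I r1 1 [s, u]"
    using lower[OF _ r1(2), of 2] by auto
  have e2: "env I r2" using e r2(2) env_frame[of I r2 r] by simp
  obtain r3 where r3: "sem closureP (St I r2) = St I r3" "\<forall>d. d < 16 \<longrightarrow> d \<notin> {2, 3} \<longrightarrow> get I r3 d = get I r2 d"
    "\<forall>t<bnd. \<forall>u<bnd. \<forall>v<bnd. get I r3 2 [t, u, v] = link_closure (Lr I r2) t u v"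
    using sem_closureP[OF e2 w] by blast
  have L: "get I r2 1 [t, u] = lower I (offset I (Kr I r 0)) t u" if "t < 3" "u < bnd" for t u
  proof -
    have "t = 0 \<or> t = 1 \<or> t = 2" using that by linarith
    moreover have "0 < bnd" "1 < bnd" "2 < bnd" using bnd_gt by auto
    ultimately show ?thesis using r0(3) r1(3,4) r2(3,4) that by auto
  qed
  have "get I r3 1 = get I r2 1" using r3(2) by simp
  moreover have "sem stageP (St I r) = St I r3" by (simp only: stageP_def sem.simps r0(1) r1(1) r2(1) r3(1))
  ultimately show ?thesis using r3 r2(2) L by (intro exI[of _ r3]) simp
qed

lemma sem_capP:
  assumes e: "env I r" and w: "work_clear I"
  shows "\<exists>r'. sem capP (St I r) = St I r' \<and> (\<forall>d. d < 16 \<longrightarrow> d \<noteq> 6 \<longrightarrow> get I r' d = get I r d) \<and> caps I r'"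
proof -
  let ?e1 = "rd 1 [V 30, V 31]" and ?e2 = "RSub (rd 0 [V 31, V 32]) (rd 1 [V 30, V 32])"
  have "\<exists>r'. sem (tab [30, 31, 32] 6 [V 30, V 31, V 32] (eqF 31 32) ?e1 ?e2) (St I r) = St I r' \<and>
      tab_post [30, 31, 32] 6 (eqF 31 32) ?e1 ?e2 I r r'"
    by (rule tab_full) (use w in \<open>auto simp: tab_ok_def clean_work tab_indep_def cell_def length_Suc_conv eqF_def\<close>)
  then obtain r' where r': "sem capP (St I r) = St I r'" "tab_post [30, 31, 32] 6 (eqF 31 32) ?e1 ?e2 I r r'"
    unfolding capP_def by blast
  have "get I r' 6 [t, u, v] = cap (Lr I r') (t, u, v)" if l: "(t, u, v) \<in> lits" for t u v
  proof -
    have b: "t < bnd" "u < bnd" "v < bnd" using lits_bnd[OF l] by auto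
    have "get I r' 6 [t, u, v] = cell (eqF 31 32) ?e1 ?e2 (I(30 := t, 31 := u, 32 := v)) r"
      using tab_postD(1)[OF r'(2), of "[t, u, v]"] b env2[OF e] by simp
    moreover have "get I r' 1 = get I r 1" using tab_postD(2)[OF r'(2), of 1] by simp
    ultimately show ?thesis using e b by (simp add: cell_def eqF_def cap_def env_def)
  qed
  then show ?thesis using r' tab_postD(2)[OF r'(2)] by (intro exI[of _ r']) (auto simp: caps_def)
qed

lemma sem_reach_linkP:
  assumes w: "\<forall>k\<in>set R6 \<union> {100..}. I k = 0"
  shows "\<exists>r'. sem reach_linkP (St I r) = St I r' \<and> (\<forall>d. d < 16 \<longrightarrow> d \<notin> {3, 5} \<longrightarrow> get I r' d = get I r d) \<and>
    (\<forall>p<I 2. \<forall>q<I 2. \<forall>z<I 2. \<forall>p'<I 2. \<forall>q'<I 2. \<forall>z'<I 2. Rr I r' (p, q, z) (p', q', z') =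
       relax_step (I 36, I 37, I 38) (I 36, I 37, I 38) 1 (Rr I r) (p, q, z) (p', q', z'))"
proof -
  let ?e1 = "RAdd (RSub (reachE (30, 31, 32) (36, 37, 38)) ROne) (reachE (36, 37, 38) (33, 34, 35))"
  let ?e2 = "reachE (30, 31, 32) (33, 34, 35)"
  let ?f = "FA (RLess ?e2 ?e1)"
  have "\<exists>r1. sem (tab R6 3 (map V R6) ?f ?e1 ?e2) (St I r) = St I r1 \<and> tab_post R6 3 ?f ?e1 ?e2 I r r1"
    by (rule tab_full) (use w in \<open>auto simp: tab_ok_def clean_def tab_indep_def cell_def length_Suc_conv reachE_def\<close>)
  then obtain r1 where r1: "sem (tab R6 3 (map V R6) ?f ?e1 ?e2) (St I r) = St I r1" "tab_post R6 3 ?f ?e1 ?e2 I r r1" by blast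
  have "\<exists>r2. sem (copyP 5 R6) (St I r1) = St I r2 \<and> tab_post R6 5 trueF (rd 3 (map V R6)) RZero I r1 r2"
    unfolding copyP_def
    by (rule tab_full) (use w in \<open>auto simp: tab_ok_def clean_def tab_indep_def cell_def length_Suc_conv trueF_def\<close>)
  then obtain r2 where r2: "sem (copyP 5 R6) (St I r1) = St I r2" "tab_post R6 5 trueF (rd 3 (map V R6)) RZero I r1 r2" by blast
  have "Rr I r2 (p, q, z) (p', q', z') =
       relax_step (I 36, I 37, I 38) (I 36, I 37, I 38) 1 (Rr I r) (p, q, z) (p', q', z')"
    if b: "p < I 2" "q < I 2" "z < I 2" "p' < I 2" "q' < I 2" "z' < I 2" for p q z p' q' z'
  proof -
    have "Rr I r2 (p, q, z) (p', q', z') = get I r1 3 [p, q, z, p', q', z']"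
      using tab_postD(1)[OF r2(2), of "[p, q, z, p', q', z']"] b by (simp add: cell_def trueF_def Rr_def)
    also have "\<dots> = cell ?f ?e1 ?e2 (I(30 := p, 31 := q, 32 := z, 33 := p', 34 := q', 35 := z')) r"
      using tab_postD(1)[OF r1(2), of "[p, q, z, p', q', z']"] b by simp
    also have "\<dots> = relax_step (I 36, I 37, I 38) (I 36, I 37, I 38) 1 (Rr I r) (p, q, z) (p', q', z')"
      by (simp add: cell_def reachE_def relax_step_def Rr_def max_def)
    finally show ?thesis .
  qed
  moreover have "sem reach_linkP (St I r) = St I r2" by (simp only: reach_linkP_def sem.simps r1(1) r2(1))
  ultimately show ?thesis using tab_postD(2)[OF r1(2)] tab_postD(2)[OF r2(2)] by (intro exI[of _ r2]) simp
qed

lemma sem_reachP: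
  assumes e: "env I r" and c: "caps I r" and w: "work_clear I"
  shows "\<exists>r'. sem reachP (St I r) = St I r' \<and> (\<forall>d. d < 16 \<longrightarrow> d \<notin> {3, 5} \<longrightarrow> get I r' d = get I r d) \<and>
    (\<forall>l\<in>lits. \<forall>k\<in>lits. Rr I r' l k = reach_closure (Lr I r) (Kr I r) l k)"
proof -
  have I2: "I 2 = bnd" using e by (rule env2)
  let ?f = "orF (FAnd (eqF 30 33) (FAnd (eqF 31 34) (eqF 32 35)))
        (exF (40, 41, 42) (FAnd (clashF (30, 31, 32) (40, 41, 42)) (clauseF (40, 41, 42) (33, 34, 35))))"
  have "\<exists>r1. sem (tab R6 5 (map V R6) ?f ROne RZero) (St I r) = St I r1 \<and> tab_post R6 5 ?f ROne RZero I r r1"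
  proof (rule tab_full)
    show "tab_indep R6 5 ?f ROne RZero I r"
      unfolding tab_indep_def
    proof (intro allI impI)
      fix js :: "nat list" and r' assume js: "length js = length R6" and f: "\<forall>d'<16. d' \<noteq> 5 \<longrightarrow> get I r' d' = get I r d'"
      obtain p q z p' q' z' where p: "js = [p, q, z, p', q', z']" using js by (auto simp: length_Suc_conv)
      have g: "get I r' 0 = get I r 0" "get I r' 1 = get I r 1" "get I r' 2 = get I r 2" "get I r' 6 = get I r 6" using f by auto
      have e': "env I r'" "caps I r'" using e c g by (auto simp: env_def caps_def)
      show "cell ?f ROne RZero (upds I R6 js) r' = cell ?f ROne RZero (upds I R6 js) r"
        unfolding p using e e' c I2 g by (simp add: cell_def) blast
    qed
  qed (use w in \<open>auto simp: tab_ok_def clean_work\<close>)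
  then obtain r1 where r1: "sem (tab R6 5 (map V R6) ?f ROne RZero) (St I r) = St I r1" "tab_post R6 5 ?f ROne RZero I r r1" by blast
  have init: "Rr I r1 (p, q, z) (p', q', z') = reach_init (Lr I r) (Kr I r) (p, q, z) (p', q', z')"
    if b: "p < bnd" "q < bnd" "z < bnd" "p' < bnd" "q' < bnd" "z' < bnd" for p q z p' q' z'
  proof -
    let ?J = "I(30 := p, 31 := q, 32 := z, 33 := p', 34 := q', 35 := z')"
    have "Rr I r1 (p, q, z) (p', q', z') = cell ?f ROne RZero ?J r"
      using tab_postD(1)[OF r1(2), of "[p, q, z, p', q', z']"] b I2 by (simp add: Rr_def)
    moreover have "fval ?f ?J r \<longleftrightarrow> (p, q, z) = (p', q', z') \<or> (\<exists>x<bnd. \<exists>y<bnd. \<exists>o'<bnd.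
        clash (Lr I r) (Kr I r) (p, q, z) (x, y, o') \<and> clause (Lr I r) (x, y, o') (p', q', z'))"
      using e c I2 by simp
    moreover have "(\<exists>x<bnd. \<exists>y<bnd. \<exists>o'<bnd. clash (Lr I r) (Kr I r) (p, q, z) (x, y, o') \<and> clause (Lr I r) (x, y, o') (p', q', z')) \<longleftrightarrow>
      (\<exists>k. clash (Lr I r) (Kr I r) (p, q, z) k \<and> clause (Lr I r) k (p', q', z'))"
      using clause_lits lits_bnd by (metis prod_cases3)
    ultimately show ?thesis by (simp add: cell_def reach_init_def)
  qed
  define act where "act js r = rmem (sem reach_linkP (St (upds I [36, 37, 38] js) r))" for js r
  have zero: "\<forall>k\<in>set R6 \<union> {100..}. (I(36 := i, 37 := j, 38 := k')) k = 0" for i j k'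
    using w by (auto simp: work_clear_def)
  have nest: "sem (nest [36, 37, 38] reach_linkP) (St I r1) = St I (fold act (tuples (I 2) (length [36::nat, 37, 38])) r1)"
    unfolding act_def
  proof (rule sem_nest_ex)
    fix js :: "nat list" and r assume "length js = length [36::nat, 37, 38]"
    then obtain i j k where "js = [i, j, k]" by (auto simp: length_Suc_conv)
    moreover obtain r' where "sem reach_linkP (St (I(36 := i, 37 := j, 38 := k)) r) = St (I(36 := i, 37 := j, 38 := k)) r'"
      using sem_reach_linkP[OF zero[of i j k], of r] by (elim exE conjE) (rule that)
    ultimately show "\<exists>r'. sem reach_linkP (St (upds I [36, 37, 38] js) r) = St (upds I [36, 37, 38] js) r'"
      by (intro exI[of _ r']) (simp only: upds.simps)
  qed (use w in \<open>auto simp: work_clear_def\<close>)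
  have len: "length [36::nat, 37, 38] = 3" by simp
  define Q where "Q r' R \<longleftrightarrow> (\<forall>d. d < 16 \<longrightarrow> d \<notin> {3, 5} \<longrightarrow> get I r' d = get I r d) \<and>
      (\<forall>p<bnd. \<forall>q<bnd. \<forall>z<bnd. \<forall>p'<bnd. \<forall>q'<bnd. \<forall>z'<bnd. Rr I r' (p, q, z) (p', q', z') = R (p, q, z) (p', q', z'))"
    for r' and R :: "lit \<Rightarrow> lit \<Rightarrow> real"
  define g where "g js = relax_step (js ! 0, js ! 1, js ! 2) (js ! 0, js ! 1, js ! 2) 1" for js :: "nat list"
  let ?T = "tuples bnd 3"
  have Q: "Q (fold act ?T r1) (fold g ?T (reach_init (Lr I r) (Kr I r)))"
  proof (rule fold_related[where Q = Q and f = act and g = g])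
    fix js r' R assume js: "js \<in> set ?T" and q: "Q r' R"
    obtain i j k where ij: "js = [i, j, k]" "i < bnd" "j < bnd" "k < bnd"
      using js by (auto simp: set_tuples numeral_3_eq_3 length_Suc_conv)
    let ?J = "I(36 := i, 37 := j, 38 := k)"
    obtain r2 where r2: "sem reach_linkP (St ?J r') = St ?J r2" "\<forall>d. d < 16 \<longrightarrow> d \<notin> {3, 5} \<longrightarrow> get ?J r2 d = get ?J r' d"
      "\<forall>p<?J 2. \<forall>q<?J 2. \<forall>z<?J 2. \<forall>p'<?J 2. \<forall>q'<?J 2. \<forall>z'<?J 2. Rr ?J r2 (p, q, z) (p', q', z') =
       relax_step (?J 36, ?J 37, ?J 38) (?J 36, ?J 37, ?J 38) 1 (Rr ?J r') (p, q, z) (p', q', z')"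
      using sem_reach_linkP[OF zero[of i j k], of r'] by blast
    have a: "act js r' = r2" using r2(1) by (simp add: act_def ij)
    have K: "Rr I r2 (p, q, z) (p', q', z') = relax_step (i, j, k) (i, j, k) 1 (Rr I r') (p, q, z) (p', q', z')"
      if "p < bnd" "q < bnd" "z < bnd" "p' < bnd" "q' < bnd" "z' < bnd" for p q z p' q' z'
      using r2(3) that I2 by simp
    have qR: "Rr I r' (p, q, z) (p', q', z') = R (p, q, z) (p', q', z')"
      if "p < bnd" "q < bnd" "z < bnd" "p' < bnd" "q' < bnd" "z' < bnd" for p q z p' q' z'
      using q that by (simp add: Q_def)
    have "Rr I r2 (p, q, z) (p', q', z') = g js R (p, q, z) (p', q', z')"
      if b: "p < bnd" "q < bnd" "z < bnd" "p' < bnd" "q' < bnd" "z' < bnd" for p q z p' q' z'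
      unfolding K[OF b] relax_step_def qR[OF b] qR[OF b(1-3) ij(2-4)] qR[OF ij(2-4) b(4-6)]
      by (simp add: g_def ij relax_step_def numeral_2_eq_2)
    then show "Q (act js r') (g js R)" using r2(2) q unfolding a by (auto simp: Q_def)
  next
    show "Q r1 (reach_init (Lr I r) (Kr I r))" using tab_postD(2)[OF r1(2)] init by (auto simp: Q_def)
  qed
  have "fold g ?T R = fold (\<lambda>z. relax_step z z 1) codes R" for R
  proof -
    have "fold g ?T R = fold (\<lambda>z. relax_step z z 1) (map (\<lambda>js. (js ! 0, js ! 1, js ! 2)) ?T) R"
      by (simp add: fold_map o_def g_def[abs_def])
    then show ?thesis by (simp only: tuples_product codes_def)
  qed
  then have RE: "fold g ?T (reach_init (Lr I r) (Kr I r)) = reach_closure (Lr I r) (Kr I r)" by (simp only: reach_closure_def)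
  have Q': "Q (fold act ?T r1) (reach_closure (Lr I r) (Kr I r))" using Q unfolding RE .
  have "sem reachP (St I r) = St I (fold act ?T r1)"
    using nest[unfolded I2 len] by (simp only: reachP_def sem.simps(4) r1(1))
  moreover have "Rr I (fold act ?T r1) l k = reach_closure (Lr I r) (Kr I r) l k" if lk: "l \<in> lits" "k \<in> lits" for l k
  proof -
    obtain p q z p' q' z' where eq: "l = (p, q, z)" "k = (p', q', z')" by (cases l; cases k)
    then have "p < bnd \<and> q < bnd \<and> z < bnd" "p' < bnd \<and> q' < bnd \<and> z' < bnd" using lk lits_bnd by auto
    then show ?thesis using conjunct2[OF Q'[unfolded Q_def]] unfolding eq by simp
  qed
  moreover have "\<forall>d. d < 16 \<longrightarrow> d \<notin> {3, 5} \<longrightarrow> get I (fold act ?T r1) d = get I r d" using Q' unfolding Q_def by blast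
  ultimately show ?thesis by blast
qed

text \<open>This table reads its own target, so \<open>tab_full\<close> does not apply; without
  indices there is a single write, and \<open>sem_tab\<close> suffices.\<close>

lemma sem_verdictP:
  assumes e: "env I r" and c: "caps I r" and w: "work_clear I"
  shows "\<exists>r'. sem verdictP (St I r) = St I r' \<and> get I r' 0 = get I r 0 \<and>
    get I r' 15 [] = (if closed_under (Lr I r) (Kr I r) \<and> consistent (Lr I r) (Kr I r) (\<lambda>l k. Rr I r l k = 1) then 1 else get I r 15 [])"
proof -
  let ?f = "FAnd closedF consistentF"
  let ?r = "r(addr I 15 [] := cell ?f ROne (rd 15 []) I r)"
  have "sem verdictP (St I r) = St I (fold (\<lambda>js r. let J = upds I [] js in
      r(addr I 15 (map (\<lambda>e. ival e (St J r)) []) := cell ?f ROne (rd 15 []) J r)) (tuples (I 2) (length ([] :: nat list))) r)"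
    unfolding verdictP_def by (rule sem_tab) (use w in \<open>auto simp: work_clear_def\<close>)
  then have "sem verdictP (St I r) = St I ?r" by (simp add: Let_def del: fun_upd_apply)
  moreover have "get I ?r 0 = get I r 0"
    using addr_inj(1)[of 0 15 I _ "[]"] by (auto simp: get_def fun_eq_iff)
  moreover have "get I ?r 15 [] = cell ?f ROne (rd 15 []) I r" by (simp add: get_def)
  ultimately show ?thesis using e c by (intro exI[of _ ?r]) (simp add: cell_def)
qed

lemma sem_guessP:
  assumes e: "env I r" and w: "work_clear I" and G: "\<And>k. k < 30 \<Longrightarrow> 10 \<le> k \<Longrightarrow> I k < bnd"
  shows "\<exists>r'. sem guessP (St I r) = St I r' \<and> get I r' 0 = get I r 0 \<and> (\<exists>L. get I r' 15 [] = (if accepts L then 1 else get I r 15 []) \<and>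
    L = lower I (offset I (link_closure (lower I (offset I (Kr I r 0))) 0)))"
proof -
  let ?L1 = "lower I (offset I (Kr I r 0))"
  let ?L2 = "lower I (offset I (link_closure ?L1 0))"
  have b0: "0 < bnd" using bnd_gt by simp
  obtain r1 where r1: "sem stageP (St I r) = St I r1" "get I r1 0 = get I r 0" "get I r1 15 = get I r 15"
    "\<forall>t<3. \<forall>u<bnd. Lr I r1 t u = ?L1 t u" "\<forall>t<bnd. \<forall>u<bnd. \<forall>v<bnd. Kr I r1 t u v = link_closure (Lr I r1) t u v"
    using sem_stageP[OF e w G] by blast
  have e1: "env I r1" using env_frame[OF r1(2)] e by simp
  obtain r2 where r2: "sem stageP (St I r1) = St I r2" "get I r2 0 = get I r1 0" "get I r2 15 = get I r1 15"
    "\<forall>t<3. \<forall>u<bnd. Lr I r2 t u = lower I (offset I (Kr I r1 0)) t u" "\<forall>t<bnd. \<forall>u<bnd. \<forall>v<bnd. Kr I r2 t u v = link_closure (Lr I r2) t u v"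
    using sem_stageP[OF e1 w G] by blast
  have e2: "env I r2" using env_frame[OF r2(2)] e1 by simp
  have K1: "link_closure (Lr I r1) = link_closure ?L1" by (rule link_closure_cong_bnd) (use r1(4) in auto)
  have "offset I (Kr I r1 0) t = offset I (link_closure ?L1 0) t" for t
    using r1(5) b0 G unfolding K1 offset_def by simp
  then have L2: "Lr I r2 t u = ?L2 t u" if "t < 3" "u < bnd" for t u
    using r2(4) that by (simp add: lower_def)
  have K2: "Kr I r2 t u v = link_closure ?L2 t u v" if "t < 3" "u < bnd" "v < bnd" for t u v
  proof -
    have "link_closure (Lr I r2) = link_closure ?L2" by (rule link_closure_cong_bnd) (use L2 in auto)
    then show ?thesis using r2(5) that bnd_gt by auto
  qed
  obtain r3 where r3: "sem capP (St I r2) = St I r3" "\<forall>d. d < 16 \<longrightarrow> d \<noteq> 6 \<longrightarrow> get I r3 d = get I r2 d" "caps I r3"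
    using sem_capP[OF e2 w] by blast
  have e3: "env I r3" using env_frame[of I r3 r2] r3(2) e2 by simp
  obtain r4 where r4: "sem reachP (St I r3) = St I r4" "\<forall>d. d < 16 \<longrightarrow> d \<notin> {3, 5} \<longrightarrow> get I r4 d = get I r3 d"
    "\<forall>l\<in>lits. \<forall>k\<in>lits. Rr I r4 l k = reach_closure (Lr I r3) (Kr I r3) l k"
    using sem_reachP[OF e3 r3(3) w] by blast
  have e4: "env I r4" using env_frame[of I r4 r3] r4(2) e3 by simp
  have g4: "get I r4 1 = get I r2 1" "get I r4 2 = get I r2 2" "get I r4 6 = get I r3 6" "get I r3 1 = get I r2 1" "get I r3 2 = get I r2 2"
    "get I r4 15 = get I r 15" "get I r4 0 = get I r 0"
    using r4(2) r3(2) r2(2,3) r1(2,3) by simp_all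
  have c4: "caps I r4" using r3(3) g4 by (simp add: caps_def)
  obtain r5 where r5: "sem verdictP (St I r4) = St I r5" "get I r5 0 = get I r4 0"
    "get I r5 15 [] = (if closed_under (Lr I r4) (Kr I r4) \<and> consistent (Lr I r4) (Kr I r4) (\<lambda>l k. Rr I r4 l k = 1) then 1 else get I r4 15 [])"
    using sem_verdictP[OF e4 c4 w] by blast
  have "consistent (Lr I r4) (Kr I r4) (\<lambda>l k. Rr I r4 l k = 1) \<longleftrightarrow>
      consistent (Lr I r2) (Kr I r2) (\<lambda>l k. reach_closure (Lr I r2) (Kr I r2) l k = 1)"
    using r4(3) unfolding consistent_def g4 by simp
  then have "closed_under (Lr I r4) (Kr I r4) \<and> consistent (Lr I r4) (Kr I r4) (\<lambda>l k. Rr I r4 l k = 1) \<longleftrightarrow> accepts_with (Lr I r2) (Kr I r2)"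
    unfolding accepts_with_def g4 by simp
  also have "\<dots> \<longleftrightarrow> accepts_with ?L2 (link_closure ?L2)" by (rule accepts_with_cong) (use L2 K2 in auto)
  also have "\<dots> \<longleftrightarrow> accepts ?L2" by (simp add: accepts_with_def accepts_def)
  finally have "get I r5 15 [] = (if accepts ?L2 then 1 else get I r 15 [])" using r5(3) g4 by simp
  moreover have "sem guessP (St I r) = St I r5" by (simp only: guessP_def sem.simps r1(1) r2(1) r3(1) r4(1) r5(1))
  ultimately show ?thesis using r5(2) g4(7) by (intro exI[of _ r5]) auto
qed

end

section \<open>Running over all guesses\<close>

text \<open>A nest becomes a fold only if its body restores the registers on every real memory, also
  on those that violate \<open>env\<close>.\<close>

definition pure_at :: "prog \<Rightarrow> (nat \<Rightarrow> nat) \<Rightarrow> bool" where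
  "pure_at p I \<longleftrightarrow> (\<forall>r. \<exists>r'. sem p (St I r) = St I r')"

lemma pure_tab: "tab_ok ks d idx f e1 e2 \<Longrightarrow> clean I ks f \<Longrightarrow> pure_at (tab ks d idx f e1 e2) I"
  unfolding pure_at_def by (intro allI exI, rule sem_tab) (auto simp: tab_ok_def clean_def)

lemma pure_seq: "pure_at p I \<Longrightarrow> pure_at q I \<Longrightarrow> pure_at (PSeq p q) I"
  unfolding pure_at_def by (metis sem.simps(4))

lemma pure_nest:
  assumes "distinct ks" "2 \<notin> set ks" "\<And>k. k \<in> set ks \<Longrightarrow> I k = 0"
    and "\<And>js. length js = length ks \<Longrightarrow> pure_at b (upds I ks js)"
  shows "pure_at (nest ks b) I"
  unfolding pure_at_def
proof
  fix r
  have "sem (nest ks b) (St I r) = St I (fold (\<lambda>js r. rmem (sem b (St (upds I ks js) r))) (tuples (I 2) (length ks)) r)"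
    by (rule sem_nest_ex) (use assms in \<open>auto simp: pure_at_def\<close>)
  then show "\<exists>r'. sem (nest ks b) (St I r) = St I r'" by blast
qed

context bipartite_form
begin

lemma accepts_cong:
  assumes "\<And>s u. s < 3 \<Longrightarrow> u < bnd \<Longrightarrow> L s u = L' s u"
  shows "accepts L = accepts L'"
proof -
  have "link_closure L = link_closure L'" by (rule link_closure_cong_bnd) (rule assms)
  moreover have "accepts_with L (link_closure L') = accepts_with L' (link_closure L')" by (rule accepts_with_cong) (auto simp: assms)
  ultimately show ?thesis by (simp add: accepts_with_def accepts_def)
qed

lemma work_clear_upds: "work_clear I \<Longrightarrow> \<forall>k\<in>set ks. k < 30 \<Longrightarrow> work_clear (upds I ks js)"
  unfolding work_clear_def by (metis not_less upds_other)

lemma pure_guessP: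
  assumes w: "work_clear I"
  shows "pure_at guessP I"
proof -
  have linkw: "clean (upds I [36, 37] js) ks f" if "\<forall>k\<in>bound_regs f \<union> set ks. 30 \<le> k \<and> k \<noteq> 36 \<and> k \<noteq> 37" for js ks f
    using w that upds_other[of _ "[36, 37]" I js] by (auto simp: clean_def work_clear_def)
  have reachw: "clean (upds I [36, 37, 38] js) ks f" if "\<forall>k\<in>bound_regs f \<union> set ks. 30 \<le> k \<and> k \<noteq> 36 \<and> k \<noteq> 37 \<and> k \<noteq> 38" for js ks f
    using w that upds_other[of _ "[36, 37, 38]" I js] by (auto simp: clean_def work_clear_def)
  have n1: "pure_at (nest [36, 37] linkP) I"
  proof (rule pure_nest)
    fix js :: "nat list"
    show "pure_at linkP (upds I [36, 37] js)"
      unfolding linkP_def copyP_def by (intro pure_seq pure_tab linkw) (auto simp: tab_ok_def)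
  qed (use w in \<open>auto simp: work_clear_def\<close>)
  have n2: "pure_at (nest [36, 37, 38] reach_linkP) I"
  proof (rule pure_nest)
    fix js :: "nat list"
    show "pure_at reach_linkP (upds I [36, 37, 38] js)"
      unfolding reach_linkP_def copyP_def by (intro pure_seq pure_tab reachw) (auto simp: tab_ok_def)
  qed (use w in \<open>auto simp: work_clear_def\<close>)
  show ?thesis
    unfolding guessP_def stageP_def lowP_def closureP_def capP_def reachP_def verdictP_def
    by (intro pure_seq n1 n2 pure_tab clean_work[OF w]) (auto simp: tab_ok_def)
qed

lemma sem_entryP:
  assumes I: "I 0 = m" "I 1 = n" "I 2 = bnd" and w: "work_clear I"
    and inp: "\<And>i j. i < m \<Longrightarrow> j < n \<Longrightarrow> r (i * n + j) = a i (m + j)"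
    and zero: "\<And>u v. \<not> opp u v \<Longrightarrow> a u v = 0"
  shows "\<exists>r'. sem entryP (St I r) = St I r' \<and> env I r' \<and> get I r' 15 = get I r 15"
proof -
  have lt: "i * n + (j - m) < m * n" if "i < m" "m \<le> j" "j < m + n" for i j
  proof -
    have "i * n + (j - m) < i * n + n" using that by simp
    also have "\<dots> \<le> m * n" using that mult_le_mono1[of "Suc i" m n] by simp
    finally show ?thesis .
  qed
  have inp': "r (i * n + (j - m)) = a i j" if "i < m" "m \<le> j" "j < m + n" for i j
  proof -
    have "j - m < n" "m + (j - m) = j" using that by linarith+
    then show ?thesis using inp[OF that(1), of "j - m"] by simp
  qed
  let ?f1 = "FAnd (rowF 31) (FAnd (FNot (rowF 30)) (vtxF 30))" and ?f2 = "FAnd (rowF 30) (FAnd (FNot (rowF 31)) (vtxF 31))"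
  let ?e1 = "RCell (IAdd (IMul (V 31) (V 1)) (ISub (V 30) (V 0)))" and ?e2 = "RCell (IAdd (IMul (V 30) (V 1)) (ISub (V 31) (V 0)))"
  have "\<exists>r1. sem (tab [30, 31] 7 [V 30, V 31] ?f1 ?e1 RZero) (St I r) = St I r1 \<and> tab_post [30, 31] 7 ?f1 ?e1 RZero I r r1"
    by (rule tab_full) (use w lt I in \<open>auto simp: tab_ok_def clean_work tab_indep_def cell_def length_Suc_conv rowF_def vtxF_def\<close>)
  then obtain r1 where r1: "sem (tab [30, 31] 7 [V 30, V 31] ?f1 ?e1 RZero) (St I r) = St I r1" "tab_post [30, 31] 7 ?f1 ?e1 RZero I r r1"
    by blast
  have low1: "r1 l = r l" if "l < m * n" for l using r1(2) that I by (simp add: tab_post_def)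
  have "\<exists>r2. sem (tab [30, 31] 0 [V 30, V 31] ?f2 ?e2 (rd 7 [V 30, V 31])) (St I r1) = St I r2 \<and>
      tab_post [30, 31] 0 ?f2 ?e2 (rd 7 [V 30, V 31]) I r1 r2"
    by (rule tab_full) (use w lt I in \<open>auto simp: tab_ok_def clean_work tab_indep_def cell_def length_Suc_conv rowF_def vtxF_def\<close>)
  then obtain r2 where r2: "sem (tab [30, 31] 0 [V 30, V 31] ?f2 ?e2 (rd 7 [V 30, V 31])) (St I r1) = St I r2"
    "tab_post [30, 31] 0 ?f2 ?e2 (rd 7 [V 30, V 31]) I r1 r2" by blast
  have "get I r2 0 [u, v] = a u v" if uv: "u < bnd" "v < bnd" for u v
  proof -
    have 7: "get I r1 7 [u, v] = (if v < m \<and> m \<le> u \<and> u < m + n then r (v * n + (u - m)) else 0)"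
      using tab_postD(1)[OF r1(2), of "[u, v]"] uv I by (simp add: cell_def rowF_def vtxF_def not_less)
    have 0: "get I r2 0 [u, v] = (if u < m \<and> m \<le> v \<and> v < m + n then r1 (u * n + (v - m)) else get I r1 7 [u, v])"
      using tab_postD(1)[OF r2(2), of "[u, v]"] uv I by (simp add: cell_def rowF_def vtxF_def not_less)
    show ?thesis
    proof (cases "opp u v")
      case True
      then consider "u < m" "m \<le> v" "v < m + n" | "v < m" "m \<le> u" "u < m + n" unfolding opp_def by linarith
      then show ?thesis
      proof cases
        case 1
        then show ?thesis using 0 low1[OF lt[OF 1]] inp'[OF 1] by simp
      next
        case 2
        then show ?thesis using 0 7 inp'[OF 2] a_sym[of u v] by simp
      qed
    next
      case False
      then have no: "\<not> (u < m \<and> m \<le> v \<and> v < m + n)" "\<not> (v < m \<and> m \<le> u \<and> u < m + n)" by (auto simp: opp_def)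
      show ?thesis unfolding 0 7 by (simp only: no if_False zero[OF False])
    qed
  qed
  moreover have "sem entryP (St I r) = St I r2" by (simp only: entryP_def sem.simps r1(1) r2(1))
  ultimately show ?thesis
    using I tab_postD(2)[OF r1(2), of 15] tab_postD(2)[OF r2(2), of 15] by (intro exI[of _ r2]) (simp add: env_def)
qed

text \<open>Acceptance of any guess is sound, and the guess from \<open>guess_exists\<close> is
  accepted whatever closure array 2 still holds from the guess before it.\<close>

lemma sem_guess_loop:
  assumes e: "env I r" and w: "\<And>k. 10 \<le> k \<Longrightarrow> I k = 0" and z: "get I r 15 [] = 0"
  shows "\<exists>r'. sem (nest guess_regs guessP) (St I r) = St I r' \<and> env I r' \<and> (get I r' 15 [] = 1 \<longleftrightarrow> (\<exists>U. covers U))"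
proof -
  define act where "act js r = rmem (sem guessP (St (upds I guess_regs js) r))" for js r
  have I2: "I 2 = bnd" using e by (rule env2)
  have wc: "work_clear I" using w by (simp add: work_clear_def)
  have set: "set guess_regs = {10..<30}" by (simp only: guess_regs_def set_upt)
  then have "\<forall>k\<in>set guess_regs. 2 < k \<and> k < 30" by simp
  moreover have "length guess_regs = 20" "distinct guess_regs"
    by (simp_all only: guess_regs_def distinct_upt length_upt)
  ultimately have regs: "distinct guess_regs" "\<forall>k\<in>set guess_regs. 2 < k \<and> k < 30" "length guess_regs = 20" "set guess_regs = {10..<30}"
    using set by blast+
  have wu: "work_clear (upds I guess_regs js)" for js using work_clear_upds[OF wc] regs by blast
  have "sem (nest guess_regs guessP) (St I r) = St I (fold act (tuples (I 2) (length guess_regs)) r)"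
    unfolding act_def
    by (rule sem_nest_ex) (use regs w pure_guessP[OF wu] in \<open>auto simp: pure_at_def\<close>)
  then have sem: "sem (nest guess_regs guessP) (St I r) = St I (fold act (tuples bnd 20) r)" by (simp only: I2 regs(3))
  define LJ where "LJ js K = lower (upds I guess_regs js) (offset (upds I guess_regs js) (link_closure (lower (upds I guess_regs js) (offset (upds I guess_regs js) K)) 0))" for js K
  have step: "env I (act js r1) \<and> (\<exists>K. get I (act js r1) 15 [] = (if accepts (LJ js K) then 1 else get I r1 15 []))"
    if js: "js \<in> set (tuples bnd 20)" and e1: "env I r1" for js r1
  proof -
    let ?J = "upds I guess_regs js"
    have len: "length js = length guess_regs" "set js \<subseteq> {..<bnd}" using js regs by (auto simp: set_tuples)
    have J: "map ?J guess_regs = js" by (rule upds_V[OF regs(1) len(1)])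
    have "?J k < bnd" if "k < 30" "10 \<le> k" for k
    proof -
      have "?J k \<in> set (map ?J guess_regs)" using that regs(4) by auto
      then show ?thesis using J len(2) by auto
    qed
    moreover have g: "get ?J = get I" by (rule get_upds) (use regs in auto)
    moreover have o: "?J 0 = I 0" "?J 1 = I 1" "?J 2 = I 2" by (rule upds_other; use regs in force)+
    then have "env ?J r1" using e1 unfolding env_def g by simp
    ultimately obtain r2 where r2: "sem guessP (St ?J r1) = St ?J r2" "get ?J r2 0 = get ?J r1 0"
      "get ?J r2 15 [] = (if accepts (LJ js (Kr ?J r1 0)) then 1 else get ?J r1 15 [])"
      using sem_guessP[of ?J r1, OF _ wu[of js]] unfolding LJ_def by blast
    have "act js r1 = r2" by (simp add: act_def r2(1))
    moreover have "env I r2" using env_frame[of I r2 r1] r2(2) e1 unfolding g by simp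
    ultimately show ?thesis using r2(3) unfolding g by auto
  qed
  \<comment> \<open>A value 1 in array 15 is backed by an accepted \<open>L\<close> and never lost.
    The guess has to be good for all \<open>K\<close> since the closure left behind by its
    predecessor is unknown.\<close>
  have inv: "env I (fold act xs r1) \<and> (get I (fold act xs r1) 15 [] = 0 \<or> get I (fold act xs r1) 15 [] = 1 \<and> (\<exists>L. accepts L)) \<and>
      ((\<exists>js\<in>set xs. \<forall>K. accepts (LJ js K)) \<or> get I r1 15 [] = 1 \<longrightarrow> get I (fold act xs r1) 15 [] = 1)"
    if "set xs \<subseteq> set (tuples bnd 20)" "env I r1" "get I r1 15 [] = 0 \<or> get I r1 15 [] = 1 \<and> (\<exists>L. accepts L)" for xs r1
    using that
  proof (induction xs arbitrary: r1)
    case (Cons js xs)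
    obtain K where s: "env I (act js r1)" "get I (act js r1) 15 [] = (if accepts (LJ js K) then 1 else get I r1 15 [])"
      using step[of js r1] Cons.prems by auto
    have "get I (act js r1) 15 [] = 0 \<or> get I (act js r1) 15 [] = 1 \<and> (\<exists>L. accepts L)" using s(2) Cons.prems(3) by auto
    from Cons.IH[OF _ s(1) this] Cons.prems(1) s(2) show ?case by auto
  qed auto
  let ?r = "fold act (tuples bnd 20) r"
  have res: "env I ?r" "get I ?r 15 [] = 0 \<or> get I ?r 15 [] = 1 \<and> (\<exists>L. accepts L)"
    "(\<exists>js\<in>set (tuples bnd 20). \<forall>K. accepts (LJ js K)) \<Longrightarrow> get I ?r 15 [] = 1"
    using inv[of "tuples bnd 20" r] e z by auto
  have "get I ?r 15 [] = 1 \<longleftrightarrow> (\<exists>U. covers U)"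
  proof
    assume "get I ?r 15 [] = 1"
    then obtain L where "accepts L" using res(2) by auto
    then show "\<exists>U. covers U" using accepts_sound by blast
  next
    assume "\<exists>U. covers U"
    then obtain G where G: "\<forall>k. G k < m + n" "\<forall>K0. accepts (lower G (offset G (link_closure (lower G (offset G K0)) 0)))"
      using guess_exists by blast
    define js where "js = map G guess_regs"
    let ?J = "upds I guess_regs js"
    have js: "js \<in> set (tuples bnd 20)" using G(1) regs bnd_gt(2) by (auto simp: set_tuples js_def intro: less_trans)
    have "map ?J guess_regs = map G guess_regs" using upds_V[OF regs(1), of js I] by (simp add: js_def)
    then have J: "?J k = G k" if "10 \<le> k" "k < 30" for k using that regs(4) by auto
    have offset: "offset ?J K t = offset G K t" if "t < 3" for K t using that J by (auto simp: offset_def)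
    have lower: "lower ?J th t u = lower G th' t u" if "t < 3" "th t = th' t" for th th' t u using that J by (simp add: lower_def)
    have K: "link_closure (lower ?J (offset ?J K)) = link_closure (lower G (offset G K))" for K by (rule link_closure_cong_bnd) (simp add: lower offset)
    have "accepts (LJ js K)" for K
    proof -
      have "accepts (LJ js K) = accepts (lower G (offset G (link_closure (lower G (offset G K)) 0)))"
        unfolding LJ_def K by (rule accepts_cong) (simp add: lower offset)
      then show ?thesis using G(2) by simp
    qed
    then show "get I ?r 15 [] = 1" using res(3) js by blast
  qed
  then show ?thesis using sem res(1) by blast
qed

end

section \<open>The decision and its running time\<close>

lemma sem_mainP:
  assumes m: "0 < dim_row A" "0 < dim_col A"
    and I: "I = (\<lambda>_. 0)(0 := dim_row A, 1 := dim_col A, 2 := dim_row A + dim_col A + 3)"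
    and r: "r = rmem (input_state A)"
  shows "imem (sem mainP (St I r)) 0 = (if factor_rank A = 3 then 1 else 0)"
proof -
  let ?m = "dim_row A" and ?n = "dim_col A"
  interpret bipartite_form ?m ?n "entry A" by unfold_locales (use m entry_sym in auto)
  have I0: "I 0 = ?m" "I 1 = ?n" "I 2 = bnd" and I3: "\<And>k. 3 \<le> k \<Longrightarrow> I k = 0" by (auto simp: I bnd_def)
  have "\<exists>r1. sem entryP (St I r) = St I r1 \<and> env I r1 \<and> get I r1 15 = get I r 15"
  proof (rule sem_entryP[OF I0])
    show "r (i * ?n + j) = entry A i (?m + j)" if ij: "i < ?m" "j < ?n" for i j
    proof -
      have "i * ?n + j < i * ?n + ?n" using ij by simp
      also have "\<dots> \<le> ?m * ?n" using ij mult_le_mono1[of "Suc i" ?m ?n] by simp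
      finally show ?thesis using ij by (simp add: r input_state_def entry_def)
    qed
    show "entry A u v = 0" if "\<not> opp u v" for u v using that by (auto simp: entry_def opp_def)
  qed (use I3 in \<open>auto simp: work_clear_def\<close>)
  then obtain r1 where r1: "sem entryP (St I r) = St I r1" "env I r1" "get I r1 15 = get I r 15" by blast
  have "get I r1 15 [] = 0" using r1(3) I0 by (simp add: get_def addr_def r input_state_def)
  then obtain r2 where r2: "sem (nest guess_regs guessP) (St I r1) = St I r2" "env I r2" "get I r2 15 [] = 1 \<longleftrightarrow> (\<exists>U. covers U)"
    using sem_guess_loop[OF r1(2)] I3 by auto
  have t: "sem (test twoF 100) (St I r2) = St (I(100 := (if fval twoF I r2 then 1 else 0))) r2"
  proof (rule sem_test)
    show "\<forall>k\<in>bound_regs twoF. I k = 0"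
    proof
      fix k assume "k \<in> bound_regs twoF"
      then have "2 < k" using fplain_bound_regs[of twoF k] by simp
      then show "I k = 0" using I3 by simp
    qed
  qed (use I3 in auto)
  have two: "fval twoF I r2 \<longleftrightarrow> factorizable A 2"
    unfolding fval_two[OF r2(2)] factorizable_2_iff[OF m] two_columns_def Let_def ..
  have "factor_rank A = 3 \<longleftrightarrow> get I r2 15 [] = 1 \<and> \<not> fval twoF I r2"
    unfolding factor_rank_3_iff factorizable_3_iff[OF m] two r2(3) ..
  then show ?thesis
    by (simp add: mainP_def r1(1) r2(1) t)
qed

theorem theorem4p5:
  "\<exists>c :: com. decides_in_poly_time c (\<lambda>A. factor_rank A = 3)"
proof -
  let ?set = "IAssign (Num 2) (IAdd (IAdd (V 0) (V 1)) (Num 3))"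
  obtain K d where Kd: "\<And>B. cost mainP B \<le> K * (B + 1) ^ d" using cost_poly by blast
  have "decides_in_poly_time (Seq ?set (compile mainP)) (\<lambda>A. factor_rank A = 3)"
    unfolding decides_in_poly_time_def
  \<comment> \<open>Setting register 2 costs 9. The loop bound is \<open>m + n + 3\<close>, and
    \<open>m + n + 4\<close> is at most \<open>3 * (m + n)\<close> because \<open>m + n\<close> is
    at least 2.\<close>
  proof (rule exI[of _ "K * 3 ^ d + 9"], rule exI[of _ d], intro allI impI ballI)
    fix m n and A :: "real mat" assume mn: "1 \<le> m" "1 \<le> n" and A: "A \<in> carrier_mat m n"
    define I where "I = (\<lambda>_ :: nat. 0 :: nat)(0 := m, 1 := n, 2 := m + n + 3)"
    define r where "r = rmem (input_state A)"
    have dim: "dim_row A = m" "dim_col A = n" using A by auto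
    have e1: "exec ?set (input_state A) 9 (St I r)"
    proof -
      have "(input_state A)\<lparr>imem := (imem (input_state A))(2 := ival (IAdd (IAdd (V 0) (V 1)) (Num 3)) (input_state A))\<rparr> = St I r"
        by (simp add: input_state_def I_def r_def dim)
      then show ?thesis
        using exec_cost_eq[OF exec.IAssign[of "Num 2" "IAdd (IAdd (V 0) (V 1)) (Num 3)" "input_state A"], of 9] by simp
    qed
    have "imem (St I r) 2 = m + n + 3" by (simp add: I_def)
    then obtain t where t: "t \<le> cost mainP (m + n + 3)" "exec (compile mainP) (St I r) t (sem mainP (St I r))"
      using exec_compile asg_main by blast
    have "imem (sem mainP (St I r)) 0 = (if factor_rank A = 3 then 1 else 0)"
      by (rule sem_mainP) (use mn in \<open>simp_all add: dim I_def r_def\<close>)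
    moreover have "9 + t \<le> (K * 3 ^ d + 9) * (m + n) ^ d"
    proof -
      have "t \<le> K * (m + n + 4) ^ d" using order_trans[OF t(1) Kd] by (simp add: eval_nat_numeral)
      also have "\<dots> \<le> K * (3 * (m + n)) ^ d" using mn by (intro mult_left_mono power_mono) auto
      finally have "t \<le> K * 3 ^ d * (m + n) ^ d" by (simp only: power_mult_distrib mult.assoc)
      moreover have "9 \<le> 9 * (m + n) ^ d" using mn by simp
      ultimately show ?thesis unfolding add_mult_distrib by linarith
    qed
    ultimately show "\<exists>t s. exec (Seq ?set (compile mainP)) (input_state A) t s \<and> t \<le> (K * 3 ^ d + 9) * (m + n) ^ d \<and>
        imem s 0 = (if factor_rank A = 3 then 1 else 0)"
      using exec.Seq[OF e1 t(2)] by blast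
  qed
  then show ?thesis by blast
qed

end
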